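(* Let $M$ be a compact, connected, smooth manifold without boundary supporting a smooth, almost free action of a compact, connected Lie group $K$, and let $N=M/K$. Suppose that the transgression $P^{\bullet}_K \to H^{\bullet +1}(M_K,\mathbb{C}) \cong H^{\bullet +1}(M/K,\mathbb{C})$ is injective in degree $1$ (i.e., on $P_K^1$). Let $p_\sharp\colon \pi_1(M)\twoheadrightarrow \pi_1^{\mathrm{orb}}(N)$ be the natural epimorphism induced by the projection $p\colon M\to M/K$. Then the following hold. (1) If the orbit space $N=M/K$ has a $2$-finite $2$-model, then $p_{\sharp}$ induces a local analytic isomorphism between $\mathcal{V}^1_s (\pi_1 (M))_{(1)}$ and $\mathcal{V}^1_s (\pi_1^{\mathrm{orb}} (N))_{(1)}$, for all $s$. (2) If $N$ is $2$-formal, then $p_{\sharp}$ induces an analytic isomorphism between the germs at $1$ of $\operatorname{Hom} (\pi_1 (M), G)$ and $\operatorname{Hom} (\pi_1^{\mathrm{orb}} (N), G)$, for $G=\operatorname{SL}_2 (\mathbb{C})$ or a Borel subgroup thereof.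
   Context: The action is almost free if all isotropy groups are finite. Write $H^\bullet(K,\mathbb{C})=\bigwedge P_K^\bullet$, where $P_K$ is the oddly-graded vector space spanned by the (universally transgressive) generators. $M_K=(EK\times M)/K$ is the Borel construction, and the transgression $P_K^\bullet\to H^{\bullet+1}(M_K,\mathbb{C})$ is that of the principal bundle $K\to EK\times M\to M_K$. For an almost free action, the map $M_K\to M/K$ induced by projection induces an isomorphism $H^\bullet(M/K,\mathbb{C})\cong H^\bullet(M_K,\mathbb{C})$. The orbit space $M/K$ is an orbifold; its orbifold fundamental group $\pi_1^{\mathrm{orb}}(M/K)$ can be identified with $\pi_1(M_K)$, and $p_\sharp$ with the epimorphism induced by $M\simeq EK\times M\to M_K$. A cdga is a commutative differential graded algebra over $\mathbb{C}$; it is $2$-finite if $A^0=\mathbb{C}$ and $A^1,A^2$ are finite-dimensional. A $2$-equivalence is a cdga map inducing isomorphisms in cohomology in degrees $\le2$ and a monomorphism in degree $3$. A cdga $A$ is a $2$-model for $X$ if it is connected by a zig-zag of $2$-equivalences to Sullivan's algebra $\Omega^\bullet(X)$ of piecewise polynomial $\mathbb{C}$-forms; $X$ is $2$-formal if $(H^\bullet(X,\mathbb{C}),d=0)$ is a $2$-model for $X$. For a finitely generated group $\pi$, $\mathcal{V}^1_s(\pi)=\{\rho\in\operatorname{Hom}(\pi,\mathbb{C}^* )\mid \dim_{\mathbb{C}} H^1(\pi,\mathbb{C}_\rho)\ge s\}$, a Zariski closed subset of the character group. For an affine variety $\mathcal{X}$ and $x\in\mathcal{X}$, $\mathcal{X}_{(x)}$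 is the reduced analytic germ at $x$; $1$ is the trivial representation. An epimorphism $f\colon\pi_1\twoheadrightarrow\pi_2$ induces by precomposition closed embeddings $\operatorname{Hom}(\pi_2,G)\hookrightarrow\operatorname{Hom}(\pi_1,G)$ and $\mathcal{V}^1_s(\pi_2)\hookrightarrow\mathcal{V}^1_s(\pi_1)$; "induces" refers to these maps. *)

theory Defs
  imports "HOL-Analysis.Analysis" "HOL-Algebra.Module" "HOL-Algebra.AbelCoset"
    "HOL-Algebra.Group_Action" "HOL-Algebra.Solvable_Groups" "HOL-Homology.Homology"
begin

section \<open>Smooth manifolds\<close>

text \<open>\<open>Ck n S k f\<close>: on the open set \<open>S\<close> of the space \<open>Euclidean_space n\<close> (whose points are
  the sequences vanishing from index \<open>n\<close> on), all iterated partial derivatives of \<open>f\<close> of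
  order at most \<open>k\<close> exist and are continuous.\<close>

primrec Ck :: "nat \<Rightarrow> (nat \<Rightarrow> real) set \<Rightarrow> nat \<Rightarrow> ((nat \<Rightarrow> real) \<Rightarrow> real) \<Rightarrow> bool" where
  "Ck n S 0 f \<longleftrightarrow> continuous_map (subtopology (Euclidean_space n) S) euclideanreal f"
| "Ck n S (Suc k) f \<longleftrightarrow>
     continuous_map (subtopology (Euclidean_space n) S) euclideanreal f \<and>
     (\<forall>i<n. \<exists>g. (\<forall>x\<in>S. ((\<lambda>t. f (x(i := t))) has_real_derivative g x) (at (x i))) \<and> Ck n S k g)"

definition smooth_vec :: "nat \<Rightarrow> nat \<Rightarrow> (nat \<Rightarrow> real) set \<Rightarrow> ((nat \<Rightarrow> real) \<Rightarrow> (nat \<Rightarrow> real)) \<Rightarrow> bool" where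
  "smooth_vec n m S F \<longleftrightarrow> (\<forall>j<m. \<forall>k. Ck n S k (\<lambda>x. F x j))"

record 'a mfd =
  mtop :: "'a topology"
  dimension :: nat
  atlas :: "('a set \<times> ('a \<Rightarrow> nat \<Rightarrow> real)) set"

text \<open>Charts take values in open subsets of the whole Euclidean space, so there is no boundary.
  Dimension 0 is allowed.\<close>

definition smooth_manifold :: "'a mfd \<Rightarrow> bool" where
  "smooth_manifold M \<longleftrightarrow>
     Hausdorff_space (mtop M) \<and> second_countable (mtop M) \<and>
     topspace (mtop M) \<subseteq> \<Union>(fst ` atlas M) \<and>
     (\<forall>(U, \<phi>) \<in> atlas M.
        openin (mtop M) U \<and> openin (Euclidean_space (dimension M)) (\<phi> ` U) \<and>
        homeomorphic_map (subtopology (mtop M) U)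
          (subtopology (Euclidean_space (dimension M)) (\<phi> ` U)) \<phi>) \<and>
     (\<forall>(U, \<phi>) \<in> atlas M. \<forall>(V, \<psi>) \<in> atlas M.
        smooth_vec (dimension M) (dimension M) (\<phi> ` (U \<inter> V)) (\<psi> \<circ> inv_into U \<phi>))"

definition smooth_map :: "'a mfd \<Rightarrow> 'b mfd \<Rightarrow> ('a \<Rightarrow> 'b) \<Rightarrow> bool" where
  "smooth_map M N f \<longleftrightarrow>
     continuous_map (mtop M) (mtop N) f \<and>
     (\<forall>(U, \<phi>) \<in> atlas M. \<forall>(V, \<psi>) \<in> atlas N.
        smooth_vec (dimension M) (dimension N) (\<phi> ` (U \<inter> f -` V)) (\<psi> \<circ> f \<circ> inv_into U \<phi>))"

definition prod_mfd :: "'a mfd \<Rightarrow> 'b mfd \<Rightarrow> ('a \<times> 'b) mfd" where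
  "prod_mfd M N = \<lparr>
     mtop = prod_topology (mtop M) (mtop N),
     dimension = dimension M + dimension N,
     atlas = {(U \<times> V, \<lambda>(x, y) i. if i < dimension M then \<phi> x i else \<psi> y (i - dimension M))
              | U \<phi> V \<psi>. (U, \<phi>) \<in> atlas M \<and> (V, \<psi>) \<in> atlas N}\<rparr>"

definition closed_connected_manifold :: "'a mfd \<Rightarrow> bool" where
  "closed_connected_manifold M \<longleftrightarrow>
     smooth_manifold M \<and> compact_space (mtop M) \<and> connected_space (mtop M)"


section \<open>Lie groups, actions, Borel construction\<close>

definition lie_group :: "'k monoid \<Rightarrow> 'k mfd \<Rightarrow> bool" where
  "lie_group K T \<longleftrightarrow>
     group K \<and> carrier K = topspace (mtop T) \<and> smooth_manifold T \<and>
     smooth_map (prod_mfd T T) T (\<lambda>(x, y). x \<otimes>\<^bsub>K\<^esub> y) \<and> smooth_map T T (\<lambda>x. inv\<^bsub>K\<^esub> x)"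

definition compact_connected_lie_group :: "'k monoid \<Rightarrow> 'k mfd \<Rightarrow> bool" where
  "compact_connected_lie_group K T \<longleftrightarrow>
     lie_group K T \<and> compact_space (mtop T) \<and> connected_space (mtop T)"

definition smooth_action :: "'k monoid \<Rightarrow> 'k mfd \<Rightarrow> 'm mfd \<Rightarrow> ('k \<Rightarrow> 'm \<Rightarrow> 'm) \<Rightarrow> bool" where
  "smooth_action K T M a \<longleftrightarrow>
     group_action K (topspace (mtop M)) a \<and> smooth_map (prod_mfd T M) M (\<lambda>(k, x). a k x)"

definition almost_free :: "'k monoid \<Rightarrow> 'm set \<Rightarrow> ('k \<Rightarrow> 'm \<Rightarrow> 'm) \<Rightarrow> bool" where
  "almost_free K S a \<longleftrightarrow> (\<forall>x\<in>S. finite (stabilizer K a x))"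

definition quotient_topology :: "'a topology \<Rightarrow> ('a \<Rightarrow> 'b) \<Rightarrow> 'b topology" where
  "quotient_topology X q =
     topology (\<lambda>V. V \<subseteq> q ` topspace X \<and> openin X {x \<in> topspace X. q x \<in> V})"

definition orbit_space :: "'k monoid \<Rightarrow> 'x topology \<Rightarrow> ('k \<Rightarrow> 'x \<Rightarrow> 'x) \<Rightarrow> 'x set topology" where
  "orbit_space K X a = quotient_topology X (orbit K a)"

text \<open>A universal principal \<open>K\<close>-bundle: a free, locally trivial action on a contractible
  space. All actions, also the one on \<open>EK\<close>, are written as left actions.\<close>

definition universal_bundle :: "'k monoid \<Rightarrow> 'k topology \<Rightarrow> 'e topology \<Rightarrow> ('k \<Rightarrow> 'e \<Rightarrow> 'e) \<Rightarrow> bool" where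
  "universal_bundle K T E a \<longleftrightarrow>
     contractible_space E \<and> group_action K (topspace E) a \<and>
     continuous_map (prod_topology T E) E (\<lambda>(k, e). a k e) \<and>
     (\<forall>e\<in>topspace E. stabilizer K a e = {\<one>\<^bsub>K\<^esub>}) \<and>
     (\<forall>b\<in>topspace (orbit_space K E a). \<exists>U h.
        openin (orbit_space K E a) U \<and> b \<in> U \<and>
        homeomorphic_map (prod_topology T (subtopology (orbit_space K E a) U))
          (subtopology E {e \<in> topspace E. orbit K a e \<in> U}) h \<and>
        (\<forall>k\<in>carrier K. \<forall>u\<in>U. orbit K a (h (k, u)) = u) \<and>
        (\<forall>k\<in>carrier K. \<forall>k'\<in>carrier K. \<forall>u\<in>U. h (k \<otimes>\<^bsub>K\<^esub> k', u) = a k (h (k', u))))"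

definition diag_action ::
    "'e topology \<Rightarrow> ('k \<Rightarrow> 'e \<Rightarrow> 'e) \<Rightarrow> 'm topology \<Rightarrow> ('k \<Rightarrow> 'm \<Rightarrow> 'm) \<Rightarrow> 'k \<Rightarrow> 'e \<times> 'm \<Rightarrow> 'e \<times> 'm" where
  "diag_action E ea X a k = (\<lambda>(e, x) \<in> topspace E \<times> topspace X. (ea k e, a k x))"

definition borel_construction ::
    "'k monoid \<Rightarrow> 'e topology \<Rightarrow> ('k \<Rightarrow> 'e \<Rightarrow> 'e) \<Rightarrow> 'm topology \<Rightarrow> ('k \<Rightarrow> 'm \<Rightarrow> 'm)
       \<Rightarrow> ('e \<times> 'm) set topology" where
  "borel_construction K E ea X a = orbit_space K (prod_topology E X) (diag_action E ea X a)"


section \<open>Commutative differential graded algebras over the complex numbers\<close>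

definition complex_ring :: "complex ring" where
  "complex_ring = \<lparr>carrier = UNIV, mult = (*), one = 1, zero = 0, add = (+)\<rparr>"

text \<open>A graded algebra is the family of its homogeneous components; each component is a module
  record, whose (irrelevant) ring multiplication is left \<open>undefined\<close>. The product
  \<open>gmult A i j\<close> goes from degrees \<open>i\<close>, \<open>j\<close> to degree \<open>i + j\<close>.\<close>

record 'a dga =
  grade :: "nat \<Rightarrow> (complex, 'a) module"
  gone :: 'a
  gmult :: "nat \<Rightarrow> nat \<Rightarrow> 'a \<Rightarrow> 'a \<Rightarrow> 'a"
  gdiff :: "nat \<Rightarrow> 'a \<Rightarrow> 'a"

definition vs_record ::
    "'a set \<Rightarrow> ('a \<Rightarrow> 'a \<Rightarrow> 'a) \<Rightarrow> 'a \<Rightarrow> (complex \<Rightarrow> 'a \<Rightarrow> 'a) \<Rightarrow> (complex, 'a) module" where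
  "vs_record V ad z sc =
     \<lparr>carrier = V, mult = undefined, one = undefined, zero = z, add = ad, smult = sc\<rparr>"

abbreviation gcar :: "'a dga \<Rightarrow> nat \<Rightarrow> 'a set" where
  "gcar A i \<equiv> carrier (grade A i)"

definition linear_on :: "(complex, 'a) module \<Rightarrow> (complex, 'b) module \<Rightarrow> ('a \<Rightarrow> 'b) \<Rightarrow> bool" where
  "linear_on V W f \<longleftrightarrow>
     f \<in> carrier V \<rightarrow> carrier W \<and>
     (\<forall>x\<in>carrier V. \<forall>y\<in>carrier V. f (x \<oplus>\<^bsub>V\<^esub> y) = f x \<oplus>\<^bsub>W\<^esub> f y) \<and>
     (\<forall>c. \<forall>x\<in>carrier V. f (c \<odot>\<^bsub>V\<^esub> x) = c \<odot>\<^bsub>W\<^esub> f x)"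

definition cdga :: "'a dga \<Rightarrow> bool" where
  "cdga A \<longleftrightarrow>
     (\<forall>i. module complex_ring (grade A i)) \<and>
     gone A \<in> gcar A 0 \<and>
     (\<forall>i j. \<forall>x\<in>gcar A i. linear_on (grade A j) (grade A (i + j)) (gmult A i j x)) \<and>
     (\<forall>i j. \<forall>y\<in>gcar A j. linear_on (grade A i) (grade A (i + j)) (\<lambda>x. gmult A i j x y)) \<and>
     (\<forall>i j k. \<forall>x\<in>gcar A i. \<forall>y\<in>gcar A j. \<forall>z\<in>gcar A k.
        gmult A (i + j) k (gmult A i j x y) z = gmult A i (j + k) x (gmult A j k y z)) \<and>
     (\<forall>i. \<forall>x\<in>gcar A i. gmult A 0 i (gone A) x = x \<and> gmult A i 0 x (gone A) = x) \<and>
     (\<forall>i j. \<forall>x\<in>gcar A i. \<forall>y\<in>gcar A j.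
        gmult A i j x y = (-1) ^ (i * j) \<odot>\<^bsub>grade A (i + j)\<^esub> gmult A j i y x) \<and>
     (\<forall>i. linear_on (grade A i) (grade A (Suc i)) (gdiff A i)) \<and>
     (\<forall>i. \<forall>x\<in>gcar A i. gdiff A (Suc i) (gdiff A i x) = \<zero>\<^bsub>grade A (Suc (Suc i))\<^esub>) \<and>
     (\<forall>i j. \<forall>x\<in>gcar A i. \<forall>y\<in>gcar A j.
        gdiff A (i + j) (gmult A i j x y) =
          gmult A (Suc i) j (gdiff A i x) y
            \<oplus>\<^bsub>grade A (Suc (i + j))\<^esub>
          (-1) ^ i \<odot>\<^bsub>grade A (Suc (i + j))\<^esub> gmult A i (Suc j) x (gdiff A j y))"

definition dga_map :: "'a dga \<Rightarrow> 'b dga \<Rightarrow> (nat \<Rightarrow> 'a \<Rightarrow> 'b) \<Rightarrow> bool" where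
  "dga_map A B f \<longleftrightarrow>
     (\<forall>i. linear_on (grade A i) (grade B i) (f i)) \<and>
     f 0 (gone A) = gone B \<and>
     (\<forall>i j. \<forall>x\<in>gcar A i. \<forall>y\<in>gcar A j. f (i + j) (gmult A i j x y) = gmult B i j (f i x) (f j y)) \<and>
     (\<forall>i. \<forall>x\<in>gcar A i. f (Suc i) (gdiff A i x) = gdiff B i (f i x))"

definition cocycles :: "'a dga \<Rightarrow> nat \<Rightarrow> 'a set" where
  "cocycles A i = {x \<in> gcar A i. gdiff A i x = \<zero>\<^bsub>grade A (Suc i)\<^esub>}"

definition coboundaries :: "'a dga \<Rightarrow> nat \<Rightarrow> 'a set" where
  "coboundaries A i = (case i of 0 \<Rightarrow> {\<zero>\<^bsub>grade A 0\<^esub>} | Suc j \<Rightarrow> gdiff A j ` gcar A j)"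

definition coh_class :: "'a dga \<Rightarrow> nat \<Rightarrow> 'a \<Rightarrow> 'a set" where
  "coh_class A i x = coboundaries A i +>\<^bsub>grade A i\<^esub> x"

text \<open>The cohomology algebra, with zero differential; its elements are cosets.\<close>

definition cohomology :: "'a dga \<Rightarrow> 'a set dga" where
  "cohomology A = \<lparr>
     grade = (\<lambda>i. vs_record (coh_class A i ` cocycles A i)
       (set_add (grade A i)) (coboundaries A i)
       (\<lambda>c C. \<Union>x\<in>C. coh_class A i (c \<odot>\<^bsub>grade A i\<^esub> x))),
     gone = coh_class A 0 (gone A),
     gmult = (\<lambda>i j C D. \<Union>x\<in>C. \<Union>y\<in>D. coh_class A (i + j) (gmult A i j x y)),
     gdiff = (\<lambda>i C. coboundaries A (Suc i))\<rparr>"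

definition coh_map :: "'b dga \<Rightarrow> (nat \<Rightarrow> 'a \<Rightarrow> 'b) \<Rightarrow> nat \<Rightarrow> 'a set \<Rightarrow> 'b set" where
  "coh_map B f i C = (\<Union>x\<in>C. coh_class B i (f i x))"

definition two_equivalence :: "'a dga \<Rightarrow> 'b dga \<Rightarrow> (nat \<Rightarrow> 'a \<Rightarrow> 'b) \<Rightarrow> bool" where
  "two_equivalence A B f \<longleftrightarrow>
     dga_map A B f \<and>
     (\<forall>i\<le>2. bij_betw (coh_map B f i) (gcar (cohomology A) i) (gcar (cohomology B) i)) \<and>
     inj_on (coh_map B f 3) (gcar (cohomology A) 3)"

definition linked :: "'a dga \<Rightarrow> 'b dga \<Rightarrow> bool" where
  "linked A B \<longleftrightarrow> (\<exists>f. two_equivalence A B f) \<or> (\<exists>f. two_equivalence B A f)"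

text \<open>The intermediate algebras of a zig-zag have carriers in an auxiliary type \<open>'u\<close>. Where this
  predicate is used as a hypothesis of a theorem in which \<open>'u\<close> is free, arbitrary types, hence
  arbitrary zig-zags, are covered: the finitely many algebras of a zig-zag
  embed into a common type, and identities can be inserted at both ends.\<close>

definition zigzag :: "'u itself \<Rightarrow> 'a dga \<Rightarrow> 'b dga \<Rightarrow> bool" where
  "zigzag (_ :: 'u itself) A B \<longleftrightarrow>
     (\<exists>C D :: 'u dga. cdga C \<and> cdga D \<and> linked A C \<and>
        (\<lambda>P Q. cdga P \<and> cdga Q \<and> linked P Q)\<^sup>*\<^sup>* C D \<and> linked D B)"

definition fin_dim :: "(complex, 'a) module \<Rightarrow> bool" where
  "fin_dim V \<longleftrightarrow> (\<exists>B. finite B \<and> B \<subseteq> carrier V \<and>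
     (\<forall>x\<in>carrier V. \<exists>c. x = finsum V (\<lambda>b. c b \<odot>\<^bsub>V\<^esub> b) B))"

definition two_finite :: "'a dga \<Rightarrow> bool" where
  "two_finite A \<longleftrightarrow>
     gcar A 0 = range (\<lambda>c. c \<odot>\<^bsub>grade A 0\<^esub> gone A) \<and> gone A \<noteq> \<zero>\<^bsub>grade A 0\<^esub> \<and>
     fin_dim (grade A 1) \<and> fin_dim (grade A 2)"


section \<open>Piecewise polynomial forms\<close>

text \<open>The algebra of functions generated by a set \<open>G\<close> of functions; for \<open>G\<close> the set
  of coordinate functions these are the polynomial functions.\<close>

inductive poly_fun :: "('x \<Rightarrow> complex) set \<Rightarrow> ('x \<Rightarrow> complex) \<Rightarrow> bool" for G where
  const: "poly_fun G (\<lambda>_. c)"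
| gen: "g \<in> G \<Longrightarrow> poly_fun G g"
| add: "poly_fun G f \<Longrightarrow> poly_fun G g \<Longrightarrow> poly_fun G (\<lambda>x. f x + g x)"
| mult: "poly_fun G f \<Longrightarrow> poly_fun G g \<Longrightarrow> poly_fun G (\<lambda>x. f x * g x)"

text \<open>The affine hull of the standard \<open>n\<close>-simplex and its space of translations. Forms are
  defined on the whole affine hull, so that polynomial functions on it are the ring of
  polynomials in the barycentric coordinates \<open>t\<^sub>0, \<dots>, t\<^sub>n\<close> modulo \<open>t\<^sub>0 + \<dots> + t\<^sub>n = 1\<close>.\<close>

definition aff :: "nat \<Rightarrow> (nat \<Rightarrow> real) set" where
  "aff n = {x. (\<forall>i>n. x i = 0) \<and> (\<Sum>i\<le>n. x i) = 1}"

definition tang :: "nat \<Rightarrow> (nat \<Rightarrow> real) set" where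
  "tang n = {v. (\<forall>i>n. v i = 0) \<and> (\<Sum>i\<le>n. v i) = 0}"

type_synonym form = "(nat \<Rightarrow> real) \<Rightarrow> (nat \<Rightarrow> real) list \<Rightarrow> complex"

text \<open>The value of \<open>dt\<^sub>I = dt\<^bsub>I ! 0\<^esub> \<and> \<dots> \<and> dt\<^bsub>I ! (p - 1)\<^esub>\<close> on tangent vectors.\<close>

definition dt :: "nat list \<Rightarrow> (nat \<Rightarrow> real) list \<Rightarrow> real" where
  "dt I vs = (\<Sum>\<pi> | \<pi> permutes {..<length I}.
     of_int (sign \<pi>) * (\<Prod>j<length I. (vs ! j) (I ! \<pi> j)))"

definition poly_form :: "nat \<Rightarrow> nat \<Rightarrow> form \<Rightarrow> bool" where
  "poly_form n p w \<longleftrightarrow>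
     (\<exists>a. (\<forall>I. poly_fun {\<lambda>x. complex_of_real (x i) | i. i \<le> n} (a I)) \<and>
        w = (\<lambda>x vs. if x \<in> aff n \<and> length vs = p \<and> set vs \<subseteq> tang n
               then \<Sum>I | length I = p \<and> sorted_wrt (<) I \<and> set I \<subseteq> {..n}. a I x * of_real (dt I vs)
               else 0))"

text \<open>The affine (indeed linear) map induced by a map of vertices \<open>\<alpha> : {..m} \<rightarrow> {..n}\<close>.\<close>

definition vertex_map :: "nat \<Rightarrow> (nat \<Rightarrow> nat) \<Rightarrow> (nat \<Rightarrow> real) \<Rightarrow> (nat \<Rightarrow> real)" where
  "vertex_map m \<alpha> x = (\<lambda>j. \<Sum>i | i \<le> m \<and> \<alpha> i = j. x i)"

text \<open>A \<open>p\<close>-form on the space \<open>X\<close> assigns to each singular simplex a polynomial \<open>p\<close>-form on the standard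
  simplex of its dimension, compatibly with all simplicial operators (faces and degeneracies).\<close>

definition PL_forms ::
    "'x topology \<Rightarrow> nat \<Rightarrow> (nat \<Rightarrow> ((nat \<Rightarrow> real) \<Rightarrow> 'x) \<Rightarrow> form) set" where
  "PL_forms X p = {w.
     (\<forall>n \<sigma>. if singular_simplex n X \<sigma> then poly_form n p (w n \<sigma>) else w n \<sigma> = (\<lambda>_ _. 0)) \<and>
     (\<forall>m n \<sigma> \<alpha>. singular_simplex n X \<sigma> \<and> \<alpha> \<in> {..m} \<rightarrow> {..n} \<and> mono_on {..m} \<alpha> \<longrightarrow>
        (\<forall>x\<in>aff m. \<forall>vs. length vs = p \<and> set vs \<subseteq> tang m \<longrightarrow>
           w m (restrict (\<sigma> \<circ> vertex_map m \<alpha>) (standard_simplex m)) x vs =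
           w n \<sigma> (vertex_map m \<alpha> x) (map (vertex_map m \<alpha>) vs)))}"

text \<open>Wedge product as a sum over \<open>(p, q)\<close>-shuffles.\<close>

definition wedge :: "nat \<Rightarrow> nat \<Rightarrow> form \<Rightarrow> form \<Rightarrow> form" where
  "wedge p q w u = (\<lambda>x vs. if length vs = p + q
     then \<Sum>S | S \<subseteq> {..<p + q} \<and> card S = p.
       (-1) ^ card {(a, b). a \<in> S \<and> b \<in> {..<p + q} - S \<and> b < a} *
         w x (nths vs S) * u x (nths vs ({..<p + q} - S))
     else 0)"

text \<open>Exterior derivative: the alternating sum of directional derivatives, the tangent vectors
  being extended to constant vector fields.\<close>

definition ext_deriv :: "nat \<Rightarrow> nat \<Rightarrow> form \<Rightarrow> form" where
  "ext_deriv n p w = (\<lambda>x vs. if length vs = Suc p \<and> set vs \<subseteq> tang n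
     then \<Sum>i\<le>p. (-1) ^ i *
       vector_derivative (\<lambda>t. w (\<lambda>j. x j + t * (vs ! i) j) (take i vs @ drop (Suc i) vs)) (at 0)
     else 0)"

definition PL_algebra :: "'x topology \<Rightarrow> (nat \<Rightarrow> ((nat \<Rightarrow> real) \<Rightarrow> 'x) \<Rightarrow> form) dga" where
  "PL_algebra X = \<lparr>
     grade = (\<lambda>p. vs_record (PL_forms X p)
       (\<lambda>w u n \<sigma> x vs. w n \<sigma> x vs + u n \<sigma> x vs) (\<lambda>n \<sigma> x vs. 0)
       (\<lambda>c w n \<sigma> x vs. c * w n \<sigma> x vs)),
     gone = (\<lambda>n \<sigma> x vs. if singular_simplex n X \<sigma> \<and> x \<in> aff n \<and> vs = [] then 1 else 0),
     gmult = (\<lambda>p q w u n \<sigma>. wedge p q (w n \<sigma>) (u n \<sigma>)),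
     gdiff = (\<lambda>p w n \<sigma>. ext_deriv n p (w n \<sigma>))\<rparr>"


section \<open>Singular cohomology with complex coefficients\<close>

text \<open>The algebra of singular cochains with the cup product (not graded commutative on cochains).\<close>

definition back_face :: "nat \<Rightarrow> nat \<Rightarrow> ((nat \<Rightarrow> real) \<Rightarrow> 'x) \<Rightarrow> (nat \<Rightarrow> real) \<Rightarrow> 'x" where
  "back_face p q \<sigma> = restrict (\<sigma> \<circ> (\<lambda>x i. if i < p then 0 else x (i - p))) (standard_simplex q)"

definition singular_cochains :: "'x topology \<Rightarrow> (((nat \<Rightarrow> real) \<Rightarrow> 'x) \<Rightarrow> complex) dga" where
  "singular_cochains X = \<lparr>
     grade = (\<lambda>p. vs_record {c. \<forall>\<sigma>. \<not> singular_simplex p X \<sigma> \<longrightarrow> c \<sigma> = 0}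
       (\<lambda>c e \<sigma>. c \<sigma> + e \<sigma>) (\<lambda>\<sigma>. 0) (\<lambda>z c \<sigma>. z * c \<sigma>)),
     gone = (\<lambda>\<sigma>. if singular_simplex 0 X \<sigma> then 1 else 0),
     gmult = (\<lambda>p q c e \<sigma>. if singular_simplex (p + q) X \<sigma>
       then c (restrict \<sigma> (standard_simplex p)) * e (back_face p q \<sigma>) else 0),
     gdiff = (\<lambda>p c \<sigma>. if singular_simplex (Suc p) X \<sigma>
       then \<Sum>i\<le>Suc p. (-1) ^ i * c (singular_face (Suc p) i \<sigma>) else 0)\<rparr>"

definition cochain_pullback ::
    "'x topology \<Rightarrow> ('x \<Rightarrow> 'y) \<Rightarrow> nat \<Rightarrow> (((nat \<Rightarrow> real) \<Rightarrow> 'y) \<Rightarrow> complex) \<Rightarrow> ((nat \<Rightarrow> real) \<Rightarrow> 'x) \<Rightarrow> complex" where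
  "cochain_pullback X f p c = (\<lambda>\<sigma>. if singular_simplex p X \<sigma> then c (simplex_map p f \<sigma>) else 0)"

abbreviation sing_coh :: "'x topology \<Rightarrow> (((nat \<Rightarrow> real) \<Rightarrow> 'x) \<Rightarrow> complex) set dga" where
  "sing_coh X \<equiv> cohomology (singular_cochains X)"

definition has_two_finite_two_model :: "'u itself \<Rightarrow> 'x topology \<Rightarrow> bool" where
  "has_two_finite_two_model (u :: 'u itself) X \<longleftrightarrow>
     (\<exists>A :: 'u dga. cdga A \<and> two_finite A \<and> zigzag u A (PL_algebra X))"

definition two_formal :: "'u itself \<Rightarrow> 'x topology \<Rightarrow> bool" where
  "two_formal (u :: 'u itself) X \<longleftrightarrow> cdga (sing_coh X) \<and> zigzag u (sing_coh X) (PL_algebra X)"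


section \<open>Transgression\<close>

text \<open>For a bundle with total space \<open>E\<close>, projection \<open>q : E \<rightarrow> B\<close> and inclusion \<open>i : F \<rightarrow> E\<close> of
  a fibre, the class \<open>x\<close> transgresses to \<open>y\<close> if some cochain on \<open>E\<close> restricts to a cocycle in
  \<open>x\<close> and its coboundary is the pullback of a cocycle in \<open>y\<close>.\<close>

definition transgresses ::
    "'f topology \<Rightarrow> ('f \<Rightarrow> 'e) \<Rightarrow> 'e topology \<Rightarrow> ('e \<Rightarrow> 'b) \<Rightarrow> 'b topology \<Rightarrow> nat
       \<Rightarrow> (((nat \<Rightarrow> real) \<Rightarrow> 'f) \<Rightarrow> complex) set \<Rightarrow> (((nat \<Rightarrow> real) \<Rightarrow> 'b) \<Rightarrow> complex) set \<Rightarrow> bool" where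
  "transgresses F i E q B p x y \<longleftrightarrow>
     x \<in> gcar (sing_coh F) p \<and> y \<in> gcar (sing_coh B) (Suc p) \<and>
     (\<exists>c\<in>gcar (singular_cochains E) p. cochain_pullback F i p c \<in> x \<and>
        (\<exists>z\<in>y. gdiff (singular_cochains E) p c = cochain_pullback E q (Suc p) z))"

text \<open>\<open>P\<^sub>K\<close> consists of the universally transgressive classes of odd degree. The fibre \<open>K\<close> is
  identified with the orbit through a base point.\<close>

definition primitive_space ::
    "'k monoid \<Rightarrow> 'k topology \<Rightarrow> 'e topology \<Rightarrow> ('k \<Rightarrow> 'e \<Rightarrow> 'e) \<Rightarrow> 'e \<Rightarrow> nat
       \<Rightarrow> (((nat \<Rightarrow> real) \<Rightarrow> 'k) \<Rightarrow> complex) set set" where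
  "primitive_space K T E ea e0 p = {x. odd p \<and>
     (\<exists>y. transgresses T (\<lambda>k. ea k e0) E (orbit K ea) (orbit_space K E ea) p x y)}"

text \<open>The transgression in degree \<open>p\<close> of the bundle \<open>K \<rightarrow> EK \<times> M \<rightarrow> M\<^sub>K\<close>. In general its values
  have an indeterminacy; it is only used in degree 1, where there is none, as \<open>K\<close> and
  \<open>M\<^sub>K\<close> are path connected.\<close>

definition transgression ::
    "'k monoid \<Rightarrow> 'k topology \<Rightarrow> 'e topology \<Rightarrow> ('k \<Rightarrow> 'e \<Rightarrow> 'e) \<Rightarrow> 'e
       \<Rightarrow> 'm topology \<Rightarrow> ('k \<Rightarrow> 'm \<Rightarrow> 'm) \<Rightarrow> 'm \<Rightarrow> nat
       \<Rightarrow> (((nat \<Rightarrow> real) \<Rightarrow> 'k) \<Rightarrow> complex) set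
       \<Rightarrow> (((nat \<Rightarrow> real) \<Rightarrow> ('e \<times> 'm) set) \<Rightarrow> complex) set" where
  "transgression K T E ea e0 X a x0 p x =
     (THE y. transgresses T (\<lambda>k. (ea k e0, a k x0)) (prod_topology E X)
        (orbit K (diag_action E ea X a)) (borel_construction K E ea X a) p x y)"


section \<open>Fundamental groups\<close>

definition loop_homotopic :: "'a topology \<Rightarrow> 'a \<Rightarrow> (real \<Rightarrow> 'a) \<Rightarrow> (real \<Rightarrow> 'a) \<Rightarrow> bool" where
  "loop_homotopic X x0 f g \<longleftrightarrow>
     homotopic_with (\<lambda>h. h 0 = x0 \<and> h 1 = x0) (top_of_set {0..1}) X f g"

definition loop_class :: "'a topology \<Rightarrow> 'a \<Rightarrow> (real \<Rightarrow> 'a) \<Rightarrow> (real \<Rightarrow> 'a) set" where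
  "loop_class X x0 f = {g. loop_homotopic X x0 f g}"

definition concat_loops :: "(real \<Rightarrow> 'a) \<Rightarrow> (real \<Rightarrow> 'a) \<Rightarrow> real \<Rightarrow> 'a" where
  "concat_loops f g t = (if t \<le> 1/2 then f (2 * t) else g (2 * t - 1))"

definition fundamental_group :: "'a topology \<Rightarrow> 'a \<Rightarrow> (real \<Rightarrow> 'a) set monoid" where
  "fundamental_group X x0 = \<lparr>
     carrier = {loop_class X x0 f | f. pathin X f \<and> f 0 = x0 \<and> f 1 = x0},
     mult = (\<lambda>C D. \<Union>f\<in>C. \<Union>g\<in>D. loop_class X x0 (concat_loops f g)),
     one = loop_class X x0 (\<lambda>_. x0)\<rparr>"

definition pi1_map :: "'b topology \<Rightarrow> 'b \<Rightarrow> ('a \<Rightarrow> 'b) \<Rightarrow> (real \<Rightarrow> 'a) set \<Rightarrow> (real \<Rightarrow> 'b) set" where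
  "pi1_map Y y0 \<phi> C = (\<Union>f\<in>C. loop_class Y y0 (\<phi> \<circ> f))"

text \<open>The orbifold fundamental group of \<open>M/K\<close> is the fundamental group of the Borel construction,
  and \<open>p\<^sub>\<sharp>\<close> is induced by \<open>x \<mapsto> [(e0, x)]\<close>, i.e. by the composite of the homotopy
  equivalence \<open>M \<rightarrow> EK \<times> M\<close> with the projection to \<open>M\<^sub>K\<close>.\<close>

definition borel_incl ::
    "'k monoid \<Rightarrow> 'e topology \<Rightarrow> ('k \<Rightarrow> 'e \<Rightarrow> 'e) \<Rightarrow> 'e \<Rightarrow> 'm topology \<Rightarrow> ('k \<Rightarrow> 'm \<Rightarrow> 'm) \<Rightarrow> 'm \<Rightarrow> ('e \<times> 'm) set" where
  "borel_incl K E ea e0 X a x = orbit K (diag_action E ea X a) (e0, x)"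

definition orbifold_pi1 ::
    "'k monoid \<Rightarrow> 'e topology \<Rightarrow> ('k \<Rightarrow> 'e \<Rightarrow> 'e) \<Rightarrow> 'e \<Rightarrow> 'm topology \<Rightarrow> ('k \<Rightarrow> 'm \<Rightarrow> 'm) \<Rightarrow> 'm
       \<Rightarrow> (real \<Rightarrow> ('e \<times> 'm) set) set monoid" where
  "orbifold_pi1 K E ea e0 X a x0 =
     fundamental_group (borel_construction K E ea X a) (borel_incl K E ea e0 X a x0)"

definition p_sharp ::
    "'k monoid \<Rightarrow> 'e topology \<Rightarrow> ('k \<Rightarrow> 'e \<Rightarrow> 'e) \<Rightarrow> 'e \<Rightarrow> 'm topology \<Rightarrow> ('k \<Rightarrow> 'm \<Rightarrow> 'm) \<Rightarrow> 'm
       \<Rightarrow> (real \<Rightarrow> 'm) set \<Rightarrow> (real \<Rightarrow> ('e \<times> 'm) set) set" where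
  "p_sharp K E ea e0 X a x0 =
     pi1_map (borel_construction K E ea X a) (borel_incl K E ea e0 X a x0) (borel_incl K E ea e0 X a)"


section \<open>Representation varieties and characteristic varieties\<close>

definition rep_variety :: "('g, 'b) monoid_scheme \<Rightarrow> 'v monoid \<Rightarrow> ('g \<Rightarrow> 'v) set" where
  "rep_variety \<pi> G = hom \<pi> G \<inter> extensional (carrier \<pi>)"

definition Cstar :: "complex monoid" where
  "Cstar = \<lparr>carrier = UNIV - {0}, mult = (*), one = 1\<rparr>"

text \<open>The cocycles and coboundaries of the bar complex in degree 1; values off the carrier are
  irrelevant.\<close>

definition twisted_cocycles :: "('g, 'b) monoid_scheme \<Rightarrow> ('g \<Rightarrow> complex) \<Rightarrow> ('g \<Rightarrow> complex) set" where
  "twisted_cocycles \<pi> \<rho> = {f. \<forall>g\<in>carrier \<pi>. \<forall>h\<in>carrier \<pi>. f (g \<otimes>\<^bsub>\<pi>\<^esub> h) = f g + \<rho> g * f h}"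

definition twisted_coboundaries :: "('g, 'b) monoid_scheme \<Rightarrow> ('g \<Rightarrow> complex) \<Rightarrow> ('g \<Rightarrow> complex) set" where
  "twisted_coboundaries \<pi> \<rho> = {f. \<exists>c. \<forall>g\<in>carrier \<pi>. f g = \<rho> g * c - c}"

text \<open>\<open>dim H\<^sup>1(\<pi>, \<complex>\<^sub>\<rho>) \<ge> s\<close>: there are \<open>s\<close> cocycles linearly independent modulo coboundaries.\<close>

definition dim_H1_ge :: "('g, 'b) monoid_scheme \<Rightarrow> ('g \<Rightarrow> complex) \<Rightarrow> nat \<Rightarrow> bool" where
  "dim_H1_ge \<pi> \<rho> s \<longleftrightarrow> (\<exists>f :: nat \<Rightarrow> 'g \<Rightarrow> complex.
     (\<forall>i<s. f i \<in> twisted_cocycles \<pi> \<rho>) \<and>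
     (\<forall>c. (\<lambda>g. \<Sum>i<s. c i * f i g) \<in> twisted_coboundaries \<pi> \<rho> \<longrightarrow> (\<forall>i<s. c i = 0)))"

definition char_variety :: "nat \<Rightarrow> ('g, 'b) monoid_scheme \<Rightarrow> ('g \<Rightarrow> complex) set" where
  "char_variety s \<pi> = {\<rho> \<in> rep_variety \<pi> Cstar. dim_H1_ge \<pi> \<rho> s}"

definition SL2 :: "(complex^2^2) monoid" where
  "SL2 = \<lparr>carrier = {A. det A = 1}, mult = (**), one = mat 1\<rparr>"

definition mat_entry :: "2 \<times> 2 \<Rightarrow> complex^2^2 \<Rightarrow> complex" where
  "mat_entry = (\<lambda>(i, j) A. A $ i $ j)"

definition zariski_closed :: "(complex^2^2) set \<Rightarrow> bool" where
  "zariski_closed S \<longleftrightarrow> (\<exists>P. (\<forall>f\<in>P. poly_fun (range mat_entry) f) \<and> S = {A. \<forall>f\<in>P. f A = 0})"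

definition zariski_connected :: "(complex^2^2) set \<Rightarrow> bool" where
  "zariski_connected S \<longleftrightarrow> \<not> (\<exists>C D. zariski_closed C \<and> zariski_closed D \<and>
     S \<subseteq> C \<union> D \<and> S \<inter> C \<inter> D = {} \<and> S \<inter> C \<noteq> {} \<and> S \<inter> D \<noteq> {})"

definition connected_solvable :: "(complex^2^2) set \<Rightarrow> bool" where
  "connected_solvable B \<longleftrightarrow> subgroup B SL2 \<and> zariski_closed B \<and> zariski_connected B \<and>
     solvable (SL2\<lparr>carrier := B\<rparr>)"

definition borel_subgroup :: "(complex^2^2) set \<Rightarrow> bool" where
  "borel_subgroup B \<longleftrightarrow>
     connected_solvable B \<and> (\<forall>B'. connected_solvable B' \<and> B \<subseteq> B' \<longrightarrow> B' = B)"


section \<open>Isomorphisms of reduced analytic germs\<close>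

definition affine_space :: "'i set \<Rightarrow> ('i \<Rightarrow> complex) topology" where
  "affine_space I = product_topology (\<lambda>_. euclidean) I"

text \<open>Holomorphic functions of several variables: continuous and holomorphic in each variable
  (\<open>U\<close> is open and \<open>I\<close> is finite).\<close>

definition holomorphic_several :: "'i set \<Rightarrow> ('i \<Rightarrow> complex) set \<Rightarrow> (('i \<Rightarrow> complex) \<Rightarrow> complex) \<Rightarrow> bool" where
  "holomorphic_several I U \<Phi> \<longleftrightarrow>
     continuous_map (subtopology (affine_space I) U) euclidean \<Phi> \<and>
     (\<forall>z\<in>U. \<forall>i\<in>I. (\<lambda>t. \<Phi> (z(i := t))) field_differentiable (at (z i)))"

text \<open>Let \<open>e\<close> embed \<open>A\<close> into the affine space on \<open>I\<close>, and \<open>e'\<close> embed \<open>B\<close> into the one on \<open>J\<close>.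
  The map \<open>F : A \<rightarrow> B\<close> is an isomorphism between the reduced germs of \<open>A\<close> at \<open>a\<close> and of
  \<open>B\<close> at \<open>b\<close> if it restricts to a bijection between neighbourhoods that is the restriction of a
  holomorphic map of the ambient spaces, and likewise for the inverse. If \<open>a\<close> is not in \<open>A\<close> and
  \<open>b\<close> is not in \<open>B\<close>, the germs (of closed subsets) are empty.\<close>

definition germ_iso ::
    "'i set \<Rightarrow> ('x \<Rightarrow> 'i \<Rightarrow> complex) \<Rightarrow> 'x set \<Rightarrow> 'x \<Rightarrow>
     'j set \<Rightarrow> ('y \<Rightarrow> 'j \<Rightarrow> complex) \<Rightarrow> 'y set \<Rightarrow> 'y \<Rightarrow> ('x \<Rightarrow> 'y) \<Rightarrow> bool" where
  "germ_iso I e A a J e' B b F \<longleftrightarrow>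
     F a = b \<and> (a \<in> A \<longleftrightarrow> b \<in> B) \<and>
     (\<exists>U V \<Phi> \<Psi>. openin (affine_space I) U \<and> e a \<in> U \<and> openin (affine_space J) V \<and> e' b \<in> V \<and>
        bij_betw F {x \<in> A. e x \<in> U} {y \<in> B. e' y \<in> V} \<and>
        (\<forall>j\<in>J. holomorphic_several I U (\<lambda>z. \<Phi> z j)) \<and>
        (\<forall>i\<in>I. holomorphic_several J V (\<lambda>z. \<Psi> z i)) \<and>
        (\<forall>x\<in>A. e x \<in> U \<longrightarrow> \<Phi> (e x) = e' (F x) \<and> \<Psi> (e' (F x)) = e x))"

text \<open>The embedding of a representation variety given by a generating set \<open>S\<close> of the group and
  the coordinate functions \<open>\<kappa>\<close> of the target.\<close>

definition rep_coords :: "('c \<Rightarrow> 'v \<Rightarrow> complex) \<Rightarrow> 'g set \<Rightarrow> ('g \<Rightarrow> 'v) \<Rightarrow> 'g \<times> 'c \<Rightarrow> complex" where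
  "rep_coords \<kappa> S \<rho> = (\<lambda>(g, c) \<in> S \<times> UNIV. \<kappa> c (\<rho> g))"

definition generating_set :: "('g, 'b) monoid_scheme \<Rightarrow> 'g set \<Rightarrow> bool" where
  "generating_set \<pi> S \<longleftrightarrow> finite S \<and> S \<subseteq> carrier \<pi> \<and> generate \<pi> S = carrier \<pi>"

text \<open>Precomposition with \<open>p : \<pi>\<^sub>1 \<rightarrow> \<pi>\<^sub>2\<close> is an isomorphism from the germ at the trivial
  representation of \<open>X\<^sub>2 \<subseteq> Hom(\<pi>\<^sub>2, G)\<close> to that of \<open>X\<^sub>1 \<subseteq> Hom(\<pi>\<^sub>1, G)\<close>; \<open>u\<close> is the unit of \<open>G\<close>.
  The germs do not depend on the generating sets. The groups have to be finitely generated for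
  the germs to be defined.\<close>

definition induces_germ_iso ::
    "('g \<Rightarrow> 'h) \<Rightarrow> ('g, 'a) monoid_scheme \<Rightarrow> ('h, 'b) monoid_scheme \<Rightarrow>
     ('c \<Rightarrow> 'v \<Rightarrow> complex) \<Rightarrow> 'v \<Rightarrow> ('g \<Rightarrow> 'v) set \<Rightarrow> ('h \<Rightarrow> 'v) set \<Rightarrow> bool" where
  "induces_germ_iso p \<pi>1 \<pi>2 \<kappa> u X1 X2 \<longleftrightarrow>
     (\<exists>S. generating_set \<pi>1 S) \<and> (\<exists>S. generating_set \<pi>2 S) \<and>
     (\<forall>S1 S2. generating_set \<pi>1 S1 \<and> generating_set \<pi>2 S2 \<longrightarrow>
        germ_iso (S2 \<times> UNIV) (rep_coords \<kappa> S2) X2 (\<lambda>g\<in>carrier \<pi>2. u)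
                 (S1 \<times> UNIV) (rep_coords \<kappa> S1) X1 (\<lambda>g\<in>carrier \<pi>1. u)
                 (\<lambda>\<rho>. restrict (\<rho> \<circ> p) (carrier \<pi>1)))"

end

theory Submission
  imports Defs
begin

text \<open>Let \<open>C\<close> be the image of \<open>\<pi>\<^sub>1(K)\<close> in \<open>\<pi> = \<pi>\<^sub>1(M)\<close> under the orbit map \<open>k \<mapsto> k x\<^sub>0\<close>. It is
  central, finitely generated and contains the kernel of the epimorphism \<open>p\<^sub>\<sharp>\<close>. An additive
    character of \<open>\<pi>\<close>
  is a class in \<open>H\<^sup>1(M) = H\<^sup>1(EK \<times> M)\<close>; its restriction to the fibre \<open>K\<close> transgresses to zero, so it
  vanishes when the transgression is injective on \<open>P\<^sub>K\<^sup>1 = H\<^sup>1(K)\<close>. Hence \<open>C\<close> is torsion in the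
    abelianization
  of \<open>\<pi>\<close>.

  Consequently a representation \<open>\<rho>\<close> of \<open>\<pi>\<close> in \<open>\<complex>\<^sup>*\<close> or \<open>SL\<^sub>2(\<complex>)\<close> sends each generator \<open>c\<close> of \<open>C\<close>
    to an
  element of bounded finite order: in the second case \<open>\<rho>(c)\<close> is \<open>\<plusminus>1\<close>, or its centralizer is
  commutative and \<open>\<rho>\<close> factors through the abelianization. If \<open>\<rho>(c)\<^sup>m = 1\<close> and \<open>\<rho>(c)\<close> is near 1 then
  \<open>1 + \<rho>(c) + \<dots> + \<rho>(c)\<^bsup>m-1\<^esup>\<close> is invertible, so \<open>\<rho>(c) = 1\<close>. Thus all representations near the
    trivial one
  factor through \<open>p\<^sub>\<sharp>\<close>, and for characters the twisted 1-cocycles do so as well, because they vanish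
  on \<open>C\<close> by centrality.\<close>

section \<open>Homotopy of paths\<close>

text \<open>The transgression hypothesis concerns \<open>primitive_space\<close>, so an additive
  character can be tested against it only once its restriction to \<open>K\<close> is known to be
  universally transgressive. For every 1-cocycle on \<open>K\<close> a transgression cochain is
  therefore built by hand, without spectral sequences. Each edge of the base of a principal bundle
  gets a chosen lift, an edge of the total space is compared with the lift of its projection, and
  the cocycle is evaluated on the resulting path in \<open>K\<close>. The coboundary must depend on
  the projected simplex only. The obstacle is that a 1-cocycle is not additive under pointwise
  products of paths; but the defect is a difference of values at the end points, and it telescopes
  around a triangle if all lifts start and end at one chosen point in each fibre.

  The exponents that kill the central elements must not depend on the representation. They come from
  the abelianization alone, doubled for SL2 to cover both alternatives. Triviality of the central
  generators then follows from the non-vanishing of finitely many holomorphic functions that do not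
  vanish at the trivial representation.\<close>

definition path_homotopic :: "'a topology \<Rightarrow> (real \<Rightarrow> 'a) \<Rightarrow> (real \<Rightarrow> 'a) \<Rightarrow> bool" where
  "path_homotopic X p q \<longleftrightarrow>
     homotopic_with (\<lambda>h. h 0 = p 0 \<and> h 1 = p 1) (top_of_set {0..1}) X p q"

lemma path_homotopicD:
  assumes "path_homotopic X p q"
  shows "pathin X p" "pathin X q" "q 0 = p 0" "q 1 = p 1"
  using homotopic_with_imp_continuous_maps[OF assms[unfolded path_homotopic_def]]
    homotopic_with_imp_property[OF assms[unfolded path_homotopic_def]]
  by (auto simp: pathin_def)

lemma path_homotopic_refl: "pathin X p \<Longrightarrow> path_homotopic X p p"
  by (simp add: path_homotopic_def pathin_def)

lemma path_homotopic_sym: "path_homotopic X p q \<Longrightarrow> path_homotopic X q p"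
  using path_homotopicD[of X p q] unfolding path_homotopic_def
  by (simp add: homotopic_with_sym)

lemma path_homotopic_trans: "path_homotopic X p q \<Longrightarrow> path_homotopic X q r \<Longrightarrow> path_homotopic X p r"
  using path_homotopicD[of X p q] unfolding path_homotopic_def
  by (auto intro: homotopic_with_trans)

lemma path_homotopic_eq:
  assumes "pathin X p" "\<And>t. 0 \<le> t \<Longrightarrow> t \<le> 1 \<Longrightarrow> p t = q t"
  shows "path_homotopic X p q"
  unfolding path_homotopic_def
  by (rule homotopic_with_equal) (use assms in \<open>auto simp: pathin_def\<close>)

lemma path_homotopic_image:
  assumes "path_homotopic X p q" "continuous_map X Y f"
  shows "path_homotopic Y (f \<circ> p) (f \<circ> q)"
  using assms unfolding path_homotopic_def
  by (auto intro: homotopic_with_compose_continuous_map_left)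

text \<open>The straight-line homotopy inside \<open>Q\<close>, pushed forward along
  \<open>h\<close>. Reparametrizations and the relations for triangles and squares are all derived
  from it.\<close>

lemma path_homotopic_convex:
  fixes h :: "'b::real_normed_vector \<Rightarrow> 'a"
  assumes Q: "convex Q" and h: "continuous_map (top_of_set Q) X h"
    and p: "continuous_on {0..1} p" "p \<in> {0..1} \<rightarrow> Q"
    and q: "continuous_on {0..1} q" "q \<in> {0..1} \<rightarrow> Q"
    and ends: "p 0 = q 0" "p 1 = q 1"
  shows "path_homotopic X (h \<circ> p) (h \<circ> q)"
proof -
  let ?k = "\<lambda>(s::real, t). (1 - s) *\<^sub>R p t + s *\<^sub>R q t"
  have "continuous_on ({0..1} \<times> {0..1}) ?k"
    unfolding case_prod_unfold
    by (intro continuous_intros continuous_on_compose2[OF p(1)] continuous_on_compose2[OF q(1)])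
      auto
  moreover have "?k \<in> {0..1} \<times> {0..1} \<rightarrow> Q"
  proof
    fix z :: "real \<times> real" assume z: "z \<in> {0..1} \<times> {0..1}"
    then have "p (snd z) \<in> Q" "q (snd z) \<in> Q" using p q by auto
    then show "?k z \<in> Q"
      using z convexD_alt[OF Q, of "p (snd z)" "q (snd z)" "fst z"] by (auto simp: case_prod_unfold)
  qed
  ultimately have k: "continuous_map (top_of_set ({0..1} \<times> {0..1})) (top_of_set Q) ?k"
    by simp
  have "continuous_map (prod_topology (top_of_set {0..1}) (top_of_set {0..1})) X (h \<circ> ?k)"
    using continuous_map_compose[OF k h] by simp
  moreover have "\<forall>s. (h \<circ> ?k) (s, 0) = h (p 0) \<and> (h \<circ> ?k) (s, 1) = h (p 1)"
    by (simp add: ends algebra_simps flip: scaleR_add_left)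
  ultimately show ?thesis
    unfolding path_homotopic_def homotopic_with_def
    by (intro exI[of _ "h \<circ> ?k"]) auto
qed

lemma path_homotopic_reparametrize:
  assumes "pathin X f" "continuous_on {0..1} r" "r \<in> {0..1} \<rightarrow> {0..1}"
    "continuous_on {0..1} s" "s \<in> {0..1} \<rightarrow> {0..1}" "r 0 = s 0" "r 1 = s 1"
  shows "path_homotopic X (f \<circ> r) (f \<circ> s)"
  using assms by (intro path_homotopic_convex[of "{0..1}"]) (auto simp: pathin_def)

text \<open>Concatenation with a parameter \<open>s\<close>: composed with the map from
  \<open>t\<close> to \<open>(0, t)\<close> it yields continuity of a concatenated path, and for
  \<open>S = {0..1}\<close> it concatenates two homotopies.\<close>

lemma continuous_map_prod_concat:
  assumes "continuous_map (prod_topology (top_of_set S) (top_of_set {0..1})) X f"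
    "continuous_map (prod_topology (top_of_set S) (top_of_set {0..1})) X g"
    "\<And>s. s \<in> S \<Longrightarrow> f (s, 1) = g (s, 0)"
  shows "continuous_map (prod_topology (top_of_set (S :: real set)) (top_of_set {0..1})) X
     (\<lambda>(s, t). if t \<le> (1/2::real) then f (s, 2 * t) else g (s, 2 * t - 1))"
  unfolding case_prod_unfold
proof (rule continuous_map_cases_le)
  let ?Z = "prod_topology (top_of_set S) (top_of_set {0..1::real})"
  have Z: "?Z = top_of_set (S \<times> {0..1})" by simp
  show "continuous_map ?Z euclideanreal (\<lambda>x. snd x)" "continuous_map ?Z euclideanreal (\<lambda>x. 1/2)"
    unfolding Z by (auto intro!: continuous_intros)
  have 1: "continuous_map (subtopology ?Z {x \<in> topspace ?Z. snd x \<le> 1/2}) ?Z (\<lambda>x. (fst x, 2 * snd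
    x))"
    unfolding Z subtopology_subtopology continuous_map_subtopology_eu
    by (auto intro!: continuous_intros)
  show "continuous_map (subtopology ?Z {x \<in> topspace ?Z. snd x \<le> 1/2}) X (\<lambda>x. f (fst x, 2 * snd x))"
    using continuous_map_compose[OF 1 assms(1)] by (simp add: o_def)
  have 2: "continuous_map (subtopology ?Z {x \<in> topspace ?Z. 1/2 \<le> snd x}) ?Z (\<lambda>x. (fst x, 2 * snd
    x - 1))"
    unfolding Z subtopology_subtopology continuous_map_subtopology_eu
    by (auto intro!: continuous_intros)
  show "continuous_map (subtopology ?Z {x \<in> topspace ?Z. 1/2 \<le> snd x}) X (\<lambda>x. g (fst x, 2 * snd x
    - 1))"
    using continuous_map_compose[OF 2 assms(2)] by (simp add: o_def)
  show "f (fst x, 2 * snd x) = g (fst x, 2 * snd x - 1)"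
    if "x \<in> topspace ?Z" "snd x = 1/2" for x
  proof -
    have "2 * snd x = 1" "2 * snd x - 1 = 0" using that(2) by auto
    moreover have "fst x \<in> S" using that(1) by auto
    ultimately show ?thesis using assms(3) by simp
  qed
qed

lemma pathin_concat:
  assumes "pathin X p" "pathin X q" "p 1 = q 0"
  shows "pathin X (concat_loops p q)"
proof -
  have pr: "continuous_map (prod_topology (top_of_set {0..1}) (top_of_set {0..1::real})) X (p \<circ>
    snd)"
    if "pathin X p" for p
    using that continuous_map_compose[OF continuous_map_snd] unfolding pathin_def by blast
  have "continuous_map (top_of_set {0..1::real})
     (prod_topology (top_of_set {0..1}) (top_of_set {0..1})) (\<lambda>t. (0::real, t))"
    by (auto intro!: continuous_on_Pair)
  from continuous_map_compose[OF this continuous_map_prod_concat[OF pr[OF assms(1)] pr[OF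
    assms(2)]]]
  show ?thesis
    using assms(3) by (simp add: pathin_def concat_loops_def[abs_def] comp_def cong: if_cong)
qed

lemma path_homotopic_concat:
  assumes p: "path_homotopic X p p'" and q: "path_homotopic X q q'" and e: "p 1 = q 0"
  shows "path_homotopic X (concat_loops p q) (concat_loops p' q')"
proof -
  obtain f where f: "continuous_map (prod_topology (top_of_set {0..1::real}) (top_of_set {0..1}))
    X f"
    "\<forall>x. f (0, x) = p x" "\<forall>x. f (1, x) = p' x" "\<forall>t\<in>{0..1}. f (t, 0) = p 0 \<and> f (t, 1) = p 1"
    using p unfolding path_homotopic_def homotopic_with_def by blast
  obtain g where g: "continuous_map (prod_topology (top_of_set {0..1::real}) (top_of_set {0..1}))
    X g"
    "\<forall>x. g (0, x) = q x" "\<forall>x. g (1, x) = q' x" "\<forall>t\<in>{0..1}. g (t, 0) = q 0 \<and> g (t, 1) = q 1"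
    using q unfolding path_homotopic_def homotopic_with_def by blast
  show ?thesis
    unfolding path_homotopic_def homotopic_with_def
    using continuous_map_prod_concat[OF f(1) g(1)] f(2,3,4) g(2,3,4) e
    by (intro exI[of _ "\<lambda>(s, t). if t \<le> 1/2 then f (s, 2 * t) else g (s, 2 * t - 1)"])
       (auto simp: concat_loops_def)
qed

lemma concat_ends [simp]: "concat_loops p q 0 = p 0" "concat_loops p q 1 = q 1"
  by (auto simp: concat_loops_def)

lemma continuous_on_if_le:
  fixes f g :: "real \<Rightarrow> 'b::topological_space"
  assumes "continuous_on {t \<in> S. t \<le> c} f" "continuous_on {t \<in> S. c \<le> t} g" "c \<in> S \<Longrightarrow> f c = g c"
  shows "continuous_on S (\<lambda>t. if t \<le> c then f t else g t)"
  using assms by (intro continuous_on_cases_le) (auto intro!: continuous_intros)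

lemma path_homotopic_assoc:
  assumes "pathin X p" "pathin X q" "pathin X r" "p 1 = q 0" "q 1 = r 0"
  shows "path_homotopic X (concat_loops (concat_loops p q) r) (concat_loops p (concat_loops q r))"
proof -
  let ?F = "concat_loops (concat_loops p q) r"
  \<comment> \<open>Sends the break points 1/2 and 3/4 of the right-hand bracketing to the break
    points 1/4 and 1/2 of the left-hand one.\<close>
  let ?r = "\<lambda>t::real. if t \<le> 1/2 then t / 2 else if t \<le> 3/4 then t - 1/4 else 2 * t - 1"
  have F: "pathin X ?F" using assms by (auto intro!: pathin_concat)
  have "continuous_on {0..1} ?r"
    by (intro continuous_on_if_le continuous_intros) auto
  then have "path_homotopic X (?F \<circ> (\<lambda>t. t)) (?F \<circ> ?r)"
    by (intro path_homotopic_reparametrize[OF F]) (auto intro!: continuous_intros simp del: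
      le_divide_eq_numeral1)
  moreover have "?F \<circ> ?r = concat_loops p (concat_loops q r)"
    by (rule ext) (auto simp: concat_loops_def field_simps intro!: arg_cong[where f = q]
      arg_cong[where f = r])
  ultimately show ?thesis by (simp add: o_def)
qed

lemma path_homotopic_left_unit:
  assumes "pathin X p" shows "path_homotopic X (concat_loops (\<lambda>_. p 0) p) p"
proof -
  have "path_homotopic X (p \<circ> (\<lambda>t. max 0 (2 * t - 1))) (p \<circ> (\<lambda>t. t))"
    by (rule path_homotopic_reparametrize[OF assms]) (auto intro!: continuous_intros)
  moreover have "p \<circ> (\<lambda>t. max 0 (2 * t - 1)) = concat_loops (\<lambda>_. p 0) p"
    by (rule ext) (auto simp add: concat_loops_def max_def intro!: arg_cong[where f = p])
  ultimately show ?thesis by (simp add: o_def)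
qed

lemma path_homotopic_right_unit:
  assumes "pathin X p" shows "path_homotopic X (concat_loops p (\<lambda>_. p 1)) p"
proof -
  have "path_homotopic X (p \<circ> (\<lambda>t. min 1 (2 * t))) (p \<circ> (\<lambda>t. t))"
    by (rule path_homotopic_reparametrize[OF assms]) (auto intro!: continuous_intros)
  moreover have "p \<circ> (\<lambda>t. min 1 (2 * t)) = concat_loops p (\<lambda>_. p 1)"
    by (rule ext) (auto simp add: concat_loops_def min_def intro!: arg_cong[where f = p])
  ultimately show ?thesis by (simp add: o_def)
qed

definition rev_path :: "(real \<Rightarrow> 'a) \<Rightarrow> real \<Rightarrow> 'a" where
  "rev_path p t = p (1 - t)"

lemma rev_path_ends [simp]: "rev_path p 0 = p 1" "rev_path p 1 = p 0"
  by (auto simp: rev_path_def)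

lemma rev_path_rev_path [simp]: "rev_path (rev_path p) = p"
  by (auto simp: rev_path_def)

lemma pathin_rev_path:
  assumes "pathin X p" shows "pathin X (rev_path p)"
proof -
  have "continuous_map (top_of_set {0..1::real}) (top_of_set {0..1}) (\<lambda>t. 1 - t)"
    by (auto intro!: continuous_intros)
  from continuous_map_compose[OF this assms[unfolded pathin_def]] show ?thesis
    by (simp add: pathin_def o_def rev_path_def[abs_def])
qed

lemma path_homotopic_rev_right:
  assumes "pathin X p" shows "path_homotopic X (concat_loops p (rev_path p)) (\<lambda>_. p 0)"
proof -
  have "path_homotopic X (p \<circ> (\<lambda>t. 1 - \<bar>1 - 2 * t\<bar>)) (p \<circ> (\<lambda>t. 0))"
    by (rule path_homotopic_reparametrize[OF assms]) (auto intro!: continuous_intros)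
  moreover have "p \<circ> (\<lambda>t. 1 - \<bar>1 - 2 * t\<bar>) = concat_loops p (rev_path p)"
    by (rule ext) (auto simp add: concat_loops_def rev_path_def abs_if)
  ultimately show ?thesis by (simp add: o_def)
qed

lemma path_homotopic_rev_left:
  assumes "pathin X p" shows "path_homotopic X (concat_loops (rev_path p) p) (\<lambda>_. p 1)"
  using path_homotopic_rev_right[OF pathin_rev_path[OF assms]] by simp


section \<open>The fundamental group\<close>

definition path_class :: "'a topology \<Rightarrow> (real \<Rightarrow> 'a) \<Rightarrow> (real \<Rightarrow> 'a) set" where
  "path_class X p = {q. path_homotopic X p q}"

lemma loop_class_eq_path_class:
  "f 0 = x0 \<Longrightarrow> f 1 = x0 \<Longrightarrow> loop_class X x0 f = path_class X f"
  by (simp add: loop_class_def path_class_def path_homotopic_def loop_homotopic_def)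

lemma path_class_eq_iff:
  assumes "pathin X p" shows "path_class X p = path_class X q \<longleftrightarrow> path_homotopic X p q"
  unfolding path_class_def using path_homotopic_refl[OF assms] path_homotopic_sym
    path_homotopic_trans
  by blast

lemma path_class_eqI: "path_homotopic X p q \<Longrightarrow> path_class X p = path_class X q"
  by (simp add: path_class_eq_iff path_homotopicD)

definition is_loop :: "'a topology \<Rightarrow> 'a \<Rightarrow> (real \<Rightarrow> 'a) \<Rightarrow> bool" where
  "is_loop X x0 f \<longleftrightarrow> pathin X f \<and> f 0 = x0 \<and> f 1 = x0"

lemma is_loop_concat: "is_loop X x0 f \<Longrightarrow> is_loop X x0 g \<Longrightarrow> is_loop X x0 (concat_loops f g)"
  by (auto simp: is_loop_def pathin_concat)

lemma carrier_fundamental_group: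
  "carrier (fundamental_group X x0) = path_class X ` {f. is_loop X x0 f}"
  by (auto simp: fundamental_group_def is_loop_def setcompr_eq_image loop_class_eq_path_class
      intro!: image_cong)

lemma one_fundamental_group: "\<one>\<^bsub>fundamental_group X x0\<^esub> = path_class X (\<lambda>_. x0)"
  by (simp add: fundamental_group_def loop_class_eq_path_class)

lemma mult_fundamental_group:
  assumes f: "is_loop X x0 f" and g: "is_loop X x0 g"
  shows "path_class X f \<otimes>\<^bsub>fundamental_group X x0\<^esub> path_class X g = path_class X (concat_loops f g)"
proof -
  have "loop_class X x0 (concat_loops f' g') = path_class X (concat_loops f g)"
    if "f' \<in> path_class X f" "g' \<in> path_class X g" for f' g'
  proof -
    have h: "path_homotopic X f f'" "path_homotopic X g g'"
      using that by (auto simp: path_class_def)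
    have "path_homotopic X (concat_loops f g) (concat_loops f' g')"
      using h f g by (intro path_homotopic_concat) (auto simp: is_loop_def)
    then show ?thesis
      using path_homotopicD[OF h(1)] path_homotopicD[OF h(2)] f g
      by (subst loop_class_eq_path_class) (auto simp: is_loop_def dest: path_class_eqI)
  qed
  moreover have "f \<in> path_class X f" "g \<in> path_class X g"
    using f g by (auto simp: path_class_def is_loop_def path_homotopic_refl)
  ultimately show ?thesis
    unfolding fundamental_group_def by auto
qed

lemma group_fundamental_group:
  assumes "x0 \<in> topspace X" shows "group (fundamental_group X x0)"
proof -
  let ?G = "fundamental_group X x0"
  have c: "is_loop X x0 (\<lambda>_. x0)" using assms by (simp add: is_loop_def)
  show ?thesis
  proof (rule groupI)
    show "x \<otimes>\<^bsub>?G\<^esub> y \<in> carrier ?G" if "x \<in> carrier ?G" "y \<in> carrier ?G" for x y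
      using that by (auto simp: carrier_fundamental_group mult_fundamental_group is_loop_concat)
    show "\<one>\<^bsub>?G\<^esub> \<in> carrier ?G"
      using c by (auto simp: carrier_fundamental_group one_fundamental_group)
    show "x \<otimes>\<^bsub>?G\<^esub> y \<otimes>\<^bsub>?G\<^esub> z = x \<otimes>\<^bsub>?G\<^esub> (y \<otimes>\<^bsub>?G\<^esub> z)"
      if xyz: "x \<in> carrier ?G" "y \<in> carrier ?G" "z \<in> carrier ?G" for x y z
    proof -
      obtain f where "x = path_class X f" "is_loop X x0 f"
        using xyz(1) by (auto simp: carrier_fundamental_group)
      moreover obtain g where "y = path_class X g" "is_loop X x0 g"
        using xyz(2) by (auto simp: carrier_fundamental_group)
      moreover obtain h where "z = path_class X h" "is_loop X x0 h"
        using xyz(3) by (auto simp: carrier_fundamental_group)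
      ultimately show ?thesis
        using path_class_eqI[OF path_homotopic_assoc[of X f g h]]
        by (simp add: mult_fundamental_group is_loop_concat) (simp add: is_loop_def)
    qed
    show "\<one>\<^bsub>?G\<^esub> \<otimes>\<^bsub>?G\<^esub> x = x" if x: "x \<in> carrier ?G" for x
    proof -
      obtain f where f: "x = path_class X f" "is_loop X x0 f"
        using x by (auto simp: carrier_fundamental_group)
      then show ?thesis
        using c path_class_eqI[OF path_homotopic_left_unit[of X f]]
        by (simp add: mult_fundamental_group one_fundamental_group) (simp add: is_loop_def)
    qed
    show "\<exists>y\<in>carrier ?G. y \<otimes>\<^bsub>?G\<^esub> x = \<one>\<^bsub>?G\<^esub>" if x: "x \<in> carrier ?G" for x
    proof -
      obtain f where f: "is_loop X x0 f" "x = path_class X f"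
        using x by (auto simp: carrier_fundamental_group)
      then have f': "is_loop X x0 (rev_path f)" by (auto simp: is_loop_def pathin_rev_path)
      have "path_homotopic X (concat_loops (rev_path f) f) (\<lambda>_. x0)"
        using path_homotopic_rev_left[of X f] f by (auto simp: is_loop_def)
      then show ?thesis
        using f f'
        by (intro bexI[of _ "path_class X (rev_path f)"])
          (auto simp: carrier_fundamental_group mult_fundamental_group one_fundamental_group
            intro!: path_class_eqI)
    qed
  qed
qed

lemma pi1_map_path_class:
  assumes f: "is_loop X x0 f" and \<phi>: "continuous_map X Y \<phi>"
  shows "pi1_map Y (\<phi> x0) \<phi> (path_class X f) = path_class Y (\<phi> \<circ> f)"
proof -
  have "loop_class Y (\<phi> x0) (\<phi> \<circ> g) = path_class Y (\<phi> \<circ> f)" if "g \<in> path_class X f" for g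
    using that f path_homotopic_image[OF _ \<phi>] path_homotopicD[of X f g]
    by (subst loop_class_eq_path_class)
       (auto simp: path_class_def is_loop_def intro: path_homotopic_sym path_homotopic_trans)
  moreover have "f \<in> path_class X f"
    using f by (auto simp: path_class_def is_loop_def path_homotopic_refl)
  ultimately show ?thesis unfolding pi1_map_def by blast
qed

lemma is_loop_image: "is_loop X x0 f \<Longrightarrow> continuous_map X Y \<phi> \<Longrightarrow> is_loop Y (\<phi> x0) (\<phi> \<circ> f)"
  by (auto simp: is_loop_def intro: pathin_compose)

lemma concat_image: "\<phi> \<circ> concat_loops f g = concat_loops (\<phi> \<circ> f) (\<phi> \<circ> g)"
  by (rule ext) (simp add: concat_loops_def)

lemma hom_pi1_map:
  assumes \<phi>: "continuous_map X Y \<phi>"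
  shows "pi1_map Y (\<phi> x0) \<phi> \<in> hom (fundamental_group X x0) (fundamental_group Y (\<phi> x0))"
  unfolding hom_def
  by (auto simp: carrier_fundamental_group pi1_map_path_class[OF _ \<phi>] is_loop_image[OF _ \<phi>]
      mult_fundamental_group is_loop_concat concat_image)


text \<open>Closing up paths with fixed paths from the base point gives a functor from paths with
  arbitrary
  end points to the fundamental group.\<close>

definition tether :: "'a topology \<Rightarrow> 'a \<Rightarrow> 'a \<Rightarrow> real \<Rightarrow> 'a" where
  "tether X x0 y = (if y = x0 then (\<lambda>_. x0) else (SOME p. pathin X p \<and> p 0 = x0 \<and> p 1 = y))"

definition close_up :: "'a topology \<Rightarrow> 'a \<Rightarrow> (real \<Rightarrow> 'a) \<Rightarrow> real \<Rightarrow> 'a" where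
  "close_up X x0 p =
     concat_loops (tether X x0 (p 0)) (concat_loops p (rev_path (tether X x0 (p 1))))"

definition holonomy :: "'a topology \<Rightarrow> 'a \<Rightarrow> (real \<Rightarrow> 'a) \<Rightarrow> (real \<Rightarrow> 'a) set" where
  "holonomy X x0 p = path_class X (close_up X x0 p)"

locale pointed_space =
  fixes X :: "'a topology" and x0 :: 'a
  assumes path_connected: "path_connected_space X" and base: "x0 \<in> topspace X"
begin

abbreviation "PI \<equiv> fundamental_group X x0"

sublocale PI: group PI
  by (rule group_fundamental_group[OF base])

lemma tether:
  assumes "y \<in> topspace X"
  shows "pathin X (tether X x0 y)" "tether X x0 y 0 = x0" "tether X x0 y 1 = y"
proof -
  have "\<exists>p. pathin X p \<and> p 0 = x0 \<and> p 1 = y"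
    using path_connected assms base unfolding path_connected_space_def by blast
  from someI_ex[OF this] show "pathin X (tether X x0 y)" "tether X x0 y 0 = x0" "tether X x0 y 1
    = y"
    using base by (auto simp: tether_def)
qed

lemma pathin_ends: "pathin X p \<Longrightarrow> p 0 \<in> topspace X \<and> p 1 \<in> topspace X"
  by (simp add: path_start_in_topspace path_finish_in_topspace)

lemma is_loop_close_up: "pathin X p \<Longrightarrow> is_loop X x0 (close_up X x0 p)"
  using tether pathin_ends[of p] unfolding close_up_def is_loop_def
  by (auto intro!: pathin_concat pathin_rev_path)

lemma holonomy_closed [simp]: "pathin X p \<Longrightarrow> holonomy X x0 p \<in> carrier PI"
  by (auto simp: holonomy_def carrier_fundamental_group is_loop_close_up)

lemma path_homotopic_close_up:
  assumes "path_homotopic X p q" shows "path_homotopic X (close_up X x0 p) (close_up X x0 q)"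
  using path_homotopicD[OF assms] tether pathin_ends[of p] assms
  unfolding close_up_def
  by (auto intro!: path_homotopic_concat path_homotopic_refl pathin_rev_path)

lemma holonomy_homotopic: "path_homotopic X p q \<Longrightarrow> holonomy X x0 p = holonomy X x0 q"
  unfolding holonomy_def by (intro path_class_eqI path_homotopic_close_up)

text \<open>\<open>tether\<close> is constant at the base point by definition. With an arbitrary
  loop chosen there, the holonomy of a loop would only be a conjugate of its class.\<close>

lemma holonomy_loop:
  assumes "is_loop X x0 f" shows "holonomy X x0 f = path_class X f"
proof -
  have f: "pathin X f" "f 0 = x0" "f 1 = x0" using assms by (auto simp: is_loop_def)
  have r: "rev_path (tether X x0 x0) = (\<lambda>_. x0)" by (auto simp: rev_path_def tether_def)
  have "path_homotopic X (concat_loops f (\<lambda>_. x0)) f"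
    using path_homotopic_right_unit[OF f(1)] f by simp
  moreover have "path_homotopic X (concat_loops (\<lambda>_. x0) (concat_loops f (\<lambda>_. x0))) (concat_loops
    f (\<lambda>_. x0))"
    using path_homotopic_left_unit[of X "concat_loops f (\<lambda>_. x0)"] f base pathin_concat[of X f
      "\<lambda>_. x0"] by simp
  ultimately have "path_homotopic X (close_up X x0 f) f"
    unfolding close_up_def f r by (simp add: tether_def) (meson path_homotopic_trans)
  then show ?thesis unfolding holonomy_def by (rule path_class_eqI)
qed

text \<open>The tether back from the middle point and the one out to it are inverse to each other;
  re-association brings them together, and they cancel.\<close>

lemma holonomy_concat:
  assumes p: "pathin X p" and q: "pathin X q" and e: "p 1 = q 0"
  shows "holonomy X x0 (concat_loops p q) = holonomy X x0 p \<otimes>\<^bsub>PI\<^esub> holonomy X x0 q"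
proof -
  let ?a = "tether X x0 (p 0)" and ?b = "tether X x0 (p 1)" and ?c = "tether X x0 (q 1)"
  let ?C = concat_loops
  have in_top: "p 0 \<in> topspace X" "p 1 \<in> topspace X" "q 1 \<in> topspace X"
    using pathin_ends p q by auto
  note t = tether[OF in_top(1)] tether[OF in_top(2)] tether[OF in_top(3)]
  note r = pathin_rev_path[OF t(4)] pathin_rev_path[OF t(7)]
  note [simp] = t e[symmetric] and [intro!] = pathin_concat path_homotopic_refl p q t r
  have 1: "path_homotopic X (?C (?C ?a (?C p (rev_path ?b))) (?C ?b (?C q (rev_path ?c))))
     (?C ?a (?C (?C p (rev_path ?b)) (?C ?b (?C q (rev_path ?c)))))"
    by (rule path_homotopic_assoc) auto
  have 2: "path_homotopic X (?C (?C p (rev_path ?b)) (?C ?b (?C q (rev_path ?c))))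
     (?C p (?C (rev_path ?b) (?C ?b (?C q (rev_path ?c)))))"
    by (rule path_homotopic_assoc) auto
  have 3: "path_homotopic X (?C (rev_path ?b) (?C ?b (?C q (rev_path ?c))))
     (?C (?C (rev_path ?b) ?b) (?C q (rev_path ?c)))"
    by (rule path_homotopic_sym, rule path_homotopic_assoc) auto
  have 4: "path_homotopic X (?C (?C (rev_path ?b) ?b) (?C q (rev_path ?c)))
      (?C (\<lambda>_. p 1) (?C q (rev_path ?c)))"
    using path_homotopic_rev_left[OF t(4)] by (intro path_homotopic_concat) auto
  have 5: "path_homotopic X (?C (\<lambda>_. p 1) (?C q (rev_path ?c))) (?C q (rev_path ?c))"
    using path_homotopic_left_unit[of X "?C q (rev_path ?c)"] pathin_concat[OF q r(2)] by simp
  have 6: "path_homotopic X (?C p (?C (rev_path ?b) (?C ?b (?C q (rev_path ?c))))) (?C p (?C q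
    (rev_path ?c)))"
    by (rule path_homotopic_concat[OF _ path_homotopic_trans[OF 3 path_homotopic_trans[OF 4 5]]])
      auto
  have 7: "path_homotopic X (?C p (?C q (rev_path ?c))) (?C (?C p q) (rev_path ?c))"
    by (rule path_homotopic_sym, rule path_homotopic_assoc) auto
  have "path_homotopic X (?C ?a (?C (?C p (rev_path ?b)) (?C ?b (?C q (rev_path ?c)))))
    (?C ?a (?C (?C p q) (rev_path ?c)))"
    by (rule path_homotopic_concat[OF _ path_homotopic_trans[OF 2 path_homotopic_trans[OF 6 7]]])
      auto
  with 1 have "path_homotopic X (?C (close_up X x0 p) (close_up X x0 q)) (close_up X x0 (?C p q))"
    unfolding close_up_def by (simp) (meson path_homotopic_trans)
  then show ?thesis
    unfolding holonomy_def
    using mult_fundamental_group[OF is_loop_close_up[OF p] is_loop_close_up[OF q]] path_class_eqI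
      by metis
qed

lemma holonomy_convex:
  fixes h :: "'b::real_normed_vector \<Rightarrow> 'a"
  assumes "convex Q" "continuous_map (top_of_set Q) X h"
    and "continuous_on {0..1} p" "p \<in> {0..1} \<rightarrow> Q" "continuous_on {0..1} q" "q \<in> {0..1} \<rightarrow> Q"
    and "p 0 = q 0" "p 1 = q 1"
  shows "holonomy X x0 (h \<circ> p) = holonomy X x0 (h \<circ> q)"
  by (rule holonomy_homotopic[OF path_homotopic_convex]) (use assms in auto)

lemma linepath_in_convex: "convex Q \<Longrightarrow> a \<in> Q \<Longrightarrow> b \<in> Q \<Longrightarrow> linepath a b \<in> {0..1} \<rightarrow> Q"
  by (auto simp: linepath_def convex_alt)

lemma pathin_segment:
  assumes "convex Q" "continuous_map (top_of_set Q) X h" "a \<in> Q" "b \<in> Q"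
  shows "pathin X (h \<circ> linepath a b)"
  using assms linepath_in_convex[OF assms(1,3,4)] unfolding pathin_def
  by (intro continuous_map_compose[OF _ assms(2)]) auto

text \<open>Both sides come from paths in \<open>Q\<close> with the same end points, so over a
  continuous image of a convex set the holonomy of a segment depends on its ends only.\<close>

lemma holonomy_triangle:
  fixes h :: "'b::real_normed_vector \<Rightarrow> 'a"
  assumes "convex Q" "continuous_map (top_of_set Q) X h" "a \<in> Q" "b \<in> Q" "c \<in> Q"
  shows "holonomy X x0 (h \<circ> linepath a b) \<otimes>\<^bsub>PI\<^esub> holonomy X x0 (h \<circ> linepath b c) =
    holonomy X x0 (h \<circ> linepath a c)"
proof -
  have 1: "concat_loops (h \<circ> linepath a b) (h \<circ> linepath b c) = h \<circ> (linepath a b +++ linepath b c)"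
    by (rule ext) (simp add: concat_loops_def joinpaths_def)
  have c: "continuous_on {0..1} (linepath a b +++ linepath b c)"
    unfolding path_def[symmetric] by (intro path_join_imp) auto
  have i: "linepath a b +++ linepath b c \<in> {0..1} \<rightarrow> Q"
    using linepath_in_convex[OF assms(1,3,4)] linepath_in_convex[OF assms(1,4,5)]
    by (auto simp: joinpaths_def Pi_iff)
  have "holonomy X x0 (h \<circ> (linepath a b +++ linepath b c)) = holonomy X x0 (h \<circ> linepath a c)"
    using linepath_in_convex[OF assms(1,3,5)] c i
    by (intro holonomy_convex[OF assms(1,2)]) (auto simp: joinpaths_def linepath_0' linepath_1')
  moreover have "holonomy X x0 (concat_loops (h \<circ> linepath a b) (h \<circ> linepath b c)) =
     holonomy X x0 (h \<circ> linepath a b) \<otimes>\<^bsub>PI\<^esub> holonomy X x0 (h \<circ> linepath b c)"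
    by (rule holonomy_concat)
       (auto intro!: pathin_segment[OF assms(1,2)] assms simp: linepath_0' linepath_1')
  ultimately show ?thesis using 1 by simp
qed

text \<open>Both sides equal the holonomy of the diagonal. Homotopies with moving end points and
  commutation relations enter the proof in this form.\<close>

lemma holonomy_square:
  fixes h :: "real \<times> real \<Rightarrow> 'a"
  assumes h: "continuous_map (top_of_set ({0..1} \<times> {0..1})) X h"
  shows "holonomy X x0 (\<lambda>s. h (s, 0)) \<otimes>\<^bsub>PI\<^esub> holonomy X x0 (\<lambda>t. h (1, t)) =
    holonomy X x0 (\<lambda>t. h (0, t)) \<otimes>\<^bsub>PI\<^esub> holonomy X x0 (\<lambda>s. h (s, 1 :: real))"
proof -
  note t = holonomy_triangle[OF _ h]
  have e: "(\<lambda>s. h (s, 0)) = h \<circ> linepath (0,0) (1,0)" "(\<lambda>t. h (1, t)) = h \<circ> linepath (1,0) (1,1)"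
    "(\<lambda>t. h (0, t)) = h \<circ> linepath (0,0) (0,1)" "(\<lambda>s. h (s, 1)) = h \<circ> linepath (0,1) (1,1)"
    by (auto simp: linepath_def)
  have "convex ({0..1::real} \<times> {0..1::real})" by (intro convex_Times convex_real_interval)
  then show ?thesis unfolding e by (simp add: t)
qed

end


section \<open>Compact manifolds have finitely generated fundamental group\<close>

text \<open>\<open>W\<close> is path connected, but the homotopies may leave \<open>W\<close>: this
  is the semilocal form of simple connectivity, which suffices for comparing holonomies in
  \<open>X\<close>.\<close>

definition simple_in :: "'a topology \<Rightarrow> 'a set \<Rightarrow> bool" where
  "simple_in X W \<longleftrightarrow>
     (\<forall>a\<in>W. \<forall>b\<in>W. \<exists>p. pathin X p \<and> p \<in> {0..1} \<rightarrow> W \<and> p 0 = a \<and> p 1 = b) \<and>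
     (\<forall>p q. pathin X p \<and> pathin X q \<and> p \<in> {0..1} \<rightarrow> W \<and> q \<in> {0..1} \<rightarrow> W \<and> p 0 = q 0 \<and> p 1 = q 1
        \<longrightarrow> path_homotopic X p q)"

lemma simple_in_homotopic:
  "simple_in X W \<Longrightarrow> pathin X p \<Longrightarrow> pathin X q \<Longrightarrow> p \<in> {0..1} \<rightarrow> W \<Longrightarrow> q \<in> {0..1} \<rightarrow> W \<Longrightarrow>
    p 0 = q 0 \<Longrightarrow> p 1 = q 1 \<Longrightarrow> path_homotopic X p q"
  unfolding simple_in_def by blast

definition locally_simple :: "'a topology \<Rightarrow> bool" where
  "locally_simple X \<longleftrightarrow>
     (\<forall>V x. openin X V \<and> x \<in> V \<longrightarrow> (\<exists>W. openin X W \<and> x \<in> W \<and> W \<subseteq> V \<and> simple_in X W))"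

lemma locally_simpleD:
  "locally_simple X \<Longrightarrow> openin X V \<Longrightarrow> x \<in> V \<Longrightarrow> \<exists>W. openin X W \<and> x \<in> W \<and> W \<subseteq> V \<and> simple_in X W"
  unfolding locally_simple_def by blast

text \<open>Straight lines in the chart, pulled back to \<open>W\<close>. As
  \<open>path_homotopic_convex\<close> is stated for normed spaces, the homotopy is written out
  coordinate by coordinate here.\<close>

lemma simple_in_convex_chart:
  fixes C :: "(nat \<Rightarrow> real) set"
  assumes conv: "\<And>x y t. x \<in> C \<Longrightarrow> y \<in> C \<Longrightarrow> 0 \<le> t \<Longrightarrow> t \<le> 1 \<Longrightarrow> (\<lambda>i. (1 - t) * x i + t * y i) \<in> C"
    and \<phi>: "continuous_map (subtopology X W) (subtopology (powertop_real UNIV) C) \<phi>"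
    and \<psi>: "continuous_map (subtopology (powertop_real UNIV) C) (subtopology X W) \<psi>"
    and inv: "\<And>x. x \<in> W \<Longrightarrow> \<psi> (\<phi> x) = x" and W: "W \<subseteq> topspace X"
  shows "simple_in X W"
proof -
  have \<phi>C: "\<phi> x \<in> C" if "x \<in> W" for x
    using continuous_map_image_subset_topspace[OF \<phi>] that W by auto
  have \<psi>W: "\<psi> x \<in> W" if "x \<in> C" for x
    using continuous_map_image_subset_topspace[OF \<psi>] that by auto
  have \<psi>X: "continuous_map (subtopology (powertop_real UNIV) C) X \<psi>"
    using \<psi> by (simp add: continuous_map_in_subtopology)
  have line: "continuous_map Z X (\<lambda>z. \<psi> (\<lambda>i. (1 - s z) * \<phi> (p z) i + s z * \<phi> (q z) i))"
    if p: "continuous_map Z (subtopology X W) p" and q: "continuous_map Z (subtopology X W) q"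
      and s: "continuous_map Z (top_of_set {0..1}) s" for Z :: "'z topology" and p q s
  proof -
    have pw: "continuous_map Z euclideanreal (\<lambda>z. \<phi> (p z) i)"
      if "continuous_map Z (subtopology X W) p" for i p
      using continuous_map_compose[OF that \<phi>] 
      by (auto simp: continuous_map_in_subtopology continuous_map_componentwise_UNIV o_def)
    have s': "continuous_map Z euclideanreal s" "\<And>z. z \<in> topspace Z \<Longrightarrow> 0 \<le> s z \<and> s z \<le> 1"
      using s by (auto simp: continuous_map_in_subtopology Pi_iff)
    have pq: "p z \<in> W" "q z \<in> W" if "z \<in> topspace Z" for z
      using p q that by (auto simp: continuous_map_in_subtopology Pi_iff)
    have "continuous_map Z (subtopology (powertop_real UNIV) C)
        (\<lambda>z i. (1 - s z) * \<phi> (p z) i + s z * \<phi> (q z) i)"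
      using s' pq
      by (auto simp: continuous_map_in_subtopology continuous_map_componentwise_UNIV
          intro!: continuous_intros pw p q conv \<phi>C)
    from continuous_map_compose[OF this \<psi>X] show ?thesis by (simp add: o_def)
  qed
  have "\<exists>p. pathin X p \<and> p \<in> {0..1} \<rightarrow> W \<and> p 0 = a \<and> p 1 = b" if ab: "a \<in> W" "b \<in> W" for a b
  proof (intro exI conjI)
    let ?p = "\<lambda>t. \<psi> (\<lambda>i. (1 - t) * \<phi> a i + t * \<phi> b i)"
    show "pathin X ?p"
      unfolding pathin_def using ab W by (intro line) (auto simp: continuous_map_in_subtopology)
    show "?p \<in> {0..1} \<rightarrow> W" using ab by (auto intro!: \<psi>W conv \<phi>C)
    show "?p 0 = a" "?p 1 = b" using ab inv by auto
  qed
  moreover have "path_homotopic X p q" if pq: "pathin X p" "pathin X q" "p \<in> {0..1} \<rightarrow> W" "q \<in>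
    {0..1} \<rightarrow> W"
    "p 0 = q 0" "p 1 = q 1" for p q
  proof -
    let ?Z = "prod_topology (top_of_set {0..1::real}) (top_of_set {0..1::real})"
    let ?H = "\<lambda>z::real \<times> real. \<psi> (\<lambda>i. (1 - fst z) * \<phi> (p (snd z)) i + fst z * \<phi> (q (snd z)) i)"
    have "continuous_map ?Z (subtopology X W) (r \<circ> snd)" if "pathin X r" "r \<in> {0..1} \<rightarrow> W" for r
      using that unfolding pathin_def
      by (intro continuous_map_compose[OF continuous_map_snd]) (auto simp:
        continuous_map_in_subtopology)
    then have H: "continuous_map ?Z X ?H"
      using line[of ?Z "p \<circ> snd" "q \<circ> snd" fst] pq continuous_map_fst[of "top_of_set {0..1::real}"]
      unfolding o_apply by blast
    \<comment> \<open>A homotopy has to start at its path for every real parameter, while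
      \<open>p\<close> and \<open>q\<close> are known to lie in \<open>W\<close> on
      \<open>{0..1}\<close> only. So the homotopy joins their images under \<psi> \<circ> \<phi>,
      which agree with them on the unit interval.\<close>
    define p' q' where "p' = \<psi> \<circ> (\<phi> \<circ> p)" and "q' = \<psi> \<circ> (\<phi> \<circ> q)"
    have "path_homotopic X p' q'"
      unfolding path_homotopic_def homotopic_with_def
      using H pq(5,6)
      by (intro exI[of _ ?H]) (auto simp: p'_def q'_def algebra_simps)
    moreover have "path_homotopic X p p'" "path_homotopic X q q'"
      using pq by (auto simp: p'_def q'_def Pi_iff inv intro!: path_homotopic_eq)
    ultimately show ?thesis by (meson path_homotopic_sym path_homotopic_trans)
  qed
  ultimately show ?thesis unfolding simple_in_def by blast
qed

lemma Euclidean_space_convex_nbhd: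
  assumes U: "openin (Euclidean_space n) U" and x: "x \<in> U"
  shows "\<exists>C. openin (Euclidean_space n) C \<and> x \<in> C \<and> C \<subseteq> U \<and>
    (\<forall>y\<in>C. \<forall>z\<in>C. \<forall>t\<in>{0..1}. (\<lambda>i. (1 - t) * y i + t * z i) \<in> C)"
proof -
  obtain V where V: "openin (powertop_real UNIV) V" "U = V \<inter> {x. \<forall>i\<ge>n. x i = 0}"
    using U unfolding Euclidean_space_def openin_subtopology by blast
  obtain B where B: "finite {i. B i \<noteq> UNIV}" "\<And>i. open (B i)" "x \<in> Pi\<^sub>E UNIV B" "Pi\<^sub>E UNIV B \<subseteq> V"
    using V x unfolding openin_product_topology_alt by auto
  \<comment> \<open>The factors equal to \<open>UNIV\<close> are kept: only finitely many factors
    may be proper if the product is to stay open.\<close>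
  have "\<exists>b. open b \<and> convex b \<and> x i \<in> b \<and> b \<subseteq> B i \<and> (B i = UNIV \<longrightarrow> b = UNIV)" for i
  proof (cases "B i = UNIV")
    case False
    have "x i \<in> B i" using B(3) by auto
    then obtain e where "e > 0" "ball (x i) e \<subseteq> B i" using B(2)[of i] open_contains_ball by metis
    then show ?thesis using False by (intro exI[of _ "ball (x i) e"]) auto
  qed auto
  then obtain b where b: "\<And>i. open (b i) \<and> convex (b i) \<and> x i \<in> b i \<and> b i \<subseteq> B i \<and> (B i = UNIV \<longrightarrow> b
    i = UNIV)"
    by metis
  have bB: "\<And>i. b i \<subseteq> B i" and bx: "\<And>i. x i \<in> b i" using b by blast+
  define C where "C = Pi\<^sub>E UNIV b \<inter> {x. \<forall>i\<ge>n. x i = 0}"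
  have fin: "finite {i. b i \<noteq> UNIV}" using b by (intro finite_subset[OF _ B(1)]) auto
  have "openin (powertop_real UNIV) (Pi\<^sub>E UNIV b)"
    using b fin by (simp add: openin_PiE_gen)
  then have "openin (Euclidean_space n) C"
    unfolding Euclidean_space_def C_def openin_subtopology by blast
  moreover have "x \<in> Pi\<^sub>E UNIV b" using bx by (simp add: PiE_iff)
  then have "x \<in> C" using x V(2) by (simp add: C_def)
  moreover have "Pi\<^sub>E UNIV b \<subseteq> Pi\<^sub>E UNIV B" using bB by (intro PiE_mono)
  then have "Pi\<^sub>E UNIV b \<subseteq> V" using B(4) by (rule order_trans)
  then have "C \<subseteq> U" unfolding C_def V(2) by (rule Int_mono) simp
  moreover have "(\<lambda>i. (1 - t) * y i + t * z i) \<in> C" if "y \<in> C" "z \<in> C" "0 \<le> t" "t \<le> 1" for y z t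
  proof -
    have "(1 - t) * y i + t * z i \<in> b i" for i
      using that b[of i] convexD_alt[of "b i" "y i" "z i" t] by (auto simp: C_def)
    then show ?thesis using that by (auto simp: C_def)
  qed
  ultimately show ?thesis by (intro exI[of _ C]) simp
qed

text \<open>A convex neighbourhood of the image of \<open>x\<close>, chosen inside the image of
  \<open>U \<inter> V\<close> in the chart, pulls back to the required set.\<close>

lemma smooth_manifold_locally_simple:
  assumes M: "smooth_manifold M" shows "locally_simple (mtop M)"
  unfolding locally_simple_def
proof (intro allI impI, elim conjE)
  fix V x assume V: "openin (mtop M) V" and x: "x \<in> V"
  let ?E = "Euclidean_space (dimension M)"
  have "x \<in> topspace (mtop M)" using V x openin_subset by blast
  moreover have "topspace (mtop M) \<subseteq> \<Union>(fst ` atlas M)"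
    using M unfolding smooth_manifold_def by blast
  ultimately obtain U \<phi> where A: "(U, \<phi>) \<in> atlas M" and xU: "x \<in> U"
    by auto
  then have U: "openin (mtop M) U" and \<phi>U: "openin ?E (\<phi> ` U)"
    and h: "homeomorphic_map (subtopology (mtop M) U) (subtopology ?E (\<phi> ` U)) \<phi>"
    using M unfolding smooth_manifold_def by blast+
  obtain \<psi> where hm: "homeomorphic_maps (subtopology (mtop M) U) (subtopology ?E (\<phi> ` U)) \<phi> \<psi>"
    using h homeomorphic_map_maps by blast
  have UX: "U \<subseteq> topspace (mtop M)" and \<phi>UE: "\<phi> ` U \<subseteq> topspace ?E"
    using U \<phi>U openin_subset by auto
  have inv: "\<psi> (\<phi> y) = y" if "y \<in> U" for y
    using hm that UX unfolding homeomorphic_maps_def by auto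
  have inv': "\<phi> (\<psi> z) = z" if "z \<in> \<phi> ` U" for z
    using hm that \<phi>UE unfolding homeomorphic_maps_def by auto
  have "openin (subtopology (mtop M) U) (U \<inter> V)"
    using V U by (metis inf_commute openin_subtopology_Int)
  then have "openin (subtopology ?E (\<phi> ` U)) (\<phi> ` (U \<inter> V))"
    using h by (meson homeomorphic_imp_open_map open_map_def)
  then have "openin ?E (\<phi> ` (U \<inter> V))"
    using \<phi>U openin_trans_full by blast
  moreover have "\<phi> x \<in> \<phi> ` (U \<inter> V)" using x xU by blast
  ultimately obtain C where C: "openin ?E C" "\<phi> x \<in> C" "C \<subseteq> \<phi> ` (U \<inter> V)"
    "\<forall>y\<in>C. \<forall>z\<in>C. \<forall>t\<in>{0..1}. (\<lambda>i. (1 - t) * y i + t * z i) \<in> C"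
    using Euclidean_space_convex_nbhd[of "dimension M" "\<phi> ` (U \<inter> V)" "\<phi> x"] by blast
  define W where "W = {y \<in> U. \<phi> y \<in> C}"
  have W\<psi>: "W = \<psi> ` C"
  proof (intro equalityI subsetI)
    fix y assume "y \<in> W" then show "y \<in> \<psi> ` C"
      using inv[of y] by (intro image_eqI[of _ _ "\<phi> y"]) (auto simp: W_def)
  next
    fix y assume "y \<in> \<psi> ` C"
    then obtain c where c: "c \<in> C" "y = \<psi> c" by blast
    then obtain u where "u \<in> U" "c = \<phi> u" using C(3) by blast
    then show "y \<in> W" using c inv[of u] by (simp add: W_def)
  qed
  have CE: "C \<subseteq> topspace ?E" using C(1) openin_subset by auto
  have sub: "subtopology (subtopology ?E (\<phi> ` U)) C = subtopology (powertop_real UNIV) C"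
  proof -
    have "{x. \<forall>i\<ge>dimension M. x i = 0} \<inter> \<phi> ` U \<inter> C = C"
      using C(3) CE by (auto simp: topspace_Euclidean_space)
    then show ?thesis unfolding Euclidean_space_def subtopology_subtopology by simp
  qed
  have contphi: "continuous_map (subtopology (mtop M) U) (subtopology ?E (\<phi> ` U)) \<phi>"
    and contpsi: "continuous_map (subtopology ?E (\<phi> ` U)) (subtopology (mtop M) U) \<psi>"
    using hm by (auto simp: homeomorphic_maps_def)
  have "openin (subtopology (mtop M) U) {y \<in> topspace (subtopology (mtop M) U). \<phi> y \<in> C}"
  proof (rule openin_continuous_map_preimage[OF contphi])
    have "C = \<phi> ` U \<inter> C" using C(3) by blast
    then show "openin (subtopology ?E (\<phi> ` U)) C"
      using C(1) openin_subtopology_Int2 by metis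
  qed
  moreover have "{y \<in> topspace (subtopology (mtop M) U). \<phi> y \<in> C} = W"
    using UX by (auto simp: W_def)
  ultimately have Wo: "openin (mtop M) W" using U openin_trans_full by metis
  have WU: "subtopology (subtopology (mtop M) U) W = subtopology (mtop M) W"
    unfolding subtopology_subtopology W_def by (metis (no_types, lifting) Int_absorb1
      mem_Collect_eq subsetI)
  have "simple_in (mtop M) W"
  proof (rule simple_in_convex_chart[of C _ _ \<phi> \<psi>])
    show "continuous_map (subtopology (mtop M) W) (subtopology (powertop_real UNIV) C) \<phi>"
      unfolding sub[symmetric] WU[symmetric]
      using contphi by (auto simp: continuous_map_in_subtopology continuous_map_from_subtopology
        W_def)
    show "continuous_map (subtopology (powertop_real UNIV) C) (subtopology (mtop M) W) \<psi>"
      unfolding sub[symmetric] WU[symmetric]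
      using contpsi W\<psi> by (auto simp: continuous_map_in_subtopology continuous_map_from_subtopology)
    show "W \<subseteq> topspace (mtop M)" using UX by (auto simp: W_def)
  qed (use C(4) inv in \<open>auto simp: W_def\<close>)
  moreover have "W \<subseteq> V" using C(3) inv by (auto simp: W_def) (metis IntE imageE subset_iff)
  ultimately show "\<exists>W. openin (mtop M) W \<and> x \<in> W \<and> W \<subseteq> V \<and> simple_in (mtop M) W"
    using Wo C(2) xU by (auto simp: W_def)
qed

lemma locally_simple_imp_path_connected:
  assumes "locally_simple X" "connected_space X"
  shows "path_connected_space X"
proof -
  have "path_connectedin X W" if W: "simple_in X W" "openin X W" for W
    unfolding path_connectedin_def path_connected_space_def
  proof (intro conjI ballI)
    show "W \<subseteq> topspace X" using W openin_subset by blast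
    fix a b assume "a \<in> topspace (subtopology X W)" "b \<in> topspace (subtopology X W)"
    then have "a \<in> W" "b \<in> W" by auto
    then obtain p where "pathin X p" "p \<in> {0..1} \<rightarrow> W" "p 0 = a" "p 1 = b"
      using W(1) unfolding simple_in_def by blast
    then show "\<exists>g. pathin (subtopology X W) g \<and> g 0 = a \<and> g 1 = b"
      by (auto simp: pathin_subtopology)
  qed
  then have "locally_path_connected_space X"
    using assms unfolding locally_simple_def locally_path_connected_space by meson
  then show ?thesis
    using assms(2) by (simp add: path_connected_eq_connected_space)
qed

text \<open>A loop is cut into pieces, each inside one simple set \<open>U i\<close>. Joining the
  cut points to the centres \<open>i\<close> rewrites the loop, up to one conjugation, as a product
  of transition elements between overlapping sets. These elements are locally constant on the
  overlaps, so compactness leaves finitely many.\<close>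

lemma (in pointed_space) finitely_generated:
  assumes X: "compact_space X" "Hausdorff_space X" "locally_simple X"
  shows "\<exists>S. generating_set PI S"
proof -
  let ?\<theta> = "holonomy X x0"
  have reg: "regular_space X" using X compact_Hausdorff_imp_regular_space by blast
  \<comment> \<open>The open sets \<open>Q\<close> provide the finite cover, the closed sets
    \<open>D\<close> have compact overlaps, and the sets \<open>U\<close> are simple.\<close>
  have "\<exists>U D Q. openin X Q \<and> closedin X D \<and> openin X U \<and> simple_in X U \<and> x \<in> Q \<and> Q \<subseteq> D \<and> D \<subseteq> U"
    if x: "x \<in> topspace X" for x
  proof -
    obtain U where "openin X U" "x \<in> U" "simple_in X U"
      using X(3) x unfolding locally_simple_def by blast
    moreover have "\<exists>Q D. openin X Q \<and> closedin X D \<and> x \<in> Q \<and> Q \<subseteq> D \<and> D \<subseteq> U"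
      using reg \<open>openin X U\<close> \<open>x \<in> U\<close>
      unfolding neighbourhood_base_of_closedin[symmetric] neighbourhood_base_of by blast
    ultimately show ?thesis by blast
  qed
  then obtain U D Q where UDQ: "\<And>x. x \<in> topspace X \<Longrightarrow> openin X (Q x) \<and> closedin X (D x) \<and> openin X
    (U x) \<and>
      simple_in X (U x) \<and> x \<in> Q x \<and> Q x \<subseteq> D x \<and> D x \<subseteq> U x"
    by metis
  obtain I where I: "finite I" "I \<subseteq> topspace X" "topspace X \<subseteq> (\<Union>i\<in>I. Q i)"
  proof -
    have "\<exists>\<F>. finite \<F> \<and> \<F> \<subseteq> Q ` topspace X \<and> topspace X \<subseteq> \<Union>\<F>"
      using X(1)[unfolded compact_space_alt, rule_format, of "Q ` topspace X"] UDQ by blast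
    then obtain \<F> where \<F>: "finite \<F>" "\<F> \<subseteq> Q ` topspace X" "topspace X \<subseteq> \<Union>\<F>" by blast
    then obtain I where "I \<subseteq> topspace X" "finite I" "\<F> = Q ` I" using finite_subset_image by metis
    then show thesis using that \<F> by blast
  qed
  have "\<exists>p. pathin X p \<and> p \<in> {0..1} \<rightarrow> U i \<and> p 0 = i \<and> p 1 = y" if "i \<in> I" "y \<in> U i" for i y
    using UDQ[of i] I(2) that unfolding simple_in_def by blast
  then obtain \<alpha> where \<alpha>: "\<And>i y. i \<in> I \<Longrightarrow> y \<in> U i \<Longrightarrow>
      pathin X (\<alpha> i y) \<and> \<alpha> i y \<in> {0..1} \<rightarrow> U i \<and> \<alpha> i y 0 = i \<and> \<alpha> i y 1 = y"
    by metis
  have DU: "y \<in> U i" if "i \<in> I" "y \<in> D i" for i y using UDQ[of i] I(2) that by blast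
  \<comment> \<open>Inside \<open>U i\<close>, the path from the centre followed by \<open>p\<close>
    is homotopic to the chosen path from the centre to the end of \<open>p\<close>.\<close>
  have slide: "?\<theta> (\<alpha> i (p 0)) \<otimes>\<^bsub>PI\<^esub> ?\<theta> p = ?\<theta> (\<alpha> i (p 1))"
    if i: "i \<in> I" and p: "pathin X p" "p \<in> {0..1} \<rightarrow> U i" for i p
  proof -
    have e: "p 0 \<in> U i" "p 1 \<in> U i" using p by auto
    have "path_homotopic X (concat_loops (\<alpha> i (p 0)) p) (\<alpha> i (p 1))"
    proof -
      have "concat_loops (\<alpha> i (p 0)) p \<in> {0..1} \<rightarrow> U i"
        using \<alpha>[OF i e(1)] p by (auto simp: concat_loops_def Pi_iff)
      moreover have "simple_in X (U i)" using UDQ[of i] i I(2) by blast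
      moreover have "pathin X (concat_loops (\<alpha> i (p 0)) p)"
        using \<alpha>[OF i e(1)] p by (simp add: pathin_concat)
      ultimately show ?thesis
        using \<alpha>[OF i e(1)] \<alpha>[OF i e(2)] by (intro simple_in_homotopic) auto
    qed
    then show ?thesis
      using holonomy_homotopic holonomy_concat[of "\<alpha> i (p 0)" p] \<alpha>[OF i e(1)] p by metis
  qed
  \<comment> \<open>Finitely many sample points whose simple neighbourhoods cover the compact
    overlap of \<open>D i\<close> and \<open>D j\<close>.\<close>
  have "\<exists>Y W. finite Y \<and> Y \<subseteq> D i \<inter> D j \<and> (\<forall>y\<in>Y. simple_in X (W y) \<and> y \<in> W y \<and> W y \<subseteq> U i \<inter> U j) \<and>
    D i \<inter> D j \<subseteq> \<Union>(W ` Y)"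
    if ij: "i \<in> I" "j \<in> I" for i j
  proof -
    have "\<exists>W. openin X W \<and> y \<in> W \<and> W \<subseteq> U i \<inter> U j \<and> simple_in X W" if y: "y \<in> D i \<inter> D j" for y
    proof (rule locally_simpleD[OF X(3)])
      show "openin X (U i \<inter> U j)" using UDQ[of i] UDQ[of j] ij I(2) by blast
      show "y \<in> U i \<inter> U j" using DU ij y by blast
    qed
    then obtain W where W: "\<And>y. y \<in> D i \<inter> D j \<Longrightarrow>
        openin X (W y) \<and> y \<in> W y \<and> W y \<subseteq> U i \<inter> U j \<and> simple_in X (W y)" by metis
    have "compactin X (D i \<inter> D j)"
      using UDQ[of i] UDQ[of j] ij I(2) X(1) by (intro closedin_compact_space closedin_Int) blast+
    then have "\<exists>\<F>. finite \<F> \<and> \<F> \<subseteq> W ` (D i \<inter> D j) \<and> D i \<inter> D j \<subseteq> \<Union>\<F>"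
      using W unfolding compactin_def by (elim conjE allE[of _ "W ` (D i \<inter> D j)"]) blast
    then obtain \<F> where \<F>: "finite \<F>" "\<F> \<subseteq> W ` (D i \<inter> D j)" "D i \<inter> D j \<subseteq> \<Union>\<F>" by blast
    then obtain Y where Y: "Y \<subseteq> D i \<inter> D j" "finite Y" "\<F> = W ` Y" using finite_subset_image by metis
    then have "D i \<inter> D j \<subseteq> \<Union>(W ` Y)" using \<F> by blast
    then show ?thesis using W Y by (intro exI[of _ Y] exI[of _ W]) blast
  qed
  then obtain Y W where Y: "\<And>i j. i \<in> I \<Longrightarrow> j \<in> I \<Longrightarrow> finite (Y i j) \<and> Y i j \<subseteq> D i \<inter> D j \<and>
      (\<forall>y\<in>Y i j. simple_in X (W i j y) \<and> y \<in> W i j y \<and> W i j y \<subseteq> U i \<inter> U j) \<and> D i \<inter> D j \<subseteq> \<Union>(W i j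
        ` Y i j)"
    by metis
  obtain i0 where i0: "i0 \<in> I" "x0 \<in> D i0" using I base UDQ by blast
  \<comment> \<open>The transition elements at the sample points. The inserted element joins the
    centre of a set around the base point to the base point itself; it undoes the conjugation at the
    end.\<close>
  define S where "S = insert (?\<theta> (\<alpha> i0 x0))
    (\<Union>i\<in>I. \<Union>j\<in>I. (\<lambda>y. ?\<theta> (\<alpha> i y) \<otimes>\<^bsub>PI\<^esub> inv\<^bsub>PI\<^esub> ?\<theta> (\<alpha> j y)) ` Y i j)"
  have finS: "finite S" using I Y by (auto simp: S_def)
  have \<alpha>c: "?\<theta> (\<alpha> i y) \<in> carrier PI" if "i \<in> I" "y \<in> D i" for i y
    using \<alpha>[OF that(1) DU[OF that]] by simp
  have Sc: "S \<subseteq> carrier PI"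
  proof -
    have "y \<in> D i \<and> y \<in> D j" if "i \<in> I" "j \<in> I" "y \<in> Y i j" for i j y
      using Y[OF that(1,2)] that(3) by blast
    then show ?thesis using \<alpha>c i0 unfolding S_def by auto
  qed
  let ?H = "generate PI S"
  have Hg: "subgroup ?H PI" using PI.generate_is_subgroup[OF Sc] .
  \<comment> \<open>The transition element at \<open>y\<close> equals the one at the sample point
    \<open>z\<close> of its piece: the same path \<open>p\<close> from \<open>z\<close> to
    \<open>y\<close> prolongs both chosen paths, and it cancels.\<close>
  have edge: "?\<theta> (\<alpha> i y) \<otimes>\<^bsub>PI\<^esub> inv\<^bsub>PI\<^esub> ?\<theta> (\<alpha> j y) \<in> ?H" if ij: "i \<in> I" "j \<in> I" "y \<in> D i" "y \<in> D
    j" for i j y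
  proof -
    obtain z where z: "z \<in> Y i j" "y \<in> W i j z" using Y[OF ij(1,2)] ij by blast
    then have W: "simple_in X (W i j z)" "z \<in> W i j z" "W i j z \<subseteq> U i \<inter> U j" "z \<in> D i" "z \<in> D j"
      using Y[OF ij(1,2)] by blast+
    obtain p where p: "pathin X p" "p \<in> {0..1} \<rightarrow> W i j z" "p 0 = z" "p 1 = y"
      using W z unfolding simple_in_def by blast
    have "?\<theta> (\<alpha> i z) \<otimes>\<^bsub>PI\<^esub> ?\<theta> p = ?\<theta> (\<alpha> i y)" "?\<theta> (\<alpha> j z) \<otimes>\<^bsub>PI\<^esub> ?\<theta> p = ?\<theta> (\<alpha> j y)"
      using slide[of i p] slide[of j p] p W ij by fastforce+
    then have "?\<theta> (\<alpha> i y) \<otimes>\<^bsub>PI\<^esub> inv\<^bsub>PI\<^esub> ?\<theta> (\<alpha> j y)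
       = (?\<theta> (\<alpha> i z) \<otimes>\<^bsub>PI\<^esub> ?\<theta> p) \<otimes>\<^bsub>PI\<^esub> inv\<^bsub>PI\<^esub> (?\<theta> (\<alpha> j z) \<otimes>\<^bsub>PI\<^esub> ?\<theta> p)"
      by simp
    also have "\<dots> = ?\<theta> (\<alpha> i z) \<otimes>\<^bsub>PI\<^esub> inv\<^bsub>PI\<^esub> ?\<theta> (\<alpha> j z)"
      using \<alpha>c W ij p(1) by (simp add: PI.inv_mult_group PI.m_assoc) (simp add:
        PI.m_assoc[symmetric])
    also have "\<dots> \<in> ?H"
      using z ij by (intro generate.incl) (auto simp: S_def)
    finally show ?thesis .
  qed
  have "?\<theta> f \<in> ?H" if f: "is_loop X x0 f" for f
  proof -
    have fp: "pathin X f" "f 0 = x0" "f 1 = x0" using f by (auto simp: is_loop_def)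
    have fc: "continuous_map (top_of_set {0..1}) X f" using fp by (simp add: pathin_def)
    have ft: "f t \<in> topspace X" if "0 \<le> t" "t \<le> 1" for t
      using continuous_map_image_subset_topspace[OF fc] that by auto
    \<comment> \<open>The holonomy over \<open>{a..b}\<close>, corrected at both ends, lies in the
      generated subgroup. Quantifying over all admissible indices lets any choice at an intermediate
      point fit both halves.\<close>
    define P where "P a b \<longleftrightarrow> (0 \<le> a \<longrightarrow> b \<le> 1 \<longrightarrow> (\<forall>i\<in>I. \<forall>j\<in>I. f a \<in> D i \<longrightarrow> f b \<in> D j \<longrightarrow>
       ?\<theta> (\<alpha> i (f a)) \<otimes>\<^bsub>PI\<^esub> ?\<theta> (f \<circ> linepath a b) \<otimes>\<^bsub>PI\<^esub> inv\<^bsub>PI\<^esub> ?\<theta> (\<alpha> j (f b)) \<in> ?H))" for a b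
    have seg: "pathin X (f \<circ> linepath a b)" if "0 \<le> a" "a \<le> 1" "0 \<le> b" "b \<le> 1" for a b
      using that by (intro pathin_segment[OF _ fc]) auto
    have "P 0 1"
    proof (rule Bolzano)
      show "(0::real) \<le> 1" by simp
    next
      fix a b c assume ab: "P a b" and bc: "P b c" and le: "a \<le> b" "b \<le> c"
      show "P a c"
        unfolding P_def
      proof (intro impI ballI)
        fix i j assume *: "0 \<le> a" "c \<le> 1" "i \<in> I" "j \<in> I" "f a \<in> D i" "f c \<in> D j"
        have "f b \<in> topspace X" using ft le * by auto
        then obtain k where k: "k \<in> I" "f b \<in> D k" using I UDQ by blast
        let ?x = "?\<theta> (\<alpha> i (f a))" and ?y = "?\<theta> (f \<circ> linepath a b)" and ?z = "?\<theta> (\<alpha> k (f b))"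
        let ?u = "?\<theta> (f \<circ> linepath b c)" and ?v = "?\<theta> (\<alpha> j (f c))"
        have 1: "?x \<otimes>\<^bsub>PI\<^esub> ?y \<otimes>\<^bsub>PI\<^esub> inv\<^bsub>PI\<^esub> ?z \<in> ?H" "?z \<otimes>\<^bsub>PI\<^esub> ?u \<otimes>\<^bsub>PI\<^esub> inv\<^bsub>PI\<^esub> ?v \<in> ?H"
          using ab bc * k le unfolding P_def by auto
        have cl: "?x \<in> carrier PI" "?y \<in> carrier PI" "?z \<in> carrier PI" "?u \<in> carrier PI" "?v \<in>
          carrier PI"
          using \<alpha>c * k le by (auto intro!: holonomy_closed seg)
        have "?\<theta> (f \<circ> linepath a c) = ?y \<otimes>\<^bsub>PI\<^esub> ?u"
          using * le by (intro holonomy_triangle[OF _ fc, symmetric]) auto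
        then have "?x \<otimes>\<^bsub>PI\<^esub> ?\<theta> (f \<circ> linepath a c) \<otimes>\<^bsub>PI\<^esub> inv\<^bsub>PI\<^esub> ?v =
          (?x \<otimes>\<^bsub>PI\<^esub> ?y \<otimes>\<^bsub>PI\<^esub> inv\<^bsub>PI\<^esub> ?z) \<otimes>\<^bsub>PI\<^esub> (?z \<otimes>\<^bsub>PI\<^esub> ?u \<otimes>\<^bsub>PI\<^esub> inv\<^bsub>PI\<^esub> ?v)"
          using cl by (simp add: PI.m_assoc) (simp add: PI.m_assoc[symmetric])
        then show "?x \<otimes>\<^bsub>PI\<^esub> ?\<theta> (f \<circ> linepath a c) \<otimes>\<^bsub>PI\<^esub> inv\<^bsub>PI\<^esub> ?v \<in> ?H"
          using subgroup.m_closed[OF Hg 1] by simp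
      qed
    next
      fix x :: real assume x: "0 \<le> x" "x \<le> 1"
      obtain k where k: "k \<in> I" "f x \<in> Q k" using ft[OF x] I by blast
      have "openin (top_of_set {0..1}) {t \<in> {0..1}. f t \<in> Q k}"
        using openin_continuous_map_preimage[OF fc, of "Q k"] UDQ[of k] k I by auto
      then obtain d where d: "d > 0" "\<And>t. t \<in> {0..1} \<Longrightarrow> dist t x < d \<Longrightarrow> f t \<in> Q k"
        using x k unfolding openin_euclidean_subtopology_iff by force
      have "P a b" if ab: "a \<le> x" "x \<le> b" "b - a < d" for a b
        unfolding P_def
      proof (intro impI ballI)
        fix i j assume *: "0 \<le> a" "b \<le> 1" "i \<in> I" "j \<in> I" "f a \<in> D i" "f b \<in> D j"
        have Qk: "f t \<in> Q k" if "a \<le> t" "t \<le> b" for t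
          using that d(2)[of t] ab * by (auto simp: dist_real_def)
        have QDU: "Q k \<subseteq> D k" "D k \<subseteq> U k" using UDQ[of k] k I by auto
        have Dk: "f a \<in> D k" "f b \<in> D k" using Qk QDU ab by auto
        have "f \<circ> linepath a b \<in> {0..1} \<rightarrow> U k"
        proof
          fix t :: real assume "t \<in> {0..1}"
          then have "linepath a b t \<in> closed_segment a b" by (simp add: linepath_in_path)
          then show "(f \<circ> linepath a b) t \<in> U k"
            using Qk QDU ab by (auto simp: closed_segment_eq_real_ivl)
        qed
        then have sl: "?\<theta> (\<alpha> k (f a)) \<otimes>\<^bsub>PI\<^esub> ?\<theta> (f \<circ> linepath a b) = ?\<theta> (\<alpha> k (f b))"
          using slide[of k "f \<circ> linepath a b"] seg[of a b] * ab x k by (simp add: linepath_0'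
            linepath_1')
        let ?x = "?\<theta> (\<alpha> i (f a))" and ?y = "?\<theta> (f \<circ> linepath a b)" and ?z = "?\<theta> (\<alpha> k (f a))"
          and ?v = "?\<theta> (\<alpha> j (f b))"
        have cl: "?x \<in> carrier PI" "?y \<in> carrier PI" "?z \<in> carrier PI" "?v \<in> carrier PI"
          using \<alpha>c * k Dk x ab by (auto intro!: holonomy_closed seg)
        have "?x \<otimes>\<^bsub>PI\<^esub> ?y \<otimes>\<^bsub>PI\<^esub> inv\<^bsub>PI\<^esub> ?v = (?x \<otimes>\<^bsub>PI\<^esub> inv\<^bsub>PI\<^esub> ?z) \<otimes>\<^bsub>PI\<^esub> (?z \<otimes>\<^bsub>PI\<^esub> ?y \<otimes>\<^bsub>PI\<^esub>
          inv\<^bsub>PI\<^esub> ?v)"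
          using cl by (simp add: PI.m_assoc) (simp add: PI.m_assoc[symmetric])
        then show "?x \<otimes>\<^bsub>PI\<^esub> ?y \<otimes>\<^bsub>PI\<^esub> inv\<^bsub>PI\<^esub> ?v \<in> ?H"
          using subgroup.m_closed[OF Hg edge[of i k "f a"] edge[of k j "f b"]] * k Dk by (simp
            add: sl)
      qed
      then show "\<exists>d>0. \<forall>a b. a \<le> x \<and> x \<le> b \<and> b - a < d \<longrightarrow> P a b" using d(1) by blast
    qed
    moreover have "f \<circ> linepath 0 1 = f" by (auto simp: linepath_def)
    ultimately have 1: "?\<theta> (\<alpha> i0 x0) \<otimes>\<^bsub>PI\<^esub> ?\<theta> f \<otimes>\<^bsub>PI\<^esub> inv\<^bsub>PI\<^esub> ?\<theta> (\<alpha> i0 x0) \<in> ?H"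
      using i0 fp unfolding P_def by auto
    have 2: "?\<theta> (\<alpha> i0 x0) \<in> ?H" by (intro generate.incl) (simp add: S_def)
    let ?a = "?\<theta> (\<alpha> i0 x0)"
    have "inv\<^bsub>PI\<^esub> ?a \<otimes>\<^bsub>PI\<^esub> (?a \<otimes>\<^bsub>PI\<^esub> ?\<theta> f \<otimes>\<^bsub>PI\<^esub> inv\<^bsub>PI\<^esub> ?a) \<otimes>\<^bsub>PI\<^esub> ?a \<in> ?H"
      using Hg 1 2 by (meson subgroup.m_closed subgroup.m_inv_closed)
    moreover have "inv\<^bsub>PI\<^esub> ?a \<otimes>\<^bsub>PI\<^esub> (?a \<otimes>\<^bsub>PI\<^esub> ?\<theta> f \<otimes>\<^bsub>PI\<^esub> inv\<^bsub>PI\<^esub> ?a) \<otimes>\<^bsub>PI\<^esub> ?a = ?\<theta> f"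
      using \<alpha>c i0 fp(1) by (simp add: PI.m_assoc) (simp add: PI.m_assoc[symmetric])
    ultimately show ?thesis by simp
  qed
  then have "carrier PI \<subseteq> ?H"
    by (auto simp: carrier_fundamental_group) (metis holonomy_loop)
  then have "generating_set PI S"
    unfolding generating_set_def using finS Sc PI.generate_incl[OF Sc] by auto
  then show ?thesis by blast
qed


section \<open>Principal actions of topological groups\<close>

lemma istopology_quotient:
  "istopology (\<lambda>V. V \<subseteq> q ` topspace X \<and> openin X {x \<in> topspace X. q x \<in> V})"
  unfolding istopology_def
proof (intro conjI allI impI)
  fix S T
  assume "S \<subseteq> q ` topspace X \<and> openin X {x \<in> topspace X. q x \<in> S}"
    "T \<subseteq> q ` topspace X \<and> openin X {x \<in> topspace X. q x \<in> T}"
  moreover have "{x \<in> topspace X. q x \<in> S \<inter> T} = {x \<in> topspace X. q x \<in> S} \<inter> {x \<in> topspace X. q x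
    \<in> T}"
    by blast
  ultimately show "S \<inter> T \<subseteq> q ` topspace X" "openin X {x \<in> topspace X. q x \<in> S \<inter> T}" by auto
next
  fix \<K> assume a: "\<forall>S\<in>\<K>. S \<subseteq> q ` topspace X \<and> openin X {x \<in> topspace X. q x \<in> S}"
  then show "\<Union>\<K> \<subseteq> q ` topspace X" by blast
  have "{x \<in> topspace X. q x \<in> \<Union>\<K>} = (\<Union>S\<in>\<K>. {x \<in> topspace X. q x \<in> S})" by blast
  then show "openin X {x \<in> topspace X. q x \<in> \<Union>\<K>}" using a by auto
qed

lemma openin_quotient_topology:
  "openin (quotient_topology X q) V \<longleftrightarrow> V \<subseteq> q ` topspace X \<and> openin X {x \<in> topspace X. q x \<in> V}"
  unfolding quotient_topology_def topology_inverse'[OF istopology_quotient] ..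

lemma topspace_quotient_topology: "topspace (quotient_topology X q) = q ` topspace X"
proof
  show "topspace (quotient_topology X q) \<subseteq> q ` topspace X"
    using openin_quotient_topology[of X q] openin_topspace by blast
  have "{x \<in> topspace X. q x \<in> q ` topspace X} = topspace X" by blast
  then have "openin (quotient_topology X q) (q ` topspace X)"
    unfolding openin_quotient_topology by simp
  then show "q ` topspace X \<subseteq> topspace (quotient_topology X q)"
    by (rule openin_subset)
qed

locale topological_group =
  fixes K :: "'k monoid" (structure) and T :: "'k topology"
  assumes grp: "group K" and carrier_eq: "carrier K = topspace T"
    and mult_cont: "continuous_map (prod_topology T T) T (\<lambda>(x, y). x \<otimes> y)"
    and inv_cont: "continuous_map T T (\<lambda>x. inv x)"
begin

sublocale group K by (rule grp)

lemma continuous_map_mult: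
  assumes "continuous_map Z T f" "continuous_map Z T g"
  shows "continuous_map Z T (\<lambda>z. f z \<otimes> g z)"
  using continuous_map_compose[OF continuous_map_pairedI[OF assms] mult_cont] by (simp add: o_def)

lemma continuous_map_inv: "continuous_map Z T f \<Longrightarrow> continuous_map Z T (\<lambda>z. inv (f z))"
  using continuous_map_compose[OF _ inv_cont] by (simp add: o_def)

end

locale continuous_action = topological_group K T
  for K :: "'k monoid" (structure) and T :: "'k topology" +
  fixes X :: "'x topology" and act :: "'k \<Rightarrow> 'x \<Rightarrow> 'x"
  assumes act_closed: "k \<in> carrier K \<Longrightarrow> x \<in> topspace X \<Longrightarrow> act k x \<in> topspace X"
    and act_one: "x \<in> topspace X \<Longrightarrow> act \<one> x = x"
    and act_mult: "k \<in> carrier K \<Longrightarrow> l \<in> carrier K \<Longrightarrow> x \<in> topspace X \<Longrightarrow>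
      act (k \<otimes> l) x = act k (act l x)"
    and act_cont: "continuous_map (prod_topology T X) X (\<lambda>(k, x). act k x)"
begin

lemma continuous_map_act:
  assumes "continuous_map Z T f" "continuous_map Z X g"
  shows "continuous_map Z X (\<lambda>z. act (f z) (g z))"
  using continuous_map_compose[OF continuous_map_pairedI[OF assms] act_cont] by (simp add: o_def)

abbreviation "proj \<equiv> orbit K act"
abbreviation "BX \<equiv> orbit_space K X act"

lemma openin_BX: "openin BX V \<longleftrightarrow> V \<subseteq> proj ` topspace X \<and> openin X {x \<in> topspace X. proj x \<in> V}"
  by (simp add: orbit_space_def openin_quotient_topology)

lemma topspace_BX: "topspace BX = proj ` topspace X"
  by (simp add: orbit_space_def topspace_quotient_topology)

lemma proj_cont: "continuous_map X BX proj"
  unfolding continuous_map_def topspace_BX by (auto simp: openin_BX)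

lemma proj_act: "k \<in> carrier K \<Longrightarrow> x \<in> topspace X \<Longrightarrow> proj (act k x) = proj x"
proof -
  assume k: "k \<in> carrier K" and x: "x \<in> topspace X"
  have "act g (act k x) \<in> proj x" if "g \<in> carrier K" for g
    using that k x act_mult[of g k x] m_closed[of g k] unfolding orbit_def
    by (intro CollectI exI[of _ "g \<otimes> k"]) auto
  moreover have "act g x \<in> proj (act k x)" if g: "g \<in> carrier K" for g
  proof -
    have "act (g \<otimes> inv k) (act k x) = act g x"
      using act_mult[of "g \<otimes> inv k" k x] g k x by (simp add: m_assoc)
    then show ?thesis using g k unfolding orbit_def by (metis (mono_tags, lifting) inv_closed
      m_closed mem_Collect_eq)
  qed
  ultimately show ?thesis unfolding orbit_def by blast
qed

lemma proj_eq_iff: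
  assumes "x \<in> topspace X" "y \<in> topspace X"
  shows "proj x = proj y \<longleftrightarrow> (\<exists>k\<in>carrier K. y = act k x)"
proof
  assume e: "proj x = proj y"
  have "y \<in> proj y" using act_one[OF assms(2)] one_closed unfolding orbit_def by (intro CollectI
    exI[of _ \<one>]) auto
  then show "\<exists>k\<in>carrier K. y = act k x" using e unfolding orbit_def by blast
next
  assume "\<exists>k\<in>carrier K. y = act k x"
  then show "proj x = proj y" using proj_act assms by metis
qed

lemma act_inv: "k \<in> carrier K \<Longrightarrow> x \<in> topspace X \<Longrightarrow> act (inv k) (act k x) = x"
  using act_mult[of "inv k" k x] by (simp add: act_one)

text \<open>The translation function of a free action. Its value is meaningful only if
  \<open>x\<close> and \<open>y\<close> lie in the same orbit.\<close>

definition diff :: "'x \<Rightarrow> 'x \<Rightarrow> 'k" where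
  "diff x y = (THE k. k \<in> carrier K \<and> y = act k x)"

end

text \<open>Local triviality is encoded by an equivariant map from an invariant open set to the
  group, the fibre coordinate of a trivialization. Freeness, continuity of \<open>diff\<close> and
  local sections can be read off from it.\<close>

locale principal_action = continuous_action +
  assumes local_triv: "x \<in> topspace X \<Longrightarrow> \<exists>W \<tau>. openin X W \<and> x \<in> W \<and>
     continuous_map (subtopology X W) T \<tau> \<and>
     (\<forall>k\<in>carrier K. \<forall>y\<in>W. act k y \<in> W \<and> \<tau> (act k y) = k \<otimes> \<tau> y)"
begin

lemma free:
  assumes "k \<in> carrier K" "l \<in> carrier K" "x \<in> topspace X" "act k x = act l x"
  shows "k = l"
proof -
  obtain W \<tau> where W: "openin X W" "x \<in> W" "continuous_map (subtopology X W) T \<tau>"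
    "\<forall>k\<in>carrier K. \<forall>y\<in>W. act k y \<in> W \<and> \<tau> (act k y) = k \<otimes> \<tau> y"
    using local_triv[OF assms(3)] by blast
  have "\<tau> x \<in> carrier K"
    using continuous_map_image_subset_topspace[OF W(3)] W(2) assms(3) carrier_eq by auto
  moreover have "k \<otimes> \<tau> x = l \<otimes> \<tau> x" using W assms by metis
  ultimately show ?thesis using assms by simp
qed

lemma diff_act: "k \<in> carrier K \<Longrightarrow> x \<in> topspace X \<Longrightarrow> diff x (act k x) = k"
  unfolding diff_def by (rule the_equality) (auto dest: free)

lemma diff:
  assumes "x \<in> topspace X" "y \<in> topspace X" "proj x = proj y"
  shows "diff x y \<in> carrier K" "act (diff x y) x = y"
  using assms diff_act proj_eq_iff by metis+

text \<open>Locally \<open>diff (u z) (v z)\<close> is the product of \<tau> at \<open>v z\<close>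
  with the inverse of \<tau> at \<open>u z\<close>. The domain of \<tau> is invariant, so it
  contains \<open>v z\<close> whenever it contains \<open>u z\<close>.\<close>

lemma diff_cont:
  assumes u: "continuous_map Z X u" and v: "continuous_map Z X v"
    and uv: "\<And>z. z \<in> topspace Z \<Longrightarrow> proj (u z) = proj (v z)"
  shows "continuous_map Z T (\<lambda>z. diff (u z) (v z))"
proof -
  have uX: "u z \<in> topspace X" and vX: "v z \<in> topspace X" if "z \<in> topspace Z" for z
    using that u v continuous_map_image_subset_topspace by blast+
  obtain W \<tau> where W: "\<And>x. x \<in> topspace X \<Longrightarrow> openin X (W x) \<and> x \<in> W x \<and>
     continuous_map (subtopology X (W x)) T (\<tau> x) \<and>
     (\<forall>k\<in>carrier K. \<forall>y\<in>W x. act k y \<in> W x \<and> \<tau> x (act k y) = k \<otimes> \<tau> x y)"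
    using local_triv by metis
  define N where "N z = {w \<in> topspace Z. u w \<in> W (u z)}" for z
  show ?thesis
  proof (rule pasting_lemma[where I = "topspace Z" and T = N and f = "\<lambda>_ z. diff (u z) (v z)"])
    fix z assume z: "z \<in> topspace Z"
    note Wz = W[OF uX[OF z]]
    show "openin Z (N z)"
      unfolding N_def using Wz u openin_continuous_map_preimage by blast
    have cu: "continuous_map (subtopology Z (N z)) (subtopology X (W (u z))) u"
      using u by (auto simp: continuous_map_in_subtopology continuous_map_from_subtopology N_def)
    have vW: "v w = act (diff (u w) (v w)) (u w)" "v w \<in> W (u z)" "u w \<in> W (u z)" if "w \<in> N z" for w
      using that Wz uv diff[OF uX vX uv] by (auto simp: N_def) metis
    then have cv: "continuous_map (subtopology Z (N z)) (subtopology X (W (u z))) v"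
      using v by (auto simp: continuous_map_in_subtopology continuous_map_from_subtopology)
    have c: "continuous_map (subtopology Z (N z)) T (\<lambda>w. \<tau> (u z) (v w) \<otimes> inv (\<tau> (u z) (u w)))"
      using continuous_map_compose[OF cu] continuous_map_compose[OF cv] Wz
      by (intro continuous_map_mult continuous_map_inv) (auto simp: o_def)
    show "continuous_map (subtopology Z (N z)) T (\<lambda>z. diff (u z) (v z))"
    proof (rule continuous_map_eq[OF c])
      fix w assume w: "w \<in> topspace (subtopology Z (N z))"
      then have wN: "w \<in> N z" "w \<in> topspace Z" by auto
      have d: "diff (u w) (v w) \<in> carrier K" using diff(1)[OF uX vX uv] wN(2) by simp
      have t: "\<tau> (u z) (u w) \<in> carrier K"
      proof -
        have "\<tau> (u z) ` topspace (subtopology X (W (u z))) \<subseteq> topspace T"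
          using Wz by (intro continuous_map_image_subset_topspace) blast
        then show ?thesis using vW(3)[OF wN(1)] uX[OF wN(2)] carrier_eq by auto
      qed
      have "\<tau> (u z) (v w) = diff (u w) (v w) \<otimes> \<tau> (u z) (u w)"
        using Wz vW[OF wN(1)] d by metis
      then show "\<tau> (u z) (v w) \<otimes> inv (\<tau> (u z) (u w)) = diff (u w) (v w)"
        using d t by (simp add: m_assoc)
    qed
  qed (use W uX in \<open>auto simp: N_def\<close>)
qed

text \<open>Translating \<open>y\<close> by the inverse of its fibre coordinate gives a map that is
  constant on orbits, hence descends to the orbit space.\<close>

lemma local_section:
  assumes "b \<in> topspace BX"
  obtains V \<sigma> where "openin BX V" "b \<in> V" "continuous_map (subtopology BX V) X \<sigma>"
    "\<And>c. c \<in> V \<Longrightarrow> proj (\<sigma> c) = c"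
proof -
  obtain x where x: "x \<in> topspace X" "b = proj x" using assms topspace_BX by blast
  obtain W \<tau> where W: "openin X W" "x \<in> W" "continuous_map (subtopology X W) T \<tau>"
    "\<forall>k\<in>carrier K. \<forall>y\<in>W. act k y \<in> W \<and> \<tau> (act k y) = k \<otimes> \<tau> y"
    using local_triv[OF x(1)] by blast
  have WX: "W \<subseteq> topspace X" using W(1) openin_subset by auto
  have \<tau>: "\<tau> y \<in> carrier K" if "y \<in> W" for y
    using continuous_map_image_subset_topspace[OF W(3)] that WX carrier_eq by auto
  define g where "g y = act (inv (\<tau> y)) y" for y
  have g_act: "g (act k y) = g y" if "k \<in> carrier K" "y \<in> W" for k y
  proof -
    have "g (act k y) = act (inv (\<tau> y) \<otimes> inv k) (act k y)"
      unfolding g_def using W(4) that \<tau> by (simp add: inv_mult_group)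
    also have "\<dots> = act (inv (\<tau> y)) (act (inv k) (act k y))"
      using that \<tau> WX by (intro act_mult) (auto intro: act_closed)
    finally show ?thesis using that WX act_inv by (simp add: g_def subset_iff)
  qed
  have gX: "g y \<in> topspace X" "proj (g y) = proj y" if "y \<in> W" for y
    using that \<tau> WX proj_act act_closed unfolding g_def by auto
  have gcont: "continuous_map (subtopology X W) X g"
    unfolding g_def using W(3)
    by (intro continuous_map_act continuous_map_inv) (auto simp: continuous_map_from_subtopology)
  have sat: "y \<in> W" if "y \<in> topspace X" "proj y \<in> proj ` W" for y
  proof -
    obtain w where "w \<in> W" "proj y = proj w" using \<open>proj y \<in> proj ` W\<close> by blast
    then show ?thesis using proj_eq_iff[of w y] WX W(4) that by auto
  qed
  define \<sigma> where "\<sigma> c = g (SOME y. y \<in> W \<and> proj y = c)" for c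
  have \<sigma>: "\<sigma> (proj y) = g y" if yW: "y \<in> W" for y
  proof -
    define y' where "y' = (SOME z. z \<in> W \<and> proj z = proj y)"
    have "y' \<in> W" "proj y' = proj y"
      using someI[of "\<lambda>z. z \<in> W \<and> proj z = proj y" y] that unfolding y'_def by auto
    then obtain k where "k \<in> carrier K" "y' = act k y"
      using proj_eq_iff[of y y'] WX yW by blast
    then show ?thesis using g_act that unfolding \<sigma>_def y'_def by metis
  qed
  have pre: "{y \<in> topspace X. proj y \<in> proj ` W} = W" using sat WX by blast
  have V: "openin BX (proj ` W)" using W(1) WX by (auto simp: openin_BX pre)
  moreover have "continuous_map (subtopology BX (proj ` W)) X \<sigma>"
    unfolding continuous_map_def
  proof (intro conjI allI impI)
    show "\<sigma> \<in> topspace (subtopology BX (proj ` W)) \<rightarrow> topspace X" using \<sigma> gX by auto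
    fix U assume U: "openin X U"
    have "{y \<in> topspace X. proj y \<in> {c \<in> topspace (subtopology BX (proj ` W)). \<sigma> c \<in> U}} =
        {y \<in> topspace (subtopology X W). g y \<in> U}"
    proof -
      have "\<sigma> (proj y) = g y \<and> y \<in> W" if "y \<in> topspace X" "proj y \<in> proj ` W" for y
        using that \<sigma> sat by blast
      then show ?thesis using WX by (auto simp: topspace_BX) (metis image_eqI)+
    qed
    moreover have "openin X {y \<in> topspace (subtopology X W). g y \<in> U}"
      using openin_continuous_map_preimage[OF gcont U] W(1) openin_trans_full by blast
    ultimately have "openin BX {c \<in> topspace (subtopology BX (proj ` W)). \<sigma> c \<in> U}"
      unfolding openin_BX using topspace_BX by auto
    then show "openin (subtopology BX (proj ` W)) {c \<in> topspace (subtopology BX (proj ` W)). \<sigma> c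
      \<in> U}"
      unfolding openin_subtopology by (intro exI[of _ "{c \<in> topspace (subtopology BX (proj ` W)).
        \<sigma> c \<in> U}"]) auto
  qed
  moreover have "proj (\<sigma> c) = c" if "c \<in> proj ` W" for c
    using that \<sigma> gX by auto
  ultimately show thesis
    using that[of "proj ` W" \<sigma>] x W(2) by blast
qed

section \<open>Lifting maps on boxes through a principal action\<close>

definition liftable :: "('c::euclidean_space \<Rightarrow> 'b set) \<Rightarrow> 'c set \<Rightarrow> bool" where
  "liftable f Q \<longleftrightarrow> (\<exists>l. continuous_map (top_of_set Q) X l \<and> (\<forall>z\<in>Q. proj (l z) = f z))"

lemma liftable_mono:
  assumes "liftable f Q" "Q' \<subseteq> Q" shows "liftable f Q'"
  using assms unfolding liftable_def by (meson continuous_map_from_subtopology_mono subsetD)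

text \<open>On the overlap the two lifts differ by a function with values in \<open>K\<close>. The
  retraction \<open>r\<close> of \<open>Q2\<close> onto the overlap extends this function over
  \<open>Q2\<close>, where it corrects the second lift.\<close>

lemma liftable_glue:
  assumes l: "liftable f Q1" "liftable f Q2"
    and cl: "closedin (top_of_set (Q1 \<union> Q2)) Q1" "closedin (top_of_set (Q1 \<union> Q2)) Q2"
    and r: "continuous_on Q2 r" "r \<in> Q2 \<rightarrow> Q1 \<inter> Q2" "\<And>z. z \<in> Q1 \<inter> Q2 \<Longrightarrow> r z = z"
  shows "liftable f (Q1 \<union> Q2)"
proof -
  obtain l1 where l1: "continuous_map (top_of_set Q1) X l1" "\<And>z. z \<in> Q1 \<Longrightarrow> proj (l1 z) = f z"
    using l(1) unfolding liftable_def by blast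
  obtain l2 where l2: "continuous_map (top_of_set Q2) X l2" "\<And>z. z \<in> Q2 \<Longrightarrow> proj (l2 z) = f z"
    using l(2) unfolding liftable_def by blast
  have l1X: "l1 z \<in> topspace X" if "z \<in> Q1" for z
    using continuous_map_image_subset_topspace[OF l1(1)] that by auto
  have l2X: "l2 z \<in> topspace X" if "z \<in> Q2" for z
    using continuous_map_image_subset_topspace[OF l2(1)] that by auto
  define k where "k z = diff (l2 (r z)) (l1 (r z))" for z
  have rQ: "continuous_map (top_of_set Q2) (top_of_set Q1) r" "continuous_map (top_of_set Q2)
    (top_of_set Q2) r"
    using r by auto
  have k: "continuous_map (top_of_set Q2) T k"
    unfolding k_def
  proof (rule diff_cont)
    show "continuous_map (top_of_set Q2) X (\<lambda>z. l2 (r z))" "continuous_map (top_of_set Q2) X (\<lambda>z.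
      l1 (r z))"
      using continuous_map_compose[OF rQ(1) l1(1)] continuous_map_compose[OF rQ(2) l2(1)] by
        (auto simp: o_def)
    show "proj (l2 (r z)) = proj (l1 (r z))" if "z \<in> topspace (top_of_set Q2)" for z
      using that r l1(2) l2(2) by (auto simp: Pi_iff)
  qed
  define m where "m z = act (k z) (l2 z)" for z
  have m: "continuous_map (top_of_set Q2) X m"
    unfolding m_def using k l2(1) by (rule continuous_map_act)
  have kc: "k z \<in> carrier K" if "z \<in> Q2" for z
    using continuous_map_image_subset_topspace[OF k] that carrier_eq by auto
  have mproj: "proj (m z) = f z" if "z \<in> Q2" for z
    using that kc l2 l2X by (simp add: m_def proj_act)
  have agree: "l1 z = m z" if "z \<in> Q1" "z \<in> Q2" for z
    using that r(3)[of z] l1 l2 l1X l2X diff(2)[of "l2 z" "l1 z"] by (auto simp: m_def k_def)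
  define n where "n z = (if z \<in> Q1 then l1 z else m z)" for z
  have "continuous_map (top_of_set (Q1 \<union> Q2)) X n"
  proof (rule pasting_lemma_closed[where I = "{True, False}" and T = "\<lambda>b. if b then Q1 else Q2"
        and f = "\<lambda>b. if b then l1 else m"])
    show "\<And>i. i \<in> {True, False} \<Longrightarrow> closedin (top_of_set (Q1 \<union> Q2)) (if i then Q1 else Q2)"
      using cl by auto
    have "(Q1 \<union> Q2) \<inter> Q1 = Q1" "(Q1 \<union> Q2) \<inter> Q2 = Q2" by auto
    then show "\<And>i. i \<in> {True, False} \<Longrightarrow>
        continuous_map (subtopology (top_of_set (Q1 \<union> Q2)) (if i then Q1 else Q2)) X (if i then
          l1 else m)"
      using l1(1) m by (auto simp: subtopology_subtopology)
  qed (use agree in \<open>auto simp: n_def split: if_splits\<close>)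
  moreover have "\<forall>z\<in>Q1 \<union> Q2. proj (n z) = f z" using l1 mproj by (auto simp: n_def)
  ultimately show ?thesis unfolding liftable_def by blast
qed

text \<open>The coordinates are released one at a time. \<open>N S x \<delta>\<close> is the part of
  the box that is \<delta>-close to \<open>x\<close> in the directions outside \<open>S\<close>: for
  empty \<open>S\<close> a local section lifts it, and for \<open>S = Basis\<close> it is the whole
  box. A direction is released by bisection along it, with \<delta> shrinking at every
  gluing.\<close>

lemma liftable_cbox:
  fixes f :: "'c::euclidean_space \<Rightarrow> 'b set"
  assumes f: "continuous_map (top_of_set (cbox a b)) BX f"
  shows "liftable f (cbox a b)"
proof (cases "cbox a b = {}")
  case True then show ?thesis unfolding liftable_def by (simp add: continuous_map_on_empty)
next
  case False
  define N where "N S x \<delta> = {y \<in> cbox a b. \<forall>i\<in>Basis - S. \<bar>y \<bullet> i - x \<bullet> i\<bar> \<le> \<delta>}" for S and x :: 'c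
    and \<delta> :: real
  have step0: "\<exists>\<delta>>0. liftable f (N {} x \<delta>)" if x: "x \<in> cbox a b" for x
  proof -
    have "f x \<in> topspace BX" using continuous_map_image_subset_topspace[OF f] x by auto
    then obtain V \<sigma> where V: "openin BX V" "f x \<in> V" "continuous_map (subtopology BX V) X \<sigma>"
      "\<And>c. c \<in> V \<Longrightarrow> proj (\<sigma> c) = c" by (rule local_section) blast
    have "openin (top_of_set (cbox a b)) {y \<in> cbox a b. f y \<in> V}"
      using openin_continuous_map_preimage[OF f V(1)] by simp
    then obtain e where e: "e > 0" "\<And>y. y \<in> cbox a b \<Longrightarrow> dist y x < e \<Longrightarrow> f y \<in> V"
      using x V(2) unfolding openin_euclidean_subtopology_iff by force
    \<comment> \<open>The norm is at most the sum of the coordinate distances, so coordinatewise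
      \<delta>-closeness gives distance at most \<open>e / 2\<close>.\<close>
    define \<delta> where "\<delta> = e / (2 * DIM('c))"
    have \<delta>: "\<delta> > 0" using e by (simp add: \<delta>_def)
    have NV: "f y \<in> V" if y: "y \<in> N {} x \<delta>" for y
    proof -
      have "norm (y - x) \<le> (\<Sum>i\<in>Basis. \<bar>(y - x) \<bullet> i\<bar>)" by (rule norm_le_l1)
      also have "\<dots> \<le> (\<Sum>i\<in>(Basis :: 'c set). \<delta>)"
        using y by (intro sum_mono) (auto simp: N_def inner_diff_left)
      also have "\<dots> = e / 2" by (simp add: \<delta>_def)
      also have "\<dots> < e" using e by simp
      finally show ?thesis using y e(2)[of y] by (auto simp: N_def dist_norm)
    qed
    have "continuous_map (top_of_set (N {} x \<delta>)) (subtopology BX V) f"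
      using NV continuous_map_from_subtopology_mono[OF f, of "N {} x \<delta>"]
      by (auto simp: continuous_map_in_subtopology N_def)
    then have "liftable f (N {} x \<delta>)"
      unfolding liftable_def using V NV continuous_map_compose by (intro exI[of _ "\<sigma> \<circ> f"]) auto
    then show ?thesis using \<delta> by blast
  qed
  have step: "\<forall>x\<in>cbox a b. \<exists>\<delta>>0. liftable f (N S x \<delta>)" if "finite S" "S \<subseteq> Basis" for S
    using that
  proof (induction S rule: finite_induct)
    case empty then show ?case using step0 by blast
  next
    case (insert i S)
    then have i: "i \<in> Basis" "i \<notin> S" and IH: "\<And>x. x \<in> cbox a b \<Longrightarrow> \<exists>\<delta>>0. liftable f (N S x \<delta>)" by auto
    show ?case
    proof
      fix x assume x: "x \<in> cbox a b"
      have ab: "a \<bullet> j \<le> b \<bullet> j" if "j \<in> Basis" for j using x that by (auto simp: mem_box intro: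
        order_trans)
      define P where "P c d \<longleftrightarrow> (a \<bullet> i \<le> c \<longrightarrow> d \<le> b \<bullet> i \<longrightarrow>
         (\<exists>\<delta>>0. liftable f {y \<in> N (insert i S) x \<delta>. c \<le> y \<bullet> i \<and> y \<bullet> i \<le> d}))" for c d
      have coord: "(y + (s - y \<bullet> i) *\<^sub>R i) \<bullet> j = (if j = i then s else y \<bullet> j)" if "j \<in> Basis" for
        y s j
        using that i by (simp add: inner_add_left inner_Basis)
      have move: "y + (s - y \<bullet> i) *\<^sub>R i \<in> cbox a b" if "y \<in> cbox a b" "a \<bullet> i \<le> s" "s \<le> b \<bullet> i" for
        y s
        using that coord by (auto simp: mem_box)
      have "P (a \<bullet> i) (b \<bullet> i)"
      proof (rule Bolzano)
        show "a \<bullet> i \<le> b \<bullet> i" using ab i by blast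
      next
        fix c d e assume P: "P c d" "P d e" and le: "c \<le> d" "d \<le> e"
        show "P c e"
          unfolding P_def
        proof (intro impI)
          assume ce: "a \<bullet> i \<le> c" "e \<le> b \<bullet> i"
          obtain \<delta>1 where d1: "\<delta>1 > 0" "liftable f {y \<in> N (insert i S) x \<delta>1. c \<le> y \<bullet> i \<and> y \<bullet> i \<le> d}"
            using P(1) ce le unfolding P_def by auto
          obtain \<delta>2 where d2: "\<delta>2 > 0" "liftable f {y \<in> N (insert i S) x \<delta>2. d \<le> y \<bullet> i \<and> y \<bullet> i \<le> e}"
            using P(2) ce le unfolding P_def by auto
          define \<delta> where "\<delta> = min \<delta>1 \<delta>2"
          define Q1 where "Q1 = {y \<in> N (insert i S) x \<delta>. c \<le> y \<bullet> i \<and> y \<bullet> i \<le> d}"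
          define Q2 where "Q2 = {y \<in> N (insert i S) x \<delta>. d \<le> y \<bullet> i \<and> y \<bullet> i \<le> e}"
          \<comment> \<open>Projection along \<open>i\<close> to the common face of the two slabs,
            the retraction required by \<open>liftable_glue\<close>.\<close>
          define r where "r y = y + (d - y \<bullet> i) *\<^sub>R i" for y
          have "liftable f Q1" "liftable f Q2"
            using d1(2) d2(2) by (auto simp: Q1_def Q2_def N_def \<delta>_def intro: liftable_mono)
          moreover have "Q1 = (Q1 \<union> Q2) \<inter> {y. y \<bullet> i \<le> d}" "Q2 = (Q1 \<union> Q2) \<inter> {y. d \<le> y \<bullet> i}"
            using le by (auto simp: Q1_def Q2_def)
          then have "closedin (top_of_set (Q1 \<union> Q2)) Q1" "closedin (top_of_set (Q1 \<union> Q2)) Q2"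
            using closed_halfspace_component_le[of i d] closed_halfspace_component_ge[of d i]
            by (metis closedin_closed_Int)+
          moreover have "continuous_on Q2 r" unfolding r_def by (intro continuous_intros)
          moreover have "r \<in> Q2 \<rightarrow> Q1 \<inter> Q2"
          proof
            fix y assume y: "y \<in> Q2"
            have "r y \<in> N (insert i S) x \<delta>"
              using y move[of y d] ce le coord[of _ y d] unfolding N_def Q2_def r_def by auto
            moreover have "r y \<bullet> i = d" using coord[OF i(1)] by (simp add: r_def)
            ultimately show "r y \<in> Q1 \<inter> Q2" using le by (simp add: Q1_def Q2_def)
          qed
          moreover have "\<And>z. z \<in> Q1 \<inter> Q2 \<Longrightarrow> r z = z"
            by (auto simp: Q1_def Q2_def r_def)
          ultimately have "liftable f (Q1 \<union> Q2)" by (rule liftable_glue)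
          moreover have "Q1 \<union> Q2 = {y \<in> N (insert i S) x \<delta>. c \<le> y \<bullet> i \<and> y \<bullet> i \<le> e}"
            using le by (auto simp: Q1_def Q2_def)
          moreover have "\<delta> > 0" using d1 d2 by (simp add: \<delta>_def)
          ultimately show "\<exists>\<delta>>0. liftable f {y \<in> N (insert i S) x \<delta>. c \<le> y \<bullet> i \<and> y \<bullet> i \<le> e}" by auto
        qed
      next
        fix s assume s: "a \<bullet> i \<le> s" "s \<le> b \<bullet> i"
        define x' where "x' = x + (s - x \<bullet> i) *\<^sub>R i"
        obtain \<delta> where d: "\<delta> > 0" "liftable f (N S x' \<delta>)"
          using IH[of x'] move[OF x s] unfolding x'_def by blast
        have "P c d" if cd: "c \<le> s" "s \<le> d" "d - c < \<delta>" for c d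
        proof -
          have "{y \<in> N (insert i S) x \<delta>. c \<le> y \<bullet> i \<and> y \<bullet> i \<le> d} \<subseteq> N S x' \<delta>"
          proof
            fix y assume y: "y \<in> {y \<in> N (insert i S) x \<delta>. c \<le> y \<bullet> i \<and> y \<bullet> i \<le> d}"
            have "\<bar>y \<bullet> j - x' \<bullet> j\<bar> \<le> \<delta>" if "j \<in> Basis - S" for j
              using that y cd coord[of j x s] unfolding x'_def N_def by (cases "j = i") auto
            then show "y \<in> N S x' \<delta>" using y by (simp add: N_def)
          qed
          then show ?thesis unfolding P_def using d liftable_mono by blast
        qed
        then show "\<exists>\<delta>>0. \<forall>c d. c \<le> s \<and> s \<le> d \<and> d - c < \<delta> \<longrightarrow> P c d" using d(1) by blast
      qed
      then obtain \<delta> where "\<delta> > 0" "liftable f {y \<in> N (insert i S) x \<delta>. a \<bullet> i \<le> y \<bullet> i \<and> y \<bullet> i \<le> b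
        \<bullet> i}"
        unfolding P_def by auto
      moreover have "{y \<in> N (insert i S) x \<delta>. a \<bullet> i \<le> y \<bullet> i \<and> y \<bullet> i \<le> b \<bullet> i} = N (insert i S) x \<delta>"
        using i by (auto simp: N_def mem_box)
      ultimately show "\<exists>\<delta>>0. liftable f (N (insert i S) x \<delta>)" by auto
    qed
  qed
  obtain x where x: "x \<in> cbox a b" using False by blast
  then obtain \<delta> where "liftable f (N Basis x \<delta>)" using step[of Basis] by auto
  then show ?thesis by (simp add: N_def)
qed

lemma path_lift:
  assumes p: "pathin BX p" and x: "x \<in> topspace X" "proj x = p 0"
  obtains l where "pathin X l" "l 0 = x" "\<And>t. t \<in> {0..1} \<Longrightarrow> proj (l t) = p t"
proof -
  obtain l where l: "continuous_map (top_of_set {0..1::real}) X l" "\<And>t. t \<in> {0..1} \<Longrightarrow> proj (l t) =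
    p t"
    using liftable_cbox[of 0 1 p] p unfolding pathin_def liftable_def cbox_interval by blast
  have lX: "l t \<in> topspace X" if "t \<in> {0..1}" for t
    using continuous_map_image_subset_topspace[OF l(1)] that by auto
  define k where "k = diff (l 0) x"
  have k: "k \<in> carrier K" "act k (l 0) = x"
    using diff[of "l 0" x] l(2)[of 0] lX[of 0] x unfolding k_def by auto
  show thesis
  proof
    show "pathin X (\<lambda>t. act k (l t))"
      unfolding pathin_def using k l(1) carrier_eq by (intro continuous_map_act) auto
  qed (use k l lX in \<open>auto simp: proj_act\<close>)
qed

text \<open>A lift with the right start ends in the right orbit. Acting with a path in
  \<open>K\<close> from the identity to the remaining difference repairs the end and leaves the
  projection unchanged.\<close>

lemma path_lift_ends:
  assumes p: "pathin BX p" and x: "x \<in> topspace X" "proj x = p 0" and y: "y \<in> topspace X" "proj y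
    = p 1"
    and T: "path_connected_space T"
  obtains l where "pathin X l" "l 0 = x" "l 1 = y" "\<And>t. t \<in> {0..1} \<Longrightarrow> proj (l t) = p t"
proof -
  obtain l where l: "pathin X l" "l 0 = x" "\<And>t. t \<in> {0..1} \<Longrightarrow> proj (l t) = p t"
    using path_lift[OF p x] by blast
  have lX: "l t \<in> topspace X" if "t \<in> {0..1}" for t
    using continuous_map_image_subset_topspace[OF l(1)[unfolded pathin_def]] that by auto
  have d: "diff (l 1) y \<in> carrier K" "act (diff (l 1) y) (l 1) = y"
    using diff[of "l 1" y] l(3)[of 1] lX[of 1] y by auto
  obtain \<kappa> where \<kappa>: "pathin T \<kappa>" "\<kappa> 0 = \<one>" "\<kappa> 1 = diff (l 1) y"
    using T d carrier_eq one_closed unfolding path_connected_space_def by metis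
  have \<kappa>K: "\<kappa> t \<in> carrier K" if "t \<in> {0..1}" for t
    using continuous_map_image_subset_topspace[OF \<kappa>(1)[unfolded pathin_def]] that carrier_eq by auto
  show thesis
  proof
    show "pathin X (\<lambda>t. act (\<kappa> t) (l t))"
      using \<kappa>(1) l(1) unfolding pathin_def by (rule continuous_map_act)
  qed (use \<kappa> l lX \<kappa>K d x in \<open>auto simp: proj_act act_one\<close>)
qed

end

lemma group_action_apply:
  assumes "group_action K S a"
  shows "k \<in> carrier K \<Longrightarrow> x \<in> S \<Longrightarrow> a k x \<in> S" "x \<in> S \<Longrightarrow> a \<one>\<^bsub>K\<^esub> x = x"
    "k \<in> carrier K \<Longrightarrow> l \<in> carrier K \<Longrightarrow> x \<in> S \<Longrightarrow> a (k \<otimes>\<^bsub>K\<^esub> l) x = a k (a l x)"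
proof -
  show "k \<in> carrier K \<Longrightarrow> x \<in> S \<Longrightarrow> a k x \<in> S"
    by (rule group_action.element_image[OF assms _ _ refl])
  show "x \<in> S \<Longrightarrow> a \<one>\<^bsub>K\<^esub> x = x"
    using fun_cong[OF group_action.id_eq_one[OF assms], of x] by simp
  show "k \<in> carrier K \<Longrightarrow> l \<in> carrier K \<Longrightarrow> x \<in> S \<Longrightarrow> a (k \<otimes>\<^bsub>K\<^esub> l) x = a k (a l x)"
    by (rule group_action.composition_rule[OF assms])
qed

text \<open>The equivariant map is the \<open>K\<close>-component of the inverse of a local
  trivialization.\<close>

lemma principal_action_universal:
  assumes G: "topological_group K T" and u: "universal_bundle K T E a"
  shows "principal_action K T E a"
proof -
  interpret topological_group K T by (rule G)
  have ga: "group_action K (topspace E) a" and cont: "continuous_map (prod_topology T E) E (\<lambda>(k,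
    e). a k e)"
    using u unfolding universal_bundle_def by blast+
  interpret continuous_action K T E a
    by unfold_locales (use cont group_action_apply[OF ga] in auto)
  show ?thesis
  proof
    fix x assume x: "x \<in> topspace E"
    then have "orbit K a x \<in> topspace (orbit_space K E a)" by (simp add: topspace_BX)
    note bspec[OF u[unfolded universal_bundle_def, THEN conjunct2, THEN conjunct2, THEN
      conjunct2, THEN conjunct2] this]
    then show "\<exists>W \<tau>. openin E W \<and> x \<in> W \<and> continuous_map (subtopology E W) T \<tau> \<and>
      (\<forall>k\<in>carrier K. \<forall>y\<in>W. a k y \<in> W \<and> \<tau> (a k y) = k \<otimes>\<^bsub>K\<^esub> \<tau> y)"
    proof (elim exE conjE)
    fix U h assume U: "openin (orbit_space K E a) U" "orbit K a x \<in> U"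
      and h: "homeomorphic_map (prod_topology T (subtopology (orbit_space K E a) U))
          (subtopology E {e \<in> topspace E. orbit K a e \<in> U}) h"
      and ho: "\<forall>k\<in>carrier K. \<forall>u\<in>U. orbit K a (h (k, u)) = u"
      and eq: "\<forall>k\<in>carrier K. \<forall>k'\<in>carrier K. \<forall>u\<in>U. h (k \<otimes>\<^bsub>K\<^esub> k', u) = a k (h (k', u))"
    define W where "W = {e \<in> topspace E. orbit K a e \<in> U}"
    let ?P = "prod_topology T (subtopology (orbit_space K E a) U)"
    obtain g where g: "homeomorphic_maps ?P (subtopology E W) h g"
      using h homeomorphic_map_maps unfolding W_def by blast
    have gc: "continuous_map (subtopology E W) ?P g" using g by (simp add: homeomorphic_maps_def)
    have tP: "topspace ?P = carrier K \<times> U"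
      using openin_subset[OF U(1)] by (auto simp: carrier_eq)
    have hg: "h (g y) = y" "g y \<in> carrier K \<times> U" if "y \<in> W" for y
      using g that continuous_map_image_subset_topspace[OF gc] tP
      unfolding homeomorphic_maps_def by (auto simp: W_def)
    have gh: "g (h z) = z" if "z \<in> carrier K \<times> U" for z
      using g that tP unfolding homeomorphic_maps_def by auto
    have "openin E W" using U unfolding W_def openin_BX by blast
    moreover have "continuous_map (subtopology E W) T (fst \<circ> g)"
      using continuous_map_compose[OF gc continuous_map_fst] .
    moreover have "a k y \<in> W \<and> (fst \<circ> g) (a k y) = k \<otimes>\<^bsub>K\<^esub> (fst \<circ> g) y" if ky: "k \<in> carrier K" "y
      \<in> W" for k y
    proof
      show "a k y \<in> W" using ky by (auto simp: W_def act_closed proj_act)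
      obtain l v where lv: "g y = (l, v)" "l \<in> carrier K" "v \<in> U" using hg(2)[OF ky(2)] by (cases
        "g y") auto
      then have "a k y = h (k \<otimes>\<^bsub>K\<^esub> l, v)" using eq ky hg(1)[OF ky(2)] by auto
      then show "(fst \<circ> g) (a k y) = k \<otimes>\<^bsub>K\<^esub> (fst \<circ> g) y" using gh[of "(k \<otimes>\<^bsub>K\<^esub> l, v)"] lv ky by auto
    qed
    ultimately show "\<exists>W \<tau>. openin E W \<and> x \<in> W \<and> continuous_map (subtopology E W) T \<tau> \<and>
      (\<forall>k\<in>carrier K. \<forall>y\<in>W. a k y \<in> W \<and> \<tau> (a k y) = k \<otimes>\<^bsub>K\<^esub> \<tau> y)"
      using x U(2) by (intro exI[of _ W] exI[of _ "fst \<circ> g"]) (auto simp: W_def)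
    qed
  qed
qed

text \<open>The fibre coordinate is taken from the factor \<open>E\<close>, so points of
  \<open>X\<close> may have non-trivial stabilizers.\<close>

lemma principal_action_diag:
  assumes E: "principal_action K T E ea" and X: "continuous_action K T X a"
  shows "principal_action K T (prod_topology E X) (diag_action E ea X a)"
proof -
  interpret E: principal_action K T E ea by (rule E)
  interpret X: continuous_action K T X a by (rule X)
  let ?P = "prod_topology E X" and ?d = "diag_action E ea X a"
  have c: "continuous_map (prod_topology T ?P) ?P (\<lambda>(k, z). (ea k (fst z), a k (snd z)))"
  proof -
    have "continuous_map (prod_topology T ?P) ?P (\<lambda>w. (ea (fst w) (fst (snd w)), a (fst w) (snd
      (snd w))))"
      using continuous_map_fst[of T ?P] continuous_map_compose[OF continuous_map_snd[of T ?P]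
        continuous_map_fst]
        continuous_map_compose[OF continuous_map_snd[of T ?P] continuous_map_snd]
      by (intro continuous_map_pairedI E.continuous_map_act X.continuous_map_act) (auto simp: o_def)
    then show ?thesis by (simp add: case_prod_unfold)
  qed
  show ?thesis
  proof
    show "?d k x \<in> topspace ?P" if "k \<in> carrier K" "x \<in> topspace ?P" for k x
      using that E.act_closed X.act_closed by (auto simp: diag_action_def)
    show "?d \<one>\<^bsub>K\<^esub> x = x" if "x \<in> topspace ?P" for x
      using that by (auto simp: diag_action_def E.act_one X.act_one)
    show "?d (k \<otimes>\<^bsub>K\<^esub> l) x = ?d k (?d l x)" if "k \<in> carrier K" "l \<in> carrier K" "x \<in> topspace ?P"
      for k l x
      using that by (auto simp: diag_action_def E.act_mult X.act_mult E.act_closed X.act_closed)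
    show "continuous_map (prod_topology T ?P) ?P (\<lambda>(k, x). ?d k x)"
      by (rule continuous_map_eq[OF c]) (auto simp: diag_action_def)
    fix x assume x: "x \<in> topspace ?P"
    then obtain W \<tau> where W: "openin E W" "fst x \<in> W" "continuous_map (subtopology E W) T \<tau>"
      "\<forall>k\<in>carrier K. \<forall>y\<in>W. ea k y \<in> W \<and> \<tau> (ea k y) = k \<otimes>\<^bsub>K\<^esub> \<tau> y"
      using E.local_triv[of "fst x"] by auto
    have WE: "W \<subseteq> topspace E" using W(1) openin_subset by auto
    have "openin ?P (W \<times> topspace X)" using W(1) by (simp add: openin_prod_Times_iff)
    moreover have "continuous_map (subtopology ?P (W \<times> topspace X)) T (\<tau> \<circ> fst)"
      using continuous_map_compose[OF continuous_map_fst W(3)] by (simp add: subtopology_Times)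
    ultimately show "\<exists>W \<tau>. openin ?P W \<and> x \<in> W \<and> continuous_map (subtopology ?P W) T \<tau> \<and>
      (\<forall>k\<in>carrier K. \<forall>y\<in>W. ?d k y \<in> W \<and> \<tau> (?d k y) = k \<otimes>\<^bsub>K\<^esub> \<tau> y)"
      using x W WE X.act_closed
      by (intro exI[of _ "W \<times> topspace X"] exI[of _ "\<tau> \<circ> fst"]) (auto simp: diag_action_def)
  qed
qed


section \<open>The fundamental group of the Borel construction\<close>

locale borel_setup =
  E: principal_action K T E ea + X: continuous_action K T X a
  for K :: "'k monoid" (structure) and T :: "'k topology" and E :: "'e topology"
    and ea :: "'k \<Rightarrow> 'e \<Rightarrow> 'e" and X :: "'x topology" and a :: "'k \<Rightarrow> 'x \<Rightarrow> 'x" +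
  fixes e0 :: 'e and x0 :: 'x
  assumes contr: "contractible_space E" and pcT: "path_connected_space T"
    and pcX: "path_connected_space X" and e0: "e0 \<in> topspace E" and x0: "x0 \<in> topspace X"
begin

abbreviation "EM \<equiv> prod_topology E X"
abbreviation "MK \<equiv> borel_construction K E ea X a"

sublocale P: principal_action K T EM "diag_action E ea X a"
  by (rule principal_action_diag) unfold_locales

lemma MK_eq: "MK = P.BX"
  by (simp add: borel_construction_def)

abbreviation "incl \<equiv> borel_incl K E ea e0 X a"

lemma incl_eq: "incl x = P.proj (e0, x)"
  by (simp add: borel_incl_def)

lemma incl_cont: "continuous_map X MK incl"
proof -
  have "continuous_map X EM (\<lambda>x. (e0, x))"
    using e0 by (auto intro: continuous_map_pairedI)
  from continuous_map_compose[OF this P.proj_cont] show ?thesis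
    by (simp add: MK_eq incl_eq[abs_def] o_def)
qed

lemma pcEM: "path_connected_space EM"
  using contr pcX by (simp add: path_connected_space_prod_topology
    contractible_imp_path_connected_space)

lemma pcMK: "path_connected_space MK"
proof -
  have "path_connectedin MK (P.proj ` topspace EM)"
    using P.proj_cont pcEM unfolding MK_eq
    by (metis path_connectedin_continuous_map_image path_connectedin_topspace)
  then show ?thesis
    by (metis MK_eq P.topspace_BX path_connectedin_topspace)
qed

sublocale X0: pointed_space X x0
  by unfold_locales (use pcX x0 in auto)

sublocale B0: pointed_space MK "incl x0"
  by unfold_locales (use pcMK x0 continuous_map_image_subset_topspace[OF incl_cont] in auto)

sublocale T0: pointed_space T "\<one>"
  by unfold_locales (use pcT E.one_closed E.carrier_eq in auto)

abbreviation "psharp \<equiv> p_sharp K E ea e0 X a x0"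

lemma psharp_hom: "psharp \<in> hom X0.PI B0.PI"
  unfolding p_sharp_def by (rule hom_pi1_map[OF incl_cont])

lemma psharp_class: "is_loop X x0 f \<Longrightarrow> psharp (path_class X f) = path_class MK (incl \<circ> f)"
  unfolding p_sharp_def by (rule pi1_map_path_class[OF _ incl_cont])

text \<open>A loop in \<open>MK\<close> lifts to a loop in \<open>EM\<close> because
  \<open>K\<close> is path connected. It remains to replace the \<open>E\<close>-component of the
  lift by the constant \<open>e0\<close>, for which the contraction of \<open>E\<close> is
  used.\<close>

lemma psharp_surj: "psharp ` carrier X0.PI = carrier B0.PI"
proof
  show "psharp ` carrier X0.PI \<subseteq> carrier B0.PI" using psharp_hom by (auto simp: hom_def)
  show "carrier B0.PI \<subseteq> psharp ` carrier X0.PI"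
  proof
    fix c assume "c \<in> carrier B0.PI"
    then obtain b where b: "is_loop MK (incl x0) b" "c = path_class MK b"
      by (auto simp: carrier_fundamental_group)
    have E0: "(e0, x0) \<in> topspace EM" using e0 x0 by simp
    obtain l where l: "pathin EM l" "l 0 = (e0, x0)" "l 1 = (e0, x0)" "\<And>t. t \<in> {0..1} \<Longrightarrow> P.proj (l
      t) = b t"
      using P.path_lift_ends[of b "(e0, x0)" "(e0, x0)"] b(1) E0 pcT
      unfolding is_loop_def MK_eq incl_eq by metis
    obtain pt H where H: "continuous_map (prod_topology (top_of_set {0..1::real}) E) E H"
      "\<And>x. H (0, x) = x" "\<And>x. H (1, x) = pt"
      using contr unfolding contractible_space_def homotopic_with_def by auto
    let ?Z = "prod_topology (top_of_set {0..1::real}) (top_of_set {0..1::real})"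
    have lc: "continuous_map ?Z E (\<lambda>z. fst (l (snd z)))" "continuous_map ?Z X (\<lambda>z. snd (l (snd z)))"
      using continuous_map_compose[OF continuous_map_compose[OF continuous_map_snd l(1)[unfolded
        pathin_def]] continuous_map_fst]
       continuous_map_compose[OF continuous_map_compose[OF continuous_map_snd l(1)[unfolded
         pathin_def]] continuous_map_snd]
      by (auto simp: o_def simp del: prod_topology_subtopology_eu)
    have Hc: "continuous_map ?Z E (\<lambda>z. H (fst z, u z))" if "continuous_map ?Z E u" for u
      using continuous_map_compose[OF continuous_map_pairedI[OF continuous_map_fst that] H(1)]
      by (simp add: o_def)
    have sq: "continuous_map (top_of_set ({0..1} \<times> {0..1})) MK (\<lambda>z. P.proj (H (fst z, u z), snd
      (l (snd z))))"
      if "continuous_map ?Z E u" for u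
      using continuous_map_compose[OF continuous_map_pairedI[OF Hc[OF that] lc(2)] P.proj_cont]
      by (simp add: o_def MK_eq)
    let ?\<theta> = "holonomy MK (incl x0)"
    let ?\<eta> = "\<lambda>s. P.proj (H (s, e0), x0)" and ?r = "\<lambda>t. P.proj (pt, snd (l t))"
    have e0c: "continuous_map ?Z E (\<lambda>z. e0)" using e0 by simp
    \<comment> \<open>Two squares with the same edge \<open>?r\<close> at \<open>s = 1\<close>: the
      contraction is applied once to the \<open>E\<close>-component of \<open>l\<close> and once to
      the constant \<open>e0\<close>. In both, the edges at \<open>t = 0\<close> and
      \<open>t = 1\<close> are the track \<open>?\<eta>\<close> of \<open>e0\<close>, so it
      cancels.\<close>
    have 1: "?\<theta> ?\<eta> \<otimes>\<^bsub>B0.PI\<^esub> ?\<theta> ?r = ?\<theta> (\<lambda>t. P.proj (l t)) \<otimes>\<^bsub>B0.PI\<^esub> ?\<theta> ?\<eta>"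
      using B0.holonomy_square[OF sq[OF lc(1)]] by (simp add: H l)
    have 2: "?\<theta> ?\<eta> \<otimes>\<^bsub>B0.PI\<^esub> ?\<theta> ?r = ?\<theta> (\<lambda>t. P.proj (e0, snd (l t))) \<otimes>\<^bsub>B0.PI\<^esub> ?\<theta> ?\<eta>"
      using B0.holonomy_square[OF sq[OF e0c]] by (simp add: H l)
    define f where "f t = snd (l t)" for t
    have f: "is_loop X x0 f"
      using l pathin_compose[OF l(1) continuous_map_snd] by (auto simp: is_loop_def
        f_def[abs_def] o_def)
    have p1: "pathin MK (\<lambda>t. P.proj (l t))"
      using pathin_compose[OF l(1) P.proj_cont] by (simp add: o_def MK_eq)
    have p2: "pathin MK (incl \<circ> f)" using is_loop_image[OF f incl_cont] by (simp add: is_loop_def)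
    have p3: "pathin MK ?\<eta>"
    proof -
      have "continuous_map (top_of_set {0..1::real}) (prod_topology (top_of_set {0..1}) E) (\<lambda>s.
        (s, e0))"
        using e0 by (auto intro: continuous_map_pairedI)
      from continuous_map_compose[OF this H(1)]
      have "continuous_map (top_of_set {0..1}) EM (\<lambda>s. (H (s, e0), x0))"
        using x0 by (auto intro: continuous_map_pairedI simp: o_def)
      from continuous_map_compose[OF this P.proj_cont] show ?thesis
        by (simp add: o_def MK_eq pathin_def)
    qed
    have "(\<lambda>t. P.proj (e0, snd (l t))) = incl \<circ> f"
      by (simp add: o_def incl_eq f_def)
    then have "?\<theta> (\<lambda>t. P.proj (l t)) \<otimes>\<^bsub>B0.PI\<^esub> ?\<theta> ?\<eta> = ?\<theta> (incl \<circ> f) \<otimes>\<^bsub>B0.PI\<^esub> ?\<theta> ?\<eta>"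
      using 1 2 by metis
    then have "?\<theta> (\<lambda>t. P.proj (l t)) = ?\<theta> (incl \<circ> f)"
      using B0.PI.right_cancel B0.holonomy_closed p1 p2 p3 by metis
    moreover have "path_homotopic MK b (\<lambda>t. P.proj (l t))"
      using b(1) l by (intro path_homotopic_eq) (auto simp: is_loop_def)
    ultimately have "?\<theta> b = ?\<theta> (incl \<circ> f)" using B0.holonomy_homotopic by metis
    then have "c = psharp (path_class X f)"
      using b f B0.holonomy_loop is_loop_image[OF f incl_cont] psharp_class by metis
    then show "c \<in> psharp ` carrier X0.PI"
      using f by (auto simp: carrier_fundamental_group)
  qed
qed

definition orbit_map :: "'k \<Rightarrow> 'x" where "orbit_map k = a k x0"

lemma orbit_map_cont: "continuous_map T X orbit_map"
  using X.continuous_map_act[OF continuous_map_id, of "\<lambda>_. x0"] x0 by (simp add: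
    orbit_map_def[abs_def])

lemma orbit_map_one: "orbit_map \<one> = x0"
  by (simp add: orbit_map_def X.act_one x0)

abbreviation "orbit_sharp \<equiv> pi1_map X x0 orbit_map"

lemma orbit_sharp_hom: "orbit_sharp \<in> hom T0.PI X0.PI"
  using hom_pi1_map[OF orbit_map_cont, of "\<one>"] by (simp add: orbit_map_one)

lemma orbit_sharp_class: "is_loop T \<one> k \<Longrightarrow> orbit_sharp (path_class T k) = path_class X (orbit_map
  \<circ> k)"
  using pi1_map_path_class[OF _ orbit_map_cont, of "\<one>"] by (simp add: orbit_map_one)

lemma orbit_loop: "is_loop T \<one> k \<Longrightarrow> is_loop X x0 (orbit_map \<circ> k)"
  using is_loop_image[OF _ orbit_map_cont, of "\<one>"] by (simp add: orbit_map_one)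

text \<open>The square \<open>a (k s) (f t)\<close> has the orbit loop of \<open>k\<close> on one
  pair of opposite sides and \<open>f\<close> on the other pair.\<close>

lemma orbit_sharp_central:
  assumes "c \<in> carrier T0.PI" "g \<in> carrier X0.PI"
  shows "orbit_sharp c \<otimes>\<^bsub>X0.PI\<^esub> g = g \<otimes>\<^bsub>X0.PI\<^esub> orbit_sharp c"
proof -
  obtain k where k: "is_loop T \<one> k" "c = path_class T k" using assms(1) by (auto simp:
    carrier_fundamental_group)
  obtain f where f: "is_loop X x0 f" "g = path_class X f" using assms(2) by (auto simp:
    carrier_fundamental_group)
  have kp: "pathin T k" "k 0 = \<one>" "k 1 = \<one>" and fp: "pathin X f" "f 0 = x0" "f 1 = x0"
    using k f by (auto simp: is_loop_def)
  let ?Z = "prod_topology (top_of_set {0..1::real}) (top_of_set {0..1::real})"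
  have "continuous_map ?Z X (\<lambda>z. a (k (fst z)) (f (snd z)))"
    using continuous_map_compose[OF continuous_map_fst kp(1)[unfolded pathin_def]]
      continuous_map_compose[OF continuous_map_snd fp(1)[unfolded pathin_def]]
    by (intro X.continuous_map_act) (auto simp: o_def simp del: prod_topology_subtopology_eu)
  then have c: "continuous_map (top_of_set ({0..1} \<times> {0..1})) X (\<lambda>z. a (k (fst z)) (f (snd z)))"
    by simp
  have "f t \<in> topspace X" if "0 \<le> t" "t \<le> 1" for t
    using continuous_map_image_subset_topspace[OF fp(1)[unfolded pathin_def]] that by auto
  then have h: "holonomy X x0 (\<lambda>t. a \<one> (f t)) = holonomy X x0 f"
    by (intro X0.holonomy_homotopic path_homotopic_sym[OF path_homotopic_eq[OF fp(1)]])
       (simp add: X.act_one)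
  have "holonomy X x0 (orbit_map \<circ> k) \<otimes>\<^bsub>X0.PI\<^esub> holonomy X x0 f = holonomy X x0 f \<otimes>\<^bsub>X0.PI\<^esub>
    holonomy X x0 (orbit_map \<circ> k)"
    using X0.holonomy_square[OF c] by (simp add: kp fp h o_def orbit_map_def[abs_def])
  then show ?thesis
    using X0.holonomy_loop[OF f(1)] X0.holonomy_loop[OF orbit_loop[OF k(1)]] orbit_sharp_class[OF
      k(1)] k f
    by simp
qed

text \<open>A null homotopy in \<open>MK\<close> lifts to \<open>EM\<close>. Normalized to be
  \<open>(e0, f)\<close> on one side of the square, the lift stays over the base point on the other
  three sides, hence runs there through the orbit of \<open>(e0, x0)\<close>. Its
  \<open>X\<close>-component deforms \<open>f\<close> to the orbit loop of a loop in
  \<open>K\<close>.\<close>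

lemma psharp_kernel:
  assumes "g \<in> carrier X0.PI" "psharp g = \<one>\<^bsub>B0.PI\<^esub>"
  shows "g \<in> orbit_sharp ` carrier T0.PI"
proof -
  obtain f where f: "is_loop X x0 f" "g = path_class X f" using assms(1) by (auto simp:
    carrier_fundamental_group)
  have fp: "pathin X f" "f 0 = x0" "f 1 = x0" using f by (auto simp: is_loop_def)
  have "path_class MK (incl \<circ> f) = path_class MK (\<lambda>_. incl x0)"
    using assms(2) f psharp_class one_fundamental_group by metis
  then have "path_homotopic MK (incl \<circ> f) (\<lambda>_. incl x0)"
    using path_class_eq_iff is_loop_image[OF f(1) incl_cont] is_loop_def by metis
  then obtain H where H: "continuous_map (prod_topology (top_of_set {0..1::real}) (top_of_set
    {0..1::real})) MK H"
    "\<And>s. H (0, s) = incl (f s)" "\<And>s. H (1, s) = incl x0"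
    "\<And>t. t \<in> {0..1} \<Longrightarrow> H (t, 0) = incl x0 \<and> H (t, 1) = incl x0"
    unfolding path_homotopic_def homotopic_with_def using fp by auto
  let ?Q = "{0..1::real} \<times> {0..1::real}"
  have Q: "cbox (0, 0) (1, 1) = ?Q" by (auto simp: cbox_Pair_eq)
  have "P.liftable H (cbox (0, 0) (1, 1))"
    by (rule P.liftable_cbox) (use H(1) MK_eq Q in auto)
  then obtain L where L: "continuous_map (top_of_set ?Q) EM L" "\<And>z. z \<in> ?Q \<Longrightarrow> P.proj (L z) = H z"
    unfolding P.liftable_def Q by blast
  have LX: "L z \<in> topspace EM" if "z \<in> ?Q" for z
    using continuous_map_image_subset_topspace[OF L(1)] that by auto
  have fX: "f s \<in> topspace X" if "s \<in> {0..1}" for s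
    using continuous_map_image_subset_topspace[OF fp(1)[unfolded pathin_def]] that by auto
  \<comment> \<open>The correction is read off at first coordinate 0 and depends on the second
    coordinate alone, so it translates the whole lift without changing its projection.\<close>
  define d where "d z = P.diff (L (0, snd z)) (e0, f (snd z))" for z :: "real \<times> real"
  have "continuous_map (top_of_set ?Q) (top_of_set ?Q) (\<lambda>z. (0, snd z))"
    by (auto intro!: continuous_intros)
  from continuous_map_compose[OF this L(1)]
  have c1: "continuous_map (top_of_set ?Q) EM (\<lambda>z. L (0, snd z))" by (simp add: o_def)
  have c2: "continuous_map (top_of_set ?Q) EM (\<lambda>z. (e0, f (snd z)))"
  proof (rule continuous_map_pairedI)
    have "continuous_map (top_of_set ?Q) (top_of_set {0..1}) snd" by (auto intro!:
      continuous_intros)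
    from continuous_map_compose[OF this fp(1)[unfolded pathin_def]]
    show "continuous_map (top_of_set ?Q) X (\<lambda>z. f (snd z))" by (simp add: o_def)
  qed (use e0 in simp)
  have pe: "P.proj (L (0, snd z)) = P.proj (e0, f (snd z))" if "z \<in> ?Q" for z
    using that L(2)[of "(0, snd z)"] H(2) incl_eq by auto
  have dc: "continuous_map (top_of_set ?Q) T d"
    unfolding d_def by (rule P.diff_cont[OF c1 c2]) (use pe in auto)
  have d: "d z \<in> carrier K" "P.proj (diag_action E ea X a (d z) (L z)) = H z" if "z \<in> ?Q" for z
  proof -
    show dK: "d z \<in> carrier K" 
      unfolding d_def by (rule P.diff(1)) (use that LX fX e0 pe[OF that] in auto)
    show "P.proj (diag_action E ea X a (d z) (L z)) = H z"
      using P.proj_act[OF dK LX[OF that]] L(2)[OF that] by simp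
  qed
  define \<Gamma> where "\<Gamma> z = diag_action E ea X a (d z) (L z)" for z
  have \<Gamma>: "continuous_map (top_of_set ?Q) EM \<Gamma>"
    unfolding \<Gamma>_def[abs_def] using dc L(1) by (rule P.continuous_map_act)
  have \<Gamma>X: "\<Gamma> z \<in> topspace EM" if "z \<in> ?Q" for z
    using continuous_map_image_subset_topspace[OF \<Gamma>] that by auto
  have \<Gamma>0: "\<Gamma> (0, s) = (e0, f s)" if "s \<in> {0..1}" for s
    unfolding \<Gamma>_def d_def using that P.diff(2)[of "L (0, s)" "(e0, f s)"] LX[of "(0, s)"] fX e0
      pe[of "(0, s)"] by auto
  define m where "m = snd \<circ> \<Gamma>"
  have m: "continuous_map (top_of_set ?Q) X m"
    unfolding m_def using \<Gamma> continuous_map_snd by (rule continuous_map_compose)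
  \<comment> \<open>Traverses the three sides other than \<open>{0} \<times> {0..1}\<close>, from
    \<open>(0,0)\<close> to \<open>(0,1)\<close>.\<close>
  define \<omega> :: "real \<Rightarrow> real \<times> real"
    where "\<omega> = linepath (0,0) (1,0) +++ linepath (1,0) (1,1) +++ linepath (1,1) (0,1)"
  have "path \<omega>" unfolding \<omega>_def by simp
  then have \<omega>c: "continuous_on {0..1} \<omega>" by (simp add: path_def)
  have "path_image \<omega> = closed_segment (0,0) (1,0) \<union> closed_segment (1,0) (1,1) \<union> closed_segment
    (1,1) (0,1)"
    unfolding \<omega>_def by (simp add: path_image_join Un_assoc)
  moreover have "closed_segment (0,0) (1,0) = {0..1::real} \<times> {0::real}"
    "closed_segment (1,0) (1,1) = {1::real} \<times> {0..1::real}"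
    "closed_segment (1,1) (0,1) = {0..1::real} \<times> {1::real}"
    unfolding closed_segment_commute[of "(1::real, 1::real)" "(0, 1)"] by (auto simp: in_segment)
  ultimately have img: "path_image \<omega> = {0..1} \<times> {0} \<union> {1} \<times> {0..1} \<union> {0..1} \<times> {1}" by simp
  have \<omega>Q: "\<omega> \<in> {0..1} \<rightarrow> ?Q" "\<And>r. r \<in> {0..1} \<Longrightarrow> H (\<omega> r) = incl x0"
  proof -
    have *: "\<omega> r \<in> {0..1} \<times> {0} \<union> {1} \<times> {0..1} \<union> {0..1} \<times> {1}" if "r \<in> {0..1}" for r
      using that img unfolding path_image_def by blast
    show "\<omega> \<in> {0..1} \<rightarrow> ?Q" using * by fastforce
    show "H (\<omega> r) = incl x0" if "r \<in> {0..1}" for r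
      using *[OF that] H(3,4) by auto
  qed
  have \<omega>01: "\<omega> 0 = (0,0)" "\<omega> 1 = (0,1)" by (simp_all add: \<omega>_def joinpaths_def linepath_def)
  have \<omega>m: "continuous_map (top_of_set {0..1}) (top_of_set ?Q) \<omega>" using \<omega>c \<omega>Q by auto
  have \<Gamma>\<omega>: "continuous_map (top_of_set {0..1}) EM (\<lambda>r. \<Gamma> (\<omega> r))"
    using continuous_map_compose[OF \<omega>m \<Gamma>] by (simp add: o_def)
  have E0: "(e0, x0) \<in> topspace EM" using e0 x0 by simp
  have pq: "P.proj (e0, x0) = P.proj (\<Gamma> (\<omega> r))" if "r \<in> {0..1}" for r
    using \<omega>Q that d(2)[of "\<omega> r"] incl_eq unfolding \<Gamma>_def by (metis Pi_iff)
  define k where "k r = P.diff (e0, x0) (\<Gamma> (\<omega> r))" for r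
  have kc: "continuous_map (top_of_set {0..1}) T k"
    unfolding k_def[abs_def] by (rule P.diff_cont) (use \<Gamma>\<omega> E0 pq in auto)
  have k: "k r \<in> carrier K" "diag_action E ea X a (k r) (e0, x0) = \<Gamma> (\<omega> r)" if "r \<in> {0..1}" for r
  proof -
    have "\<Gamma> (\<omega> r) \<in> topspace EM" using \<Gamma>X \<omega>Q that by blast
    from P.diff[OF E0 this pq[OF that]]
    show "k r \<in> carrier K" "diag_action E ea X a (k r) (e0, x0) = \<Gamma> (\<omega> r)" by (auto simp: k_def)
  qed
  have one: "P.diff (e0, x0) (e0, x0) = \<one>"
    using P.diff_act[OF E.one_closed E0] P.act_one[OF E0] by simp
  have "k 0 = \<one>" "k 1 = \<one>"
    unfolding k_def using \<omega>01 \<Gamma>0[of 0] \<Gamma>0[of 1] fp one by auto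
  then have kl: "is_loop T \<one> k" using kc by (simp add: is_loop_def pathin_def)
  have mk: "m (\<omega> r) = orbit_map (k r)" if "r \<in> {0..1}" for r
    using arg_cong[OF k(2)[OF that], of snd] E0 by (simp add: m_def orbit_map_def diag_action_def)
  have "holonomy X x0 (m \<circ> linepath (0,0) (0,1)) = holonomy X x0 (m \<circ> \<omega>)"
  proof (rule X0.holonomy_convex[OF _ m])
    show "convex ?Q" by (intro convex_Times convex_real_interval)
    show "linepath (0, 0) (0, 1) \<in> {0..1} \<rightarrow> ?Q" by (auto simp: linepath_def)
  qed (use \<omega>c \<omega>Q \<omega>01 in \<open>auto simp: linepath_0' linepath_1'\<close>)
  moreover have "holonomy X x0 (m \<circ> linepath (0,0) (0,1)) = holonomy X x0 f"
    by (rule X0.holonomy_homotopic, rule path_homotopic_sym, rule path_homotopic_eq[OF fp(1)])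
       (simp add: m_def linepath_def \<Gamma>0)
  moreover have "holonomy X x0 (m \<circ> \<omega>) = holonomy X x0 (orbit_map \<circ> k)"
  proof (rule X0.holonomy_homotopic, rule path_homotopic_eq)
    show "pathin X (m \<circ> \<omega>)" unfolding pathin_def using continuous_map_compose[OF \<omega>m m] .
  qed (use mk in auto)
  ultimately have "g = orbit_sharp (path_class T k)"
    using X0.holonomy_loop[OF f(1)] X0.holonomy_loop[OF orbit_loop[OF kl]] orbit_sharp_class[OF
      kl] f(2) by simp
  then show ?thesis using kl by (auto simp: carrier_fundamental_group)
qed

end


section \<open>Additive characters of finitely generated groups\<close>

definition additive_on :: "('g, 'b) monoid_scheme \<Rightarrow> 'g set \<Rightarrow> ('g \<Rightarrow> complex) \<Rightarrow> bool" where
  "additive_on G H \<phi> \<longleftrightarrow> (\<forall>x\<in>H. \<forall>y\<in>H. \<phi> (x \<otimes>\<^bsub>G\<^esub> y) = \<phi> x + \<phi> y)"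

context group
begin

lemma additive_one:
  assumes "additive_on G H \<phi>" "subgroup H G" shows "\<phi> \<one> = 0"
proof -
  have "\<phi> (\<one> \<otimes> \<one>) = \<phi> \<one> + \<phi> \<one>"
    using assms subgroup.one_closed unfolding additive_on_def by blast
  then show ?thesis by simp
qed

lemma additive_inv:
  assumes "additive_on G H \<phi>" "subgroup H G" "x \<in> H" shows "\<phi> (inv x) = - \<phi> x"
proof -
  have x: "x \<in> carrier G" "inv x \<in> H" using assms subgroup.mem_carrier subgroup.m_inv_closed by
    metis+
  have "\<phi> (inv x \<otimes> x) = \<phi> (inv x) + \<phi> x"
    using assms x unfolding additive_on_def by blast
  then show ?thesis using additive_one[OF assms(1,2)] x by (simp add: eq_neg_iff_add_eq_0)
qed

lemma additive_int_pow:
  assumes \<phi>: "additive_on G H \<phi>" and H: "subgroup H G" and x: "x \<in> H"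
  shows "\<phi> (x [^] (k :: int)) = of_int k * \<phi> x"
proof -
  have xc: "x \<in> carrier G" using H x subgroup.mem_carrier by metis
  have pw: "x [^] (m :: int) \<in> H" for m using subgroup_int_pow_closed[OF H x] .
  show ?thesis
  proof (induction k rule: int_induct[of _ 0])
    case base then show ?case using additive_one[OF \<phi> H] by simp
  next
    case (step1 i)
    have "x [^] (i + 1) = x [^] i \<otimes> x" using xc by (simp add: int_pow_mult)
    then show ?case using \<phi> pw x step1 unfolding additive_on_def by (simp add: algebra_simps)
  next
    case (step2 i)
    have "x [^] (i - 1) = x [^] i \<otimes> inv x" using xc by (simp add: int_pow_diff)
    then show ?case using \<phi> pw x step2 additive_inv[OF \<phi> H x] subgroup.m_inv_closed[OF H x]
      unfolding additive_on_def by (simp add: algebra_simps)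
  qed
qed

end

text \<open>The value \<open>t\<close> at \<open>s\<close> has to agree with \<phi> on those powers
  of \<open>s\<close> that already lie in \<open>H\<close>. This is exactly what makes the extension
  to products of elements of \<open>H\<close> with powers of \<open>s\<close> well defined.\<close>

lemma (in comm_group) additive_extend_step:
  assumes H: "subgroup H G" and \<phi>: "additive_on G H \<phi>" and s: "s \<in> carrier G"
    and t: "\<And>k::int. s [^] k \<in> H \<Longrightarrow> \<phi> (s [^] k) = of_int k * t"
  shows "\<exists>H' \<phi>'. subgroup H' G \<and> H \<subseteq> H' \<and> s \<in> H' \<and> additive_on G H' \<phi>' \<and> (\<forall>x\<in>H. \<phi>' x = \<phi> x) \<and> \<phi>'
    s = t"
proof -
  have Hc: "x \<in> carrier G" if "x \<in> H" for x using H that subgroup.mem_carrier by metis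
  note Ho = subgroup.one_closed[OF H] and Hm = subgroup.m_closed[OF H] and Hi =
    subgroup.m_inv_closed[OF H]
  have wd: "\<phi> h + of_int k * t = \<phi> h' + of_int k' * t"
    if h: "h \<in> H" "h' \<in> H" and e: "h \<otimes> s [^] k = h' \<otimes> s [^] k'" for h h' and k k' :: int
  proof -
    have "inv h' \<otimes> h \<otimes> s [^] k = s [^] k'"
      using e h Hc s by (simp add: m_assoc) (simp add: m_assoc[symmetric])
    then have "s [^] (k' - k) = inv h' \<otimes> h"
      using h Hc s by (simp add: int_pow_diff) (metis Hi Hm inv_solve_right int_pow_closed m_closed)
    moreover have "\<phi> (inv h' \<otimes> h) = \<phi> h - \<phi> h'"
      using \<phi> h Hi additive_inv[OF \<phi> H h(2)] unfolding additive_on_def by auto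
    ultimately have "\<phi> h - \<phi> h' = of_int (k' - k) * t" using t[of "k' - k"] Hm Hi h by auto
    then show ?thesis by (simp add: algebra_simps)
  qed
  define H' where "H' = {h \<otimes> s [^] k | h k. h \<in> H \<and> (k :: int) \<in> UNIV}"
  define \<phi>' where "\<phi>' x = (THE v. \<exists>h k. h \<in> H \<and> x = h \<otimes> s [^] (k :: int) \<and> v = \<phi> h + of_int k *
    t)" for x
  have \<phi>': "\<phi>' (h \<otimes> s [^] k) = \<phi> h + of_int k * t" if "h \<in> H" for h and k :: int
    unfolding \<phi>'_def
  proof (rule the_equality)
    show "\<exists>h' k'. h' \<in> H \<and> h \<otimes> s [^] k = h' \<otimes> s [^] (k' :: int) \<and> \<phi> h + of_int k * t = \<phi> h' +
      of_int k' * t"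
      using that by blast
    fix v assume "\<exists>h' k'. h' \<in> H \<and> h \<otimes> s [^] k = h' \<otimes> s [^] (k' :: int) \<and> v = \<phi> h' + of_int k' * t"
    then obtain h' and k' :: int where "h' \<in> H" "h \<otimes> s [^] k = h' \<otimes> s [^] k'" "v = \<phi> h' + of_int
      k' * t"
      by blast
    then show "v = \<phi> h + of_int k * t" using wd[of h h' k k'] that by simp
  qed
  have H'I: "h \<otimes> s [^] k \<in> H'" if "h \<in> H" for h and k :: int using that by (auto simp: H'_def)
  have mult: "(h \<otimes> s [^] k) \<otimes> (h' \<otimes> s [^] k') = (h \<otimes> h') \<otimes> s [^] (k + k')" if "h \<in> H" "h' \<in> H"
    for h h' and k k' :: int
    using that Hc s by (simp add: int_pow_mult m_ac)
  have sub: "subgroup H' G"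
  proof
    show "H' \<subseteq> carrier G" using Hc s by (auto simp: H'_def)
    show "x \<otimes> y \<in> H'" if xy: "x \<in> H'" "y \<in> H'" for x y
    proof -
      obtain h h' and k k' :: int where "h \<in> H" "h' \<in> H" "x = h \<otimes> s [^] k" "y = h' \<otimes> s [^] k'"
        using xy unfolding H'_def by blast
      then show ?thesis using mult Hm H'I by simp
    qed
    show "\<one> \<in> H'" using H'I[OF Ho, of 0] by simp
    show "inv x \<in> H'" if "x \<in> H'" for x
    proof -
      obtain h k where x: "h \<in> H" "x = h \<otimes> s [^] (k :: int)" using \<open>x \<in> H'\<close> by (auto simp: H'_def)
      then have "inv x = inv h \<otimes> s [^] (- k)"
        using Hc s by (simp add: inv_mult int_pow_neg)
      then show ?thesis using H'I[OF Hi[OF x(1)]] by simp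
    qed
  qed
  have "additive_on G H' \<phi>'"
    unfolding additive_on_def
  proof (intro ballI)
    fix x y assume "x \<in> H'" "y \<in> H'"
    then obtain h k h' k' where "h \<in> H" "x = h \<otimes> s [^] (k :: int)" "h' \<in> H" "y = h' \<otimes> s [^] (k'
      :: int)"
      unfolding H'_def by blast
    then show "\<phi>' (x \<otimes> y) = \<phi>' x + \<phi>' y"
      using \<phi> by (simp add: mult \<phi>' Hm additive_on_def algebra_simps)
  qed
  moreover have "\<phi>' x = \<phi> x" if "x \<in> H" for x using \<phi>'[OF that, of 0] Hc[OF that] by simp
  moreover have "\<phi>' s = t" using \<phi>'[OF Ho, of 1] s additive_one[OF \<phi> H] by simp
  moreover have "H \<subseteq> H'" using H'I[of _ 0] Hc by force
  moreover have "s \<in> H'" using H'I[OF Ho, of 1] s by simp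
  ultimately show ?thesis using sub by blast
qed

text \<open>The complex numbers are divisible: if some power \<open>m \<noteq> 0\<close> of
  \<open>s\<close> lies in the domain, the value of \<phi> there divided by \<open>m\<close> is
  consistent with all other powers, and otherwise 0 will do.\<close>

lemma (in comm_group) additive_extend:
  assumes "subgroup H G" "additive_on G H \<phi>" "finite S" "S \<subseteq> carrier G"
  shows "\<exists>H' \<phi>'. subgroup H' G \<and> H \<subseteq> H' \<and> S \<subseteq> H' \<and> additive_on G H' \<phi>' \<and> (\<forall>x\<in>H. \<phi>' x = \<phi> x)"
  using assms(3,4)
proof (induction S rule: finite_induct)
  case empty then show ?case using assms(1,2) by blast
next
  case (insert s S)
  then obtain H1 \<phi>1 where 1: "subgroup H1 G" "H \<subseteq> H1" "S \<subseteq> H1" "additive_on G H1 \<phi>1" "\<forall>x\<in>H. \<phi>1 x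
    = \<phi> x"
    by auto
  have s: "s \<in> carrier G" using insert.prems by blast
  have "\<exists>t. \<forall>k::int. s [^] k \<in> H1 \<longrightarrow> \<phi>1 (s [^] k) = of_int k * t"
  proof (cases "\<exists>m::int. m \<noteq> 0 \<and> s [^] m \<in> H1")
    case True
    then obtain m :: int where m: "m \<noteq> 0" "s [^] m \<in> H1" by blast
    have "\<phi>1 (s [^] k) = of_int k * (\<phi>1 (s [^] m) / of_int m)" if "s [^] k \<in> H1" for k :: int
    proof -
      have "of_int m * \<phi>1 (s [^] k) = \<phi>1 ((s [^] k) [^] m)"
        using additive_int_pow[OF 1(4,1) that] by simp
      also have "(s [^] k) [^] m = (s [^] m) [^] k"
        using s by (simp add: int_pow_pow mult.commute)
      also have "\<phi>1 \<dots> = of_int k * \<phi>1 (s [^] m)"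
        using additive_int_pow[OF 1(4,1) m(2)] by simp
      finally show ?thesis using m(1) by (simp add: field_simps)
    qed
    then show ?thesis by blast
  next
    case False
    then have "\<forall>k::int. s [^] k \<in> H1 \<longrightarrow> \<phi>1 (s [^] k) = of_int k * 0"
      using additive_one[OF 1(4,1)] by (metis int_pow_0 mult_zero_right)
    then show ?thesis by blast
  qed
  then obtain t where "\<And>k::int. s [^] k \<in> H1 \<Longrightarrow> \<phi>1 (s [^] k) = of_int k * t" by blast
  from additive_extend_step[OF 1(1,4) s this] obtain H2 \<phi>2 where 2: "subgroup H2 G" "H1 \<subseteq> H2" "s
    \<in> H2"
    "additive_on G H2 \<phi>2" "\<forall>x\<in>H1. \<phi>2 x = \<phi>1 x" by auto
  then have "H \<subseteq> H2" "insert s S \<subseteq> H2" "\<forall>x\<in>H. \<phi>2 x = \<phi> x" using 1 by auto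
  then show ?case using 2(1,4) by blast
qed

text \<open>If \<open>c\<close> had infinite order in the abelianization, the character with value 1
  at the image of \<open>c\<close> would extend over the images of the finitely many generators,
  hence to the whole group, and would not kill \<open>c\<close>.\<close>

lemma (in group) torsion_mod_derived:
  assumes S: "generating_set G S" and c: "c \<in> carrier G"
    and kill: "\<And>\<phi>. additive_on G (carrier G) \<phi> \<Longrightarrow> \<phi> c = 0"
  shows "\<exists>n>0. c [^] (n :: nat) \<in> derived G (carrier G)"
proof (rule ccontr)
  assume neg: "\<not> ?thesis"
  define D where "D = derived G (carrier G)"
  have D: "D \<lhd> G" unfolding D_def by (rule derived_self_is_normal)
  then have Ds: "subgroup D G" by (simp add: normal_imp_subgroup)
  interpret D: normal D G by (rule D)
  have "comm_group (G Mod D)"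
    using derived_quot_of_subgroup_is_comm_group[OF subgroup_self] by (simp add: D_def)
  then interpret A: comm_group "G Mod D" .
  define q where "q g = D #> g" for g
  have qh: "q \<in> hom G (G Mod D)" unfolding q_def[abs_def] by (rule D.r_coset_hom_Mod)
  interpret q: group_hom G "G Mod D" q
    by unfold_locales (rule qh)
  have qc: "q g \<in> carrier (G Mod D)" if "g \<in> carrier G" for g using that q.hom_closed by blast
  have inf: "k = 0" if k: "q c [^]\<^bsub>G Mod D\<^esub> (k :: int) \<in> {\<one>\<^bsub>G Mod D\<^esub>}" for k
  proof (rule ccontr)
    assume "k \<noteq> 0"
    have "q (c [^] k) = \<one>\<^bsub>G Mod D\<^esub>" using k c q.hom_int_pow by simp
    then have ck: "c [^] k \<in> D"
      using coset_join1[OF _ _ Ds, of "c [^] k"] c by (simp add: q_def FactGroup_def)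
    have "c [^] (int (nat \<bar>k\<bar>)) \<in> D"
    proof (cases "k \<ge> 0")
      case False
      then have "c [^] (int (nat \<bar>k\<bar>)) = inv (c [^] k)" using c by (simp add: int_pow_neg)
      then show ?thesis using ck Ds subgroup.m_inv_closed by metis
    qed (use ck in simp)
    then have "c [^] (nat \<bar>k\<bar>) \<in> D" by (simp only: int_pow_int)
    moreover have "nat \<bar>k\<bar> > 0" using \<open>k \<noteq> 0\<close> by simp
    ultimately show False using neg unfolding D_def by blast
  qed
  have t1: "subgroup {\<one>\<^bsub>G Mod D\<^esub>} (G Mod D)" by (rule A.triv_subgroup)
  have t2: "additive_on (G Mod D) {\<one>\<^bsub>G Mod D\<^esub>} (\<lambda>_. 0)" by (simp add: additive_on_def)
  obtain H1 \<phi>1 where 1: "subgroup H1 (G Mod D)" "q c \<in> H1" "additive_on (G Mod D) H1 \<phi>1" "\<phi>1 (q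
    c) = 1"
    using A.additive_extend_step[OF t1 t2 qc[OF c], of 1] inf by (metis mult_zero_left of_int_0)
  have "finite (q ` S)" "q ` S \<subseteq> carrier (G Mod D)"
    using S qc unfolding generating_set_def by auto
  then obtain H2 \<phi>2 where 2: "subgroup H2 (G Mod D)" "H1 \<subseteq> H2" "q ` S \<subseteq> H2" "additive_on (G Mod
    D) H2 \<phi>2"
      "\<forall>x\<in>H1. \<phi>2 x = \<phi>1 x"
    using A.additive_extend[OF 1(1,3)] by metis
  have "q g \<in> H2" if "g \<in> carrier G" for g
  proof -
    have "g \<in> generate G S" using that S by (simp add: generating_set_def)
    then show ?thesis
    proof (induction rule: generate.induct)
      case one then show ?case using 2(1) subgroup.one_closed q.hom_one by metis
    next
      case (incl h) then show ?case using 2(3) by blast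
    next
      case (inv h)
      then have "h \<in> carrier G" using S unfolding generating_set_def by blast
      then show ?case using inv 2(1,3) subgroup.m_inv_closed by (metis image_subset_iff q.hom_inv)
    next
      case (eng h1 h2)
      then have "h1 \<in> carrier G" "h2 \<in> carrier G" using S unfolding generating_set_def by blast+
      then show ?case using eng 2(1) subgroup.m_closed q.hom_mult by metis
    qed
  qed
  then have "additive_on G (carrier G) (\<phi>2 \<circ> q)"
    using 2(4) unfolding additive_on_def by simp
  then have "(\<phi>2 \<circ> q) c = 0" by (rule kill)
  then show False using 1 2 by simp
qed

text \<open>Commutativity is asked of the image only; this is how representations in
  \<open>SL2\<close> with commutative image are treated.\<close>

lemma hom_derived_trivial:
  assumes "group_hom G A \<rho>"
    and comm: "\<And>x y. x \<in> carrier G \<Longrightarrow> y \<in> carrier G \<Longrightarrow> \<rho> x \<otimes>\<^bsub>A\<^esub> \<rho> y = \<rho> y \<otimes>\<^bsub>A\<^esub> \<rho> x"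
    and d: "d \<in> derived G (carrier G)"
  shows "\<rho> d = \<one>\<^bsub>A\<^esub>"
proof -
  interpret group_hom G A \<rho> by (rule assms(1))
  have "derived_set G (carrier G) \<subseteq> kernel G A \<rho>"
  proof
    fix x assume "x \<in> derived_set G (carrier G)"
    then obtain g h where gh: "g \<in> carrier G" "h \<in> carrier G" "x = g \<otimes>\<^bsub>G\<^esub> h \<otimes>\<^bsub>G\<^esub> inv\<^bsub>G\<^esub> g \<otimes>\<^bsub>G\<^esub>
      inv\<^bsub>G\<^esub> h" by blast
    have "\<rho> x = \<rho> h \<otimes>\<^bsub>A\<^esub> \<rho> g \<otimes>\<^bsub>A\<^esub> inv\<^bsub>A\<^esub> \<rho> g \<otimes>\<^bsub>A\<^esub> inv\<^bsub>A\<^esub> \<rho> h"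
      using gh comm[OF gh(1,2)] by simp
    also have "\<dots> = \<one>\<^bsub>A\<^esub>" using gh by (simp add: H.m_assoc)
    finally show "x \<in> kernel G A \<rho>" using gh by (simp add: kernel_def)
  qed
  then have "derived G (carrier G) \<subseteq> kernel G A \<rho>"
    unfolding derived_def by (rule G.generate_subgroup_incl[OF _ subgroup_kernel])
  then show ?thesis using d by (auto simp: kernel_def)
qed


section \<open>Holomorphic functions on affine space\<close>

lemma continuous_map_binop:
  fixes f g :: "'z \<Rightarrow> complex" and op :: "complex \<times> complex \<Rightarrow> complex"
  assumes "continuous_map Z euclidean f" "continuous_map Z euclidean g" "continuous_on UNIV op"
  shows "continuous_map Z euclidean (\<lambda>z. op (f z, g z))"
proof -
  have "continuous_map Z euclidean (\<lambda>z. (f z, g z))"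
    using continuous_map_pairedI[OF assms(1,2)] by simp
  from continuous_map_compose[OF this, of euclidean op] assms(3) show ?thesis by (simp add: o_def)
qed

lemma holomorphic_several_add:
  assumes "holomorphic_several I U f" "holomorphic_several I U g"
  shows "holomorphic_several I U (\<lambda>z. f z + g z)"
proof -
  have "continuous_on UNIV (\<lambda>w :: complex \<times> complex. fst w + snd w)" by (intro continuous_intros)
  then show ?thesis
    using assms continuous_map_binop[of _ f g "\<lambda>w. fst w + snd w"] unfolding holomorphic_several_def
    by (auto intro: field_differentiable_add)
qed

lemma holomorphic_several_mult:
  assumes "holomorphic_several I U f" "holomorphic_several I U g"
  shows "holomorphic_several I U (\<lambda>z. f z * g z)"
proof -
  have "continuous_on UNIV (\<lambda>w :: complex \<times> complex. fst w * snd w)" by (intro continuous_intros)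
  then show ?thesis
    using assms continuous_map_binop[of _ f g "\<lambda>w. fst w * snd w"] unfolding holomorphic_several_def
    by (auto intro: field_differentiable_mult)
qed

lemma holomorphic_several_const: "holomorphic_several I U (\<lambda>_. c)"
  unfolding holomorphic_several_def by simp

lemma holomorphic_several_uminus:
  "holomorphic_several I U f \<Longrightarrow> holomorphic_several I U (\<lambda>z. - f z)"
  using holomorphic_several_mult[OF holomorphic_several_const[of I U "-1"]] by simp

lemma holomorphic_several_coord: 
  assumes "i \<in> I" shows "holomorphic_several I U (\<lambda>z. z i)"
  unfolding holomorphic_several_def
proof (intro conjI ballI)
  show "continuous_map (subtopology (affine_space I) U) euclidean (\<lambda>z. z i)"
    unfolding affine_space_def using assms
    by (intro continuous_map_from_subtopology continuous_map_product_projection)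
  fix z j assume "z \<in> U" "j \<in> I"
  show "(\<lambda>t. (z(j := t)) i) field_differentiable at (z j)" by (cases "i = j") simp_all
qed

lemma holomorphic_several_inverse:
  assumes f: "holomorphic_several I U f" and nz: "\<And>z. z \<in> U \<Longrightarrow> f z \<noteq> 0"
  shows "holomorphic_several I U (\<lambda>z. inverse (f z))"
  unfolding holomorphic_several_def
proof (intro conjI ballI)
  have "continuous_map (subtopology (affine_space I) U) (top_of_set (- {0})) f"
    using f nz unfolding holomorphic_several_def continuous_map_in_subtopology by auto
  moreover have "continuous_map (top_of_set (- {0::complex})) euclidean inverse"
    by (auto intro!: continuous_intros)
  ultimately show "continuous_map (subtopology (affine_space I) U) euclidean (\<lambda>z. inverse (f z))"
    using continuous_map_compose[of _ _ f _ inverse] by (simp add: o_def)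
  fix z i assume "z \<in> U" "i \<in> I"
  then show "(\<lambda>t. inverse (f (z(i := t)))) field_differentiable at (z i)"
    using f nz[of z] unfolding holomorphic_several_def by (auto intro!:
      field_differentiable_inverse)
qed

lemma holomorphic_several_mono:
  "holomorphic_several I U f \<Longrightarrow> V \<subseteq> U \<Longrightarrow> holomorphic_several I V f"
  unfolding holomorphic_several_def using continuous_map_from_subtopology_mono by blast

lemma holomorphic_several_sum:
  "finite A \<Longrightarrow> (\<And>a. a \<in> A \<Longrightarrow> holomorphic_several I U (f a)) \<Longrightarrow> holomorphic_several I U (\<lambda>z. \<Sum>a\<in>A. f
    a z)"
  by (induction A rule: finite_induct) (auto intro: holomorphic_several_add
    holomorphic_several_const)

lemma holomorphic_several_prod:
  "finite A \<Longrightarrow> (\<And>a. a \<in> A \<Longrightarrow> holomorphic_several I U (f a)) \<Longrightarrow> holomorphic_several I U (\<lambda>z. \<Prod>a\<in>A. f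
    a z)"
  by (induction A rule: finite_induct) (auto intro: holomorphic_several_mult
    holomorphic_several_const)

text \<open>The neighbourhoods of the trivial representation are obtained as such non-vanishing
  loci.\<close>

lemma openin_nonzero:
  assumes U: "openin (affine_space I) U" and f: "holomorphic_several I U f"
  shows "openin (affine_space I) {z \<in> U. f z \<noteq> 0}"
proof -
  have "openin (subtopology (affine_space I) U) {z \<in> topspace (subtopology (affine_space I) U). f
    z \<in> - {0}}"
    using f unfolding holomorphic_several_def
    by (intro openin_continuous_map_preimage[of _ euclidean]) (auto simp: open_Compl)
  moreover have "{z \<in> topspace (subtopology (affine_space I) U). f z \<in> - {0}} = {z \<in> U. f z \<noteq> 0}"
    using openin_subset[OF U] by auto
  ultimately show ?thesis using U openin_trans_full by metis
qed


section \<open>Singular cochains in low degrees\<close>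

lemma gcar_singular_cochains:
  "gcar (singular_cochains X) p = {c. \<forall>\<sigma>. \<not> singular_simplex p X \<sigma> \<longrightarrow> c \<sigma> = 0}"
  by (simp add: singular_cochains_def vs_record_def)

lemma zero_singular_cochains: "\<zero>\<^bsub>grade (singular_cochains X) p\<^esub> = (\<lambda>\<sigma>. 0)"
  by (simp add: singular_cochains_def vs_record_def)

lemma gdiff_singular_cochains:
  "gdiff (singular_cochains X) p c = (\<lambda>\<sigma>. if singular_simplex (Suc p) X \<sigma>
     then \<Sum>i\<le>Suc p. (-1) ^ i * c (singular_face (Suc p) i \<sigma>) else 0)"
  by (simp add: singular_cochains_def)

lemma gdiff_add:
  "gdiff (singular_cochains X) p (\<lambda>\<sigma>. c \<sigma> + e \<sigma>) =
     (\<lambda>\<sigma>. gdiff (singular_cochains X) p c \<sigma> + gdiff (singular_cochains X) p e \<sigma>)"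
  by (auto simp: gdiff_singular_cochains algebra_simps sum.distrib)

lemma gdiff_minus:
  "gdiff (singular_cochains X) p (\<lambda>\<sigma>. - c \<sigma>) = (\<lambda>\<sigma>. - gdiff (singular_cochains X) p c \<sigma>)"
  by (auto simp: gdiff_singular_cochains sum_negf)

lemma mem_coh_class:
  "y \<in> coh_class (singular_cochains X) p x \<longleftrightarrow>
     (\<exists>b\<in>coboundaries (singular_cochains X) p. y = (\<lambda>\<sigma>. b \<sigma> + x \<sigma>))"
  by (auto simp: coh_class_def a_r_coset_def r_coset_def singular_cochains_def vs_record_def)

lemma coboundaries_zero: "(\<lambda>\<sigma>. 0) \<in> coboundaries (singular_cochains X) (Suc p)"
proof -
  have "gdiff (singular_cochains X) p (\<lambda>\<sigma>. 0) = (\<lambda>\<sigma>. 0)" by (auto simp: gdiff_singular_cochains)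
  moreover have "(\<lambda>\<sigma>. 0) \<in> gcar (singular_cochains X) p" by (simp add: gcar_singular_cochains)
  ultimately show ?thesis unfolding coboundaries_def by (auto intro: rev_image_eqI)
qed

lemma self_in_coh_class: "x \<in> coh_class (singular_cochains X) (Suc p) x"
  unfolding mem_coh_class using coboundaries_zero by (intro bexI[of _ "\<lambda>\<sigma>. 0"]) auto

lemma gcar_sing_coh: "gcar (sing_coh X) p = coh_class (singular_cochains X) p ` cocycles
  (singular_cochains X) p"
  by (simp add: cohomology_def vs_record_def)

lemma cochain_pullback_add:
  "cochain_pullback F i p (\<lambda>\<sigma>. c \<sigma> + e \<sigma>) = (\<lambda>\<sigma>. cochain_pullback F i p c \<sigma> + cochain_pullback F
    i p e \<sigma>)"
  by (auto simp: cochain_pullback_def)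

lemma cochain_pullback_minus:
  "cochain_pullback F i p (\<lambda>\<sigma>. - c \<sigma>) = (\<lambda>\<sigma>. - cochain_pullback F i p c \<sigma>)"
  by (auto simp: cochain_pullback_def)

lemma simplical_face_simplical_face:
  assumes "j < i"
  shows "simplical_face i (simplical_face j x) = simplical_face j (simplical_face (i - 1) x)"
  using assms by (auto simp: simplical_face_def fun_eq_iff)

lemma singular_face_eq:
  assumes "k \<le> Suc p" "x \<in> standard_simplex p"
  shows "singular_face (Suc p) k \<sigma> x = \<sigma> (simplical_face k x)"
  using assms by (simp add: singular_face_def)

lemma simplical_face_closed:
  "k \<le> Suc p \<Longrightarrow> x \<in> standard_simplex p \<Longrightarrow> simplical_face k x \<in> standard_simplex (Suc p)"
  using simplical_face_in_standard_simplex[of "Suc p" k x] by simp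

lemma singular_face_singular_face:
  assumes "j < i" "i \<le> Suc (Suc p)"
  shows "singular_face (Suc p) j (singular_face (Suc (Suc p)) i \<sigma>) =
    singular_face (Suc p) (i - 1) (singular_face (Suc (Suc p)) j \<sigma>)"
proof
  fix x
  show "singular_face (Suc p) j (singular_face (Suc (Suc p)) i \<sigma>) x =
    singular_face (Suc p) (i - 1) (singular_face (Suc (Suc p)) j \<sigma>) x"
  proof (cases "x \<in> standard_simplex p")
    case True
    then show ?thesis
      using assms simplical_face_simplical_face[OF assms(1), of x]
      by (simp add: singular_face_eq simplical_face_closed)
  qed (simp add: singular_face_def)
qed

text \<open>Applied to the cochain on the total space, it makes the transgressed 2-cochain on the
  base closed.\<close>

lemma gdiff_gdiff_1:
  "gdiff (singular_cochains X) (Suc (Suc 0)) (gdiff (singular_cochains X) (Suc 0) c) = (\<lambda>\<sigma>. 0)"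
proof
  fix \<sigma>
  let ?d2 = "singular_face (Suc (Suc 0))" and ?d3 = "singular_face (Suc (Suc (Suc 0)))"
  show "gdiff (singular_cochains X) (Suc (Suc 0)) (gdiff (singular_cochains X) (Suc 0) c) \<sigma> = 0"
  proof (cases "singular_simplex (Suc (Suc (Suc 0))) X \<sigma>")
    case True
    then have s: "singular_simplex (Suc (Suc 0)) X (?d3 k \<sigma>)" if "k \<le> 3" for k
      using singular_simplex_singular_face[of "Suc (Suc (Suc 0))" X \<sigma> k] that by simp
    note f = singular_face_singular_face[of _ _ "Suc 0" \<sigma>]
    have "?d2 0 (?d3 (Suc 0) \<sigma>) = ?d2 0 (?d3 0 \<sigma>)" "?d2 0 (?d3 (Suc (Suc 0)) \<sigma>) = ?d2 (Suc 0)
      (?d3 0 \<sigma>)"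
      "?d2 0 (?d3 (Suc (Suc (Suc 0))) \<sigma>) = ?d2 (Suc (Suc 0)) (?d3 0 \<sigma>)"
      "?d2 (Suc 0) (?d3 (Suc (Suc 0)) \<sigma>) = ?d2 (Suc 0) (?d3 (Suc 0) \<sigma>)"
      "?d2 (Suc 0) (?d3 (Suc (Suc (Suc 0))) \<sigma>) = ?d2 (Suc (Suc 0)) (?d3 (Suc 0) \<sigma>)"
      "?d2 (Suc (Suc 0)) (?d3 (Suc (Suc (Suc 0))) \<sigma>) = ?d2 (Suc (Suc 0)) (?d3 (Suc (Suc 0)) \<sigma>)"
      using f[of 0 "Suc 0"] f[of 0 "Suc (Suc 0)"] f[of 0 "Suc (Suc (Suc 0))"] f[of "Suc 0" "Suc
        (Suc 0)"]
        f[of "Suc 0" "Suc (Suc (Suc 0))"] f[of "Suc (Suc 0)" "Suc (Suc (Suc 0))"] by simp_all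
    then show ?thesis using True s by (simp add: gdiff_singular_cochains)
  qed (simp add: gdiff_singular_cochains)
qed

lemma simplex_map_singular_face:
  assumes "i \<le> Suc p"
  shows "simplex_map p f (singular_face (Suc p) i \<sigma>) = singular_face (Suc p) i (simplex_map (Suc
    p) f \<sigma>)"
  using assms
  by (auto simp: simplex_map_def singular_face_def simplical_face_closed restrict_def fun_eq_iff)

lemma gdiff_cochain_pullback:
  assumes f: "continuous_map X Y f"
  shows "gdiff (singular_cochains X) p (cochain_pullback X f p c) =
    cochain_pullback X f (Suc p) (gdiff (singular_cochains Y) p c)"
proof
  fix \<sigma>
  show "gdiff (singular_cochains X) p (cochain_pullback X f p c) \<sigma> =
    cochain_pullback X f (Suc p) (gdiff (singular_cochains Y) p c) \<sigma>"
  proof (cases "singular_simplex (Suc p) X \<sigma>")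
    case True
    then have "singular_simplex p X (singular_face (Suc p) i \<sigma>)" if "i \<le> Suc p" for i
      using singular_simplex_singular_face[of "Suc p" X \<sigma> i] that by simp
    moreover have "singular_simplex (Suc p) Y (simplex_map (Suc p) f \<sigma>)"
      using True f by (rule singular_simplex_simplex_map)
    ultimately show ?thesis
      using True by (auto simp: gdiff_singular_cochains cochain_pullback_def
        simplex_map_singular_face intro!: sum.cong)
  qed (simp add: gdiff_singular_cochains cochain_pullback_def)
qed


subsection \<open>Paths as singular simplices\<close>

definition seg_point :: "real \<Rightarrow> nat \<Rightarrow> real" where
  "seg_point t = (\<lambda>i. if i = 0 then 1 - t else if i = 1 then t else 0)"

definition simplex_path :: "((nat \<Rightarrow> real) \<Rightarrow> 'a) \<Rightarrow> real \<Rightarrow> 'a" where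
  "simplex_path \<sigma> t = \<sigma> (seg_point t)"

definition path_simplex :: "(real \<Rightarrow> 'a) \<Rightarrow> (nat \<Rightarrow> real) \<Rightarrow> 'a" where
  "path_simplex p = restrict (\<lambda>x. p (x 1)) (standard_simplex 1)"

lemma seg_point_in: "t \<in> {0..1} \<Longrightarrow> seg_point t \<in> standard_simplex (Suc 0)"
  by (auto simp: standard_simplex_def seg_point_def)

lemma seg_point_cont:
  "continuous_map (top_of_set {0..1}) (subtopology (powertop_real UNIV) (standard_simplex (Suc
    0))) seg_point"
proof -
  have "continuous_map (top_of_set {0..1}) euclideanreal (\<lambda>t. seg_point t i)" for i
    by (cases "i = 0"; cases "i = 1") (auto simp: seg_point_def intro!: continuous_intros)
  then show ?thesis
    using seg_point_in by (auto simp: continuous_map_in_subtopology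
      continuous_map_componentwise_UNIV)
qed

lemma standard_simplex_1: "x \<in> standard_simplex (Suc 0) \<Longrightarrow> x (Suc 0) \<in> {0..1} \<and> seg_point (x (Suc
  0)) = x"
  by (auto simp: standard_simplex_def seg_point_def fun_eq_iff)

lemma pathin_simplex_path: "singular_simplex (Suc 0) X \<sigma> \<Longrightarrow> pathin X (simplex_path \<sigma>)"
  using continuous_map_compose[OF seg_point_cont]
  unfolding singular_simplex_def pathin_def simplex_path_def[abs_def] by (auto simp: o_def)

lemma singular_simplex_path_simplex:
  assumes "pathin X p" shows "singular_simplex (Suc 0) X (path_simplex p)"
proof -
  have "continuous_map (subtopology (powertop_real UNIV) (standard_simplex (Suc 0))) (top_of_set
    {0..1}) (\<lambda>x. x (Suc 0))"
    using standard_simplex_1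
    by (auto simp: continuous_map_in_subtopology intro!: continuous_map_from_subtopology
      continuous_map_product_projection)
  from continuous_map_compose[OF this assms[unfolded pathin_def]]
  have "continuous_map (subtopology (powertop_real UNIV) (standard_simplex (Suc 0))) X
    (path_simplex p)"
    by (rule continuous_map_eq) (simp add: path_simplex_def)
  then show ?thesis by (simp add: singular_simplex_def path_simplex_def)
qed

lemma path_simplex_simplex_path:
  assumes "singular_simplex (Suc 0) X \<sigma>" shows "path_simplex (simplex_path \<sigma>) = \<sigma>"
proof
  fix x
  show "path_simplex (simplex_path \<sigma>) x = \<sigma> x"
    using standard_simplex_1[of x] assms
    by (cases "x \<in> standard_simplex (Suc 0)")
       (auto simp: path_simplex_def simplex_path_def singular_simplex_def extensional_def)
qed

lemma path_simplex_cong: "(\<And>t. t \<in> {0..1} \<Longrightarrow> p t = q t) \<Longrightarrow> path_simplex p = path_simplex q"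
  using standard_simplex_1 by (auto simp: path_simplex_def restrict_def fun_eq_iff)

lemma simplex_path_face:
  "t \<in> {0..1} \<Longrightarrow> k \<le> 2 \<Longrightarrow> simplex_path (singular_face (Suc (Suc 0)) k \<sigma>) t = \<sigma> (simplical_face k
    (seg_point t))"
  by (simp add: simplex_path_def singular_face_eq seg_point_in)

text \<open>Parametrizes the 2-simplex by the triangle with corners \<open>(0,0)\<close>,
  \<open>(1,0)\<close>, \<open>(1,1)\<close>, which correspond to the vertices 0, 1, 2. The triangle
  is convex in a normed space, so \<open>holonomy_triangle\<close> applies to it.\<close>

definition tri_point :: "real \<times> real \<Rightarrow> nat \<Rightarrow> real" where
  "tri_point z = (\<lambda>i. if i = 0 then 1 - fst z else if i = 1 then fst z - snd z else if i = 2 then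
    snd z else 0)"

lemma tri_point_edges:
  "simplical_face 0 (seg_point t) = tri_point (1, t)"
  "simplical_face (Suc 0) (seg_point t) = tri_point (t, t)"
  "simplical_face (Suc (Suc 0)) (seg_point t) = tri_point (t, 0)"
  by (auto simp: simplical_face_def seg_point_def tri_point_def fun_eq_iff)

lemma tri_point_cont:
  "continuous_map (top_of_set {z. 0 \<le> snd z \<and> snd z \<le> fst z \<and> fst z \<le> 1})
     (subtopology (powertop_real UNIV) (standard_simplex (Suc (Suc 0)))) tri_point"
proof -
  let ?Q = "{z :: real \<times> real. 0 \<le> snd z \<and> snd z \<le> fst z \<and> fst z \<le> 1}"
  have "continuous_map (top_of_set ?Q) euclideanreal (\<lambda>z. tri_point z i)" for i
    by (cases "i = 0"; cases "i = 1"; cases "i = 2") (auto simp: tri_point_def intro!: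
      continuous_intros)
  moreover have "tri_point z \<in> standard_simplex (Suc (Suc 0))" if "z \<in> ?Q" for z
    using that by (auto simp: standard_simplex_def tri_point_def)
  ultimately show ?thesis
    by (auto simp: continuous_map_in_subtopology continuous_map_componentwise_UNIV)
qed

text \<open>This is the relation around the triangle of \<open>tri_point\<close>. It turns an
  additive character, evaluated on holonomies of edges, into a 1-cocycle.\<close>

lemma (in pointed_space) holonomy_simplex:
  assumes "singular_simplex (Suc (Suc 0)) X \<sigma>"
  shows "holonomy X x0 (simplex_path (singular_face (Suc (Suc 0)) (Suc (Suc 0)) \<sigma>)) \<otimes>\<^bsub>PI\<^esub>
    holonomy X x0 (simplex_path (singular_face (Suc (Suc 0)) 0 \<sigma>)) =
    holonomy X x0 (simplex_path (singular_face (Suc (Suc 0)) (Suc 0) \<sigma>))"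
proof -
  let ?Q = "{z :: real \<times> real. 0 \<le> snd z \<and> snd z \<le> fst z \<and> fst z \<le> 1}"
  let ?d = "singular_face (Suc (Suc 0))"
  have c: "continuous_map (top_of_set ?Q) X (\<sigma> \<circ> tri_point)"
    using continuous_map_compose[OF tri_point_cont] assms unfolding singular_simplex_def by blast
  have Q: "convex ?Q"
  proof (rule convexI)
    fix x y :: "real \<times> real" and u v :: real
    assume *: "x \<in> ?Q" "y \<in> ?Q" "0 \<le> u" "0 \<le> v" "u + v = 1"
    have "u * snd x + v * snd y \<le> u * fst x + v * fst y"
      using * by (intro add_mono mult_left_mono) auto
    moreover have "u * fst x + v * fst y \<le> u * 1 + v * 1"
      using * by (intro add_mono mult_left_mono) auto
    ultimately show "u *\<^sub>R x + v *\<^sub>R y \<in> ?Q" using * by auto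
  qed
  have e: "holonomy X x0 (simplex_path (?d k \<sigma>)) = holonomy X x0 (\<sigma> \<circ> tri_point \<circ> linepath a b)"
    if k: "k \<le> 2" "\<And>t. t \<in> {0..1} \<Longrightarrow> simplical_face k (seg_point t) = tri_point (linepath a b t)"
      for k a b
  proof (rule holonomy_homotopic, rule path_homotopic_eq)
    show "pathin X (simplex_path (?d k \<sigma>))"
      using assms k(1) singular_simplex_singular_face[of "Suc (Suc 0)" X \<sigma> k] pathin_simplex_path
        by auto
  qed (use k in \<open>auto simp: simplex_path_face\<close>)
  have "holonomy X x0 (simplex_path (?d (Suc (Suc 0)) \<sigma>)) = holonomy X x0 (\<sigma> \<circ> tri_point \<circ>
    linepath (0,0) (1,0))"
    "holonomy X x0 (simplex_path (?d 0 \<sigma>)) = holonomy X x0 (\<sigma> \<circ> tri_point \<circ> linepath (1,0) (1,1))"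
    "holonomy X x0 (simplex_path (?d (Suc 0) \<sigma>)) = holonomy X x0 (\<sigma> \<circ> tri_point \<circ> linepath (0,0)
      (1,1))"
    by (rule e; simp add: tri_point_edges linepath_def)+
  then show ?thesis using holonomy_triangle[OF Q c, of "(0,0)" "(1,0)" "(1,1)"] by simp
qed

locale path_cocycle =
  fixes X :: "'a topology" and \<xi> :: "((nat \<Rightarrow> real) \<Rightarrow> 'a) \<Rightarrow> complex"
  assumes cocycle: "\<xi> \<in> cocycles (singular_cochains X) (Suc 0)"
begin

definition "\<Xi> p = \<xi> (path_simplex p)"

lemma \<Xi>_simplex_path: "singular_simplex (Suc 0) X \<sigma> \<Longrightarrow> \<Xi> (simplex_path \<sigma>) = \<xi> \<sigma>"
  by (simp add: \<Xi>_def path_simplex_simplex_path)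

lemma \<Xi>_cong: "(\<And>t. t \<in> {0..1} \<Longrightarrow> p t = q t) \<Longrightarrow> \<Xi> p = \<Xi> q"
  unfolding \<Xi>_def using path_simplex_cong by metis

lemma \<Xi>_simplex:
  assumes "singular_simplex (Suc (Suc 0)) X \<sigma>"
  shows "\<Xi> (\<lambda>t. \<sigma> (simplical_face 0 (seg_point t))) - \<Xi> (\<lambda>t. \<sigma> (simplical_face (Suc 0) (seg_point
    t)))
     + \<Xi> (\<lambda>t. \<sigma> (simplical_face (Suc (Suc 0)) (seg_point t))) = 0"
proof -
  let ?d = "singular_face (Suc (Suc 0))"
  have "\<Xi> (\<lambda>t. \<sigma> (simplical_face k (seg_point t))) = \<xi> (?d k \<sigma>)" if "k \<le> 2" for k
  proof -
    have "singular_simplex (Suc 0) X (?d k \<sigma>)"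
      using assms that singular_simplex_singular_face[of "Suc (Suc 0)" X \<sigma> k] by simp
    then have "\<xi> (?d k \<sigma>) = \<Xi> (simplex_path (?d k \<sigma>))" by (simp add: \<Xi>_simplex_path)
    also have "\<dots> = \<Xi> (\<lambda>t. \<sigma> (simplical_face k (seg_point t)))"
      by (rule \<Xi>_cong) (simp add: simplex_path_face that)
    finally show ?thesis ..
  qed
  moreover have "gdiff (singular_cochains X) (Suc 0) \<xi> \<sigma> = 0"
    using cocycle by (simp add: cocycles_def zero_singular_cochains)
  ultimately show ?thesis using assms by (simp add: gdiff_singular_cochains)
qed

text \<open>The lower triangle of the square, as a singular 2-simplex, compares the diagonal with
  the bottom side followed by the right side.\<close>

lemma \<Xi>_triangle:
  assumes H: "continuous_map (top_of_set ({0..1} \<times> {0..1})) X H"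
  shows "\<Xi> (\<lambda>t. H (t, t)) = \<Xi> (\<lambda>t. H (t, 0)) + \<Xi> (\<lambda>t. H (1, t :: real))"
proof -
  let ?D = "standard_simplex (Suc (Suc 0))"
  define \<sigma> where "\<sigma> = restrict (\<lambda>x. H (x 1 + x 2, x 2)) ?D"
  have D: "x 1 + x 2 \<in> {0..1} \<and> x 2 \<in> {0..1}" if "x \<in> ?D" for x
  proof -
    have "x 0 + x 1 + x 2 = 1" "0 \<le> x 0" "0 \<le> x 1" "0 \<le> x 2" "x 2 \<le> 1"
      using that by (auto simp: standard_simplex_def numeral_2_eq_2)
    then show ?thesis by auto
  qed
  have "continuous_map (subtopology (powertop_real UNIV) ?D) (top_of_set ({0..1} \<times> {0..1})) (\<lambda>x.
    (x 1 + x 2, x 2))"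
    unfolding prod_topology_subtopology_eu[symmetric]
    using D by (intro continuous_map_pairedI)
      (auto simp: continuous_map_in_subtopology intro!: continuous_map_add
        continuous_map_from_subtopology continuous_map_product_projection)
  from continuous_map_compose[OF this H] have "continuous_map (subtopology (powertop_real UNIV)
    ?D) X \<sigma>"
    by (rule continuous_map_eq) (simp add: \<sigma>_def)
  then have s: "singular_simplex (Suc (Suc 0)) X \<sigma>" by (simp add: singular_simplex_def \<sigma>_def)
  have "\<Xi> (\<lambda>t. \<sigma> (simplical_face k (seg_point t))) = \<Xi> (\<lambda>t. H (f t))"
    if "k \<le> 2" "\<And>t. H (simplical_face k (seg_point t) 1 + simplical_face k (seg_point t) 2,
      simplical_face k (seg_point t) 2) = H (f t)"
    for k f
    by (rule \<Xi>_cong) (use that simplical_face_closed[of k "Suc 0"] seg_point_in in \<open>auto simp: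
      \<sigma>_def\<close>)
  from this[of 0 "\<lambda>t. (1, t)"] this[of "Suc 0" "\<lambda>t. (t, t)"] this[of "Suc (Suc 0)" "\<lambda>t. (t, 0)"]
  show ?thesis using \<Xi>_simplex[OF s] by (simp add: tri_point_edges tri_point_def algebra_simps)
qed

lemma \<Xi>_triangle':
  assumes H: "continuous_map (top_of_set ({0..1} \<times> {0..1})) X H"
  shows "\<Xi> (\<lambda>t. H (t, t)) = \<Xi> (\<lambda>t. H (0, t)) + \<Xi> (\<lambda>t. H (t, 1 :: real))"
proof -
  have "continuous_map (top_of_set ({0..1} \<times> {0..1})) (top_of_set ({0..1::real} \<times> {0..1::real}))
    (\<lambda>z. (snd z, fst z))"
    by (auto intro!: continuous_intros)
  from \<Xi>_triangle[OF continuous_map_compose[OF this H]] show ?thesis by simp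
qed

end


section \<open>Degree one classes of the structure group are universally transgressive\<close>

locale group_cocycle = topological_group K T + path_cocycle T \<xi>
  for K :: "'k monoid" (structure) and T :: "'k topology" and \<xi> +
  assumes pcT: "path_connected_space T"
begin

sublocale T0: pointed_space T \<one>
  by unfold_locales (use pcT one_closed carrier_eq in auto)

definition \<kappa> :: "'k \<Rightarrow> real \<Rightarrow> 'k" where "\<kappa> k = tether T \<one> k"

lemma \<kappa>: "k \<in> carrier K \<Longrightarrow> pathin T (\<kappa> k) \<and> \<kappa> k 0 = \<one> \<and> \<kappa> k 1 = k"
  using T0.tether[of k] by (simp add: \<kappa>_def carrier_eq)

text \<open>The failure of additivity along the chosen paths. By \<open>\<Xi>_mult\<close> the
  failure along arbitrary paths is the value of \<omega> at their ends minus its value at their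
  starts.\<close>

definition \<omega> :: "'k \<Rightarrow> 'k \<Rightarrow> complex" where
  "\<omega> k l = \<Xi> (\<lambda>t. \<kappa> k t \<otimes> \<kappa> l t) - \<Xi> (\<kappa> k) - \<Xi> (\<kappa> l)"

lemma pathin_carrier: "pathin T p \<Longrightarrow> t \<in> {0..1} \<Longrightarrow> p t \<in> carrier K"
  unfolding pathin_def carrier_eq using continuous_map_image_subset_topspace by fastforce

text \<open>Compare the two ways round the squares \<open>h(s)g(t)\<close>, \<open>h(s)\<kappa>(t)\<close>, \<open>\<kappa>(s)g(t)\<close> and \<open>\<kappa>(s)\<kappa>(t)\<close>.\<close>

lemma \<Xi>_mult:
  assumes h: "pathin T h" and g: "pathin T g"
  shows "\<Xi> (\<lambda>t. h t \<otimes> g t) = \<Xi> h + \<Xi> g + \<omega> (h 1) (g 1) - \<omega> (h 0) (g 0)"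
proof -
  have c: "continuous_map (top_of_set ({0..1} \<times> {0..1})) T (\<lambda>z. p (fst z) \<otimes> q (snd z))"
    if "pathin T p" "pathin T q" for p q
  proof -
    let ?Z = "prod_topology (top_of_set {0..1::real}) (top_of_set {0..1::real})"
    have "continuous_map ?Z T (\<lambda>z. p (fst z) \<otimes> q (snd z))"
      using continuous_map_compose[OF continuous_map_fst that(1)[unfolded pathin_def]]
        continuous_map_compose[OF continuous_map_snd that(2)[unfolded pathin_def]]
      by (intro continuous_map_mult) (auto simp: o_def simp del: prod_topology_subtopology_eu)
    then show ?thesis by simp
  qed
  have t1: "\<Xi> (\<lambda>t. p t \<otimes> q t) = \<Xi> (\<lambda>t. p t \<otimes> q 0) + \<Xi> (\<lambda>t. p 1 \<otimes> q t)"
    and t2: "\<Xi> (\<lambda>t. p t \<otimes> q t) = \<Xi> (\<lambda>t. p 0 \<otimes> q t) + \<Xi> (\<lambda>t. p t \<otimes> q 1)"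
    if "pathin T p" "pathin T q" for p q
    using \<Xi>_triangle[OF c[OF that]] \<Xi>_triangle'[OF c[OF that]] by simp_all
  have e: "h 0 \<in> carrier K" "h 1 \<in> carrier K" "g 0 \<in> carrier K" "g 1 \<in> carrier K"
    using pathin_carrier h g by auto
  have one: "\<Xi> (\<lambda>t. p t \<otimes> \<one>) = \<Xi> p" "\<Xi> (\<lambda>t. \<one> \<otimes> p t) = \<Xi> p" if "pathin T p" for p
    using pathin_carrier[OF that] by (auto intro!: \<Xi>_cong)
  note k = \<kappa>[OF e(1)] \<kappa>[OF e(2)] \<kappa>[OF e(3)] \<kappa>[OF e(4)]
  have 1: "\<Xi> (\<lambda>t. h t \<otimes> g t) = \<Xi> (\<lambda>t. h t \<otimes> g 0) + \<Xi> (\<lambda>t. h 1 \<otimes> g t)"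
    using t1[OF h g] .
  have 2: "\<Xi> h + \<Xi> (\<lambda>t. h 1 \<otimes> \<kappa> (g 0) t) = \<Xi> (\<lambda>t. h 0 \<otimes> \<kappa> (g 0) t) + \<Xi> (\<lambda>t. h t \<otimes> g 0)"
    using t1[of h "\<kappa> (g 0)"] t2[of h "\<kappa> (g 0)"] k h one by simp
  have 3: "\<Xi> (\<lambda>t. \<kappa> (h 1) t \<otimes> g 0) + \<Xi> (\<lambda>t. h 1 \<otimes> g t) = \<Xi> g + \<Xi> (\<lambda>t. \<kappa> (h 1) t \<otimes> g 1)"
    using t1[of "\<kappa> (h 1)" g] t2[of "\<kappa> (h 1)" g] k g one by simp
  have 4: "\<Xi> (\<kappa> (h 1)) + \<Xi> (\<lambda>t. h 1 \<otimes> \<kappa> (g 0) t) = \<Xi> (\<kappa> (g 0)) + \<Xi> (\<lambda>t. \<kappa> (h 1) t \<otimes> g 0)"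
    using t1[of "\<kappa> (h 1)" "\<kappa> (g 0)"] t2[of "\<kappa> (h 1)" "\<kappa> (g 0)"] k one by simp
  have 5: "\<Xi> (\<lambda>t. \<kappa> (h 1) t \<otimes> \<kappa> (g 1) t) = \<Xi> (\<kappa> (g 1)) + \<Xi> (\<lambda>t. \<kappa> (h 1) t \<otimes> g 1)"
    using t2[of "\<kappa> (h 1)" "\<kappa> (g 1)"] k one by simp
  have 6: "\<Xi> (\<lambda>t. \<kappa> (h 0) t \<otimes> \<kappa> (g 0) t) = \<Xi> (\<kappa> (h 0)) + \<Xi> (\<lambda>t. h 0 \<otimes> \<kappa> (g 0) t)"
    using t1[of "\<kappa> (h 0)" "\<kappa> (g 0)"] k one by simp
  have a: "\<Xi> (\<lambda>t. h t \<otimes> g 0) = \<Xi> h + \<Xi> (\<lambda>t. h 1 \<otimes> \<kappa> (g 0) t) - \<Xi> (\<lambda>t. h 0 \<otimes> \<kappa> (g 0) t)"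
    by (simp add: 2)
  have b: "\<Xi> (\<lambda>t. h 1 \<otimes> g t) = \<Xi> g + \<Xi> (\<lambda>t. \<kappa> (h 1) t \<otimes> g 1) - \<Xi> (\<lambda>t. \<kappa> (h 1) t \<otimes> g 0)"
    by (simp add: 3[symmetric])
  have c: "\<Xi> (\<lambda>t. h 1 \<otimes> \<kappa> (g 0) t) = \<Xi> (\<kappa> (g 0)) + \<Xi> (\<lambda>t. \<kappa> (h 1) t \<otimes> g 0) - \<Xi> (\<kappa> (h 1))"
    by (simp add: 4[symmetric])
  show ?thesis unfolding \<omega>_def 1 a b c 5 6 by simp
qed

end

context principal_action
begin

text \<open>Simplices of dimension 2 and 3 are retracts of the cube.\<close>

lemma simplex_lift:
  assumes \<tau>: "singular_simplex n BX \<tau>" and n: "n = 2 \<or> n = 3"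
  shows "\<exists>\<sigma>. singular_simplex n X \<sigma> \<and> (\<forall>x\<in>standard_simplex n. proj (\<sigma> x) = \<tau> x)"
proof -
  let ?D = "standard_simplex n"
  let ?S = "subtopology (powertop_real UNIV) ?D"
  let ?C = "cbox (0, 0, 0) (1, 1, 1) :: (real \<times> real \<times> real) set"
  \<comment> \<open>For \<open>n = 2\<close> the factor 0 suppresses the last coordinate, so one
    formula retracts the cube to the 2-simplex and to the 3-simplex.\<close>
  define c where "c = (if n = 3 then 1 else 0 :: real)"
  define y2 where "y2 z = min (fst (snd z)) (1 - fst z)" for z :: "real \<times> real \<times> real"
  define y3 where "y3 z = c * min (snd (snd z)) (1 - fst z - y2 z)" for z
  define r where "r z = (\<lambda>i::nat. if i = 0 then 1 - fst z - y2 z - y3 z else if i = 1 then fst z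
     else if i = 2 then y2 z else if i = 3 then y3 z else 0)" for z
  have C: "z \<in> ?C \<longleftrightarrow> 0 \<le> fst z \<and> fst z \<le> 1 \<and> 0 \<le> fst (snd z) \<and> fst (snd z) \<le> 1 \<and> 0 \<le> snd (snd z) \<and>
    snd (snd z) \<le> 1" for z
    by (cases z) (auto simp: cbox_Pair_eq)
  have rD: "r z \<in> ?D" if z: "z \<in> ?C" for z
  proof -
    have 2: "0 \<le> y2 z" "y2 z \<le> 1 - fst z" using z C by (auto simp: y2_def)
    have 3: "0 \<le> y3 z" "y3 z \<le> 1 - fst z - y2 z" using z C 2 by (auto simp: y3_def c_def)
    have "(\<Sum>i\<le>n. r z i) = 1"
      using n by (auto simp: r_def numeral_2_eq_2 numeral_3_eq_3 y3_def c_def)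
    moreover have "r z i = 0" if "i > n" for i using that n by (auto simp: r_def y3_def c_def)
    moreover have "0 \<le> r z i \<and> r z i \<le> 1" for i using 2 3 z C by (auto simp: r_def)
    ultimately show ?thesis by (auto simp: standard_simplex_def)
  qed
  have "continuous_map (top_of_set ?C) euclideanreal (\<lambda>z. r z i)" for i
    unfolding r_def y3_def y2_def
    by (cases "i = 0"; cases "i = 1"; cases "i = 2"; cases "i = 3") (auto intro!: continuous_intros)
  then have r: "continuous_map (top_of_set ?C) ?S r"
    using rD by (auto simp: continuous_map_in_subtopology continuous_map_componentwise_UNIV)
  have \<tau>c: "continuous_map ?S BX \<tau>" using \<tau> by (simp add: singular_simplex_def)
  have "liftable (\<tau> \<circ> r) ?C" by (rule liftable_cbox[OF continuous_map_compose[OF r \<tau>c]])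
  then obtain l where l: "continuous_map (top_of_set ?C) X l" "\<And>z. z \<in> ?C \<Longrightarrow> proj (l z) = \<tau> (r z)"
    unfolding liftable_def by auto
  define s where "s x = (x 1, x 2, x 3)" for x :: "nat \<Rightarrow> real"
  have sC: "s x \<in> ?C" if "x \<in> ?D" for x using that C by (auto simp: s_def standard_simplex_def)
  have rs: "r (s x) = x" if x: "x \<in> ?D" for x
  proof -
    have sum: "x 0 + x 1 + x 2 + x 3 = 1" "n = 2 \<Longrightarrow> x 3 = 0" "\<And>i. 0 \<le> x i" "\<And>i. i > 3 \<Longrightarrow> x i = 0"
      using x n by (auto simp: standard_simplex_def numeral_2_eq_2 numeral_3_eq_3)
    have "y2 (s x) = x 2" using sum(1) sum(3)[of 0] sum(3)[of 3] by (simp add: y2_def s_def)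
    moreover from this have "y3 (s x) = x 3"
      using sum(1,2) sum(3)[of 0] n by (auto simp: y3_def c_def) (simp_all add: s_def)
    ultimately show ?thesis using sum by (auto simp: r_def fun_eq_iff s_def)
  qed
  have "continuous_map ?S euclidean s"
    unfolding s_def prod_topology_euclidean[symmetric]
    by (intro continuous_map_pairedI continuous_map_from_subtopology
      continuous_map_product_projection) auto
  then have "continuous_map ?S (top_of_set ?C) s"
    using sC by (auto simp: continuous_map_in_subtopology)
  from continuous_map_compose[OF this l(1)] have ls: "continuous_map ?S X (l \<circ> s)" .
  have "singular_simplex n X (restrict (l \<circ> s) ?D)"
    unfolding singular_simplex_def
    using continuous_map_eq[OF ls, of "restrict (l \<circ> s) ?D"] by auto
  moreover have "\<forall>x\<in>?D. proj (restrict (l \<circ> s) ?D x) = \<tau> x"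
    using l(2) sC rs by auto
  ultimately show ?thesis by blast
qed

end

section \<open>Construction of the transgression of a degree one class\<close>

locale transgression_setup =
  principal_action K T X act + group_cocycle K T \<xi>
  for K :: "'k monoid" (structure) and T :: "'k topology" and X :: "'x topology" and act and \<xi> +
  fixes e0 assumes e0: "e0 \<in> topspace X"
begin

text \<open>All chosen lifts of edges end at these points. Hence the value of \<open>gap\<close> at
  a vertex is the same for all edges meeting there, and the end point terms cancel around a
  triangle.\<close>

definition sec :: "'x set \<Rightarrow> 'x" where
  "sec b = (if b = proj e0 then e0 else (SOME x. x \<in> topspace X \<and> proj x = b))"

lemma sec: "b \<in> topspace BX \<Longrightarrow> sec b \<in> topspace X \<and> proj (sec b) = b"
  using someI_ex[of "\<lambda>x. x \<in> topspace X \<and> proj x = b"] e0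
  unfolding sec_def topspace_BX by auto

text \<open>The last clause lifts an edge that stays at \<open>proj e0\<close> to the constant path.
  It makes \<open>cochain\<close> restrict to \<xi> on the orbit of \<open>e0\<close>.\<close>

definition good_lift :: "((nat \<Rightarrow> real) \<Rightarrow> 'x set) \<Rightarrow> (real \<Rightarrow> 'x) \<Rightarrow> bool" where
  "good_lift \<tau> l \<longleftrightarrow> pathin X l \<and> l 0 = sec (\<tau> (seg_point 0)) \<and> l 1 = sec (\<tau> (seg_point 1)) \<and>
     (\<forall>t\<in>{0..1}. proj (l t) = \<tau> (seg_point t)) \<and>
     ((\<forall>t\<in>{0..1}. \<tau> (seg_point t) = proj e0) \<longrightarrow> (\<forall>t\<in>{0..1}. l t = e0))"

definition lift :: "((nat \<Rightarrow> real) \<Rightarrow> 'x set) \<Rightarrow> real \<Rightarrow> 'x" where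
  "lift \<tau> = (SOME l. good_lift \<tau> l)"

lemma lift:
  assumes "singular_simplex (Suc 0) BX \<tau>" shows "good_lift \<tau> (lift \<tau>)"
  unfolding lift_def
proof (rule someI_ex[of "good_lift \<tau>"])
  have p: "pathin BX (simplex_path \<tau>)" by (rule pathin_simplex_path[OF assms])
  have B: "\<tau> (seg_point t) \<in> topspace BX" if "t \<in> {0..1}" for t
    using continuous_map_image_subset_topspace[OF p[unfolded pathin_def]] that by (auto simp:
      simplex_path_def)
  show "\<exists>l. good_lift \<tau> l"
  proof (cases "\<forall>t\<in>{0..1}. \<tau> (seg_point t) = proj e0")
    case True
    then have "good_lift \<tau> (\<lambda>_. e0)" using e0 by (auto simp: good_lift_def sec_def)
    then show ?thesis by blast
  next
    case False
    obtain l where "pathin X l" "l 0 = sec (\<tau> (seg_point 0))" "l 1 = sec (\<tau> (seg_point 1))"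
       "\<And>t. t \<in> {0..1} \<Longrightarrow> proj (l t) = simplex_path \<tau> t"
      using path_lift_ends[OF p, of "sec (\<tau> (seg_point 0))" "sec (\<tau> (seg_point 1))"] sec[OF B[of
        0]] sec[OF B[of 1]] pcT
      by (auto simp: simplex_path_def)
    then show ?thesis using False by (auto simp: good_lift_def simplex_path_def)
  qed
qed

text \<open>An edge measured against the chosen lift of its projection: this path in
  \<open>K\<close> carries the chosen lift to the edge.\<close>

definition gap :: "((nat \<Rightarrow> real) \<Rightarrow> 'x) \<Rightarrow> real \<Rightarrow> 'k" where
  "gap \<sigma> t = diff (lift (simplex_map (Suc 0) proj \<sigma>) t) (\<sigma> (seg_point t))"

definition cochain :: "((nat \<Rightarrow> real) \<Rightarrow> 'x) \<Rightarrow> complex" where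
  "cochain \<sigma> = (if singular_simplex (Suc 0) X \<sigma> then \<Xi> (gap \<sigma>) else 0)"

lemma gap:
  assumes \<sigma>: "singular_simplex (Suc 0) X \<sigma>"
  shows "pathin T (gap \<sigma>)" "gap \<sigma> 0 = diff (sec (proj (\<sigma> (seg_point 0)))) (\<sigma> (seg_point 0))"
    "gap \<sigma> 1 = diff (sec (proj (\<sigma> (seg_point 1)))) (\<sigma> (seg_point 1))"
    "t \<in> {0..1} \<Longrightarrow> lift (simplex_map (Suc 0) proj \<sigma>) t \<in> topspace X"
    "t \<in> {0..1} \<Longrightarrow> \<sigma> (seg_point t) \<in> topspace X"
    "t \<in> {0..1} \<Longrightarrow> proj (lift (simplex_map (Suc 0) proj \<sigma>) t) = proj (\<sigma> (seg_point t))"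
proof -
  let ?\<tau> = "simplex_map (Suc 0) proj \<sigma>"
  have "singular_simplex (Suc 0) BX ?\<tau>" using singular_simplex_simplex_map[OF \<sigma> proj_cont] .
  then have l: "good_lift ?\<tau> (lift ?\<tau>)" by (rule lift)
  have \<tau>: "?\<tau> (seg_point t) = proj (\<sigma> (seg_point t))" if "t \<in> {0..1}" for t
    using seg_point_in[OF that] by (simp add: simplex_map_def)
  have p: "pathin X (simplex_path \<sigma>)" by (rule pathin_simplex_path[OF \<sigma>])
  show lX: "t \<in> {0..1} \<Longrightarrow> lift ?\<tau> t \<in> topspace X" for t
    using l continuous_map_image_subset_topspace unfolding good_lift_def pathin_def by fastforce
  show \<sigma>X: "t \<in> {0..1} \<Longrightarrow> \<sigma> (seg_point t) \<in> topspace X" for t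
    using continuous_map_image_subset_topspace[OF p[unfolded pathin_def]] by (auto simp:
      simplex_path_def)
  show pe: "t \<in> {0..1} \<Longrightarrow> proj (lift ?\<tau> t) = proj (\<sigma> (seg_point t))" for t
    using l \<tau> unfolding good_lift_def by auto
  show "gap \<sigma> 0 = diff (sec (proj (\<sigma> (seg_point 0)))) (\<sigma> (seg_point 0))"
    "gap \<sigma> 1 = diff (sec (proj (\<sigma> (seg_point 1)))) (\<sigma> (seg_point 1))"
    using l \<tau>[of 0] \<tau>[of 1] by (simp_all add: gap_def good_lift_def)
  show "pathin T (gap \<sigma>)"
    unfolding pathin_def gap_def[abs_def]
    by (rule diff_cont) (use l p pe in \<open>auto simp: good_lift_def pathin_def
      simplex_path_def[abs_def]\<close>)
qed

lemma diff_act_right: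
  assumes "x \<in> topspace X" "y \<in> topspace X" "proj x = proj y" "k \<in> carrier K"
  shows "diff x (act k y) = k \<otimes> diff x y"
proof -
  have d: "diff x y \<in> carrier K" "act (diff x y) x = y" using diff[OF assms(1-3)] by auto
  have "act k y = act (k \<otimes> diff x y) x" using d assms act_mult by simp
  then show ?thesis using diff_act[of "k \<otimes> diff x y" x] d assms by simp
qed

lemma vertices:
  "simplical_face 0 (seg_point 0) = simplical_face (Suc (Suc 0)) (seg_point 1)"
  "simplical_face 0 (seg_point 1) = simplical_face (Suc 0) (seg_point 1)"
  "simplical_face (Suc 0) (seg_point 0) = simplical_face (Suc (Suc 0)) (seg_point 0)"
  by (auto simp: simplical_face_def seg_point_def fun_eq_iff)

text \<open>Two simplices with the same projection differ by a singular simplex \<open>h\<close> of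
  \<open>K\<close>. By \<open>\<Xi>_mult\<close> the value on an edge changes by \<Xi> of the
  corresponding edge of \<open>h\<close> and a difference of values of \<open>W\<close> at its
  vertices. The first terms cancel by the cocycle condition on \<open>h\<close>, the second ones
  telescope.\<close>

lemma gdiff_cochain_descends:
  assumes \<sigma>: "singular_simplex (Suc (Suc 0)) X \<sigma>" and \<sigma>': "singular_simplex (Suc (Suc 0)) X \<sigma>'"
    and e: "\<And>x. x \<in> standard_simplex (Suc (Suc 0)) \<Longrightarrow> proj (\<sigma> x) = proj (\<sigma>' x)"
  shows "gdiff (singular_cochains X) (Suc 0) cochain \<sigma> = gdiff (singular_cochains X) (Suc 0)
    cochain \<sigma>'"
proof -
  let ?D = "standard_simplex (Suc (Suc 0))" and ?d = "singular_face (Suc (Suc 0))"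
  let ?S = "subtopology (powertop_real UNIV) ?D"
  define h where "h = restrict (\<lambda>x. diff (\<sigma> x) (\<sigma>' x)) ?D"
  have c: "continuous_map ?S X \<sigma>" "continuous_map ?S X \<sigma>'"
    using \<sigma> \<sigma>' by (simp_all add: singular_simplex_def)
  have X: "\<sigma> x \<in> topspace X" "\<sigma>' x \<in> topspace X" if "x \<in> ?D" for x
    using c continuous_map_image_subset_topspace that by fastforce+
  have "continuous_map ?S T (\<lambda>x. diff (\<sigma> x) (\<sigma>' x))"
    using c e by (intro diff_cont) auto
  then have hs: "singular_simplex (Suc (Suc 0)) T h"
    unfolding singular_simplex_def h_def using continuous_map_eq by fastforce
  have h: "h x \<in> carrier K" "\<sigma>' x = act (h x) (\<sigma> x)" if "x \<in> ?D" for x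
    using diff[OF X[OF that] e[OF that]] that by (simp_all add: h_def)
  \<comment> \<open>The term \<omega> at a vertex, where \<open>gap\<close> has been identified
    through \<open>sec\<close>; it does not refer to any particular edge.\<close>
  define W where "W x = \<omega> (h x) (diff (sec (proj (\<sigma> x))) (\<sigma> x))" for x
  have edge: "cochain (?d k \<sigma>') = cochain (?d k \<sigma>) + \<Xi> (\<lambda>t. h (simplical_face k (seg_point t)))
     + W (simplical_face k (seg_point 1)) - W (simplical_face k (seg_point 0))" if k: "k \<le> 2" for k
  proof -
    have s: "singular_simplex (Suc 0) X (?d k \<sigma>)" "singular_simplex (Suc 0) X (?d k \<sigma>')"
      using singular_simplex_singular_face[of "Suc (Suc 0)" X _ k] \<sigma> \<sigma>' k by auto
    have f: "simplical_face k (seg_point t) \<in> ?D" if "t \<in> {0..1}" for t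
      using simplical_face_closed[of k "Suc 0"] seg_point_in[OF that] k by simp
    have fe: "?d k \<rho> (seg_point t) = \<rho> (simplical_face k (seg_point t))" if "t \<in> {0..1}" for t
      and \<rho> :: "(nat \<Rightarrow> real) \<Rightarrow> 'x"
      using that seg_point_in k by (simp add: singular_face_eq)
    have same: "simplex_map (Suc 0) proj (?d k \<sigma>') = simplex_map (Suc 0) proj (?d k \<sigma>)"
      using k e by (auto simp: simplex_map_def singular_face_eq simplical_face_closed
        restrict_def fun_eq_iff)
    define \<eta> where "\<eta> t = h (simplical_face k (seg_point t))" for t
    have \<eta>: "pathin T \<eta>"
    proof -
      have "singular_simplex (Suc 0) T (?d k h)"
        using singular_simplex_singular_face[of "Suc (Suc 0)" T h k] hs k by simp
      then have "pathin T (simplex_path (?d k h))" by (rule pathin_simplex_path)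
      then show ?thesis unfolding pathin_def
        by (rule continuous_map_eq) (use k in \<open>simp add: simplex_path_face \<eta>_def\<close>)
    qed
    have "\<Xi> (gap (?d k \<sigma>')) = \<Xi> (\<lambda>t. \<eta> t \<otimes> gap (?d k \<sigma>) t)"
    proof (rule \<Xi>_cong)
      fix t :: real assume t: "t \<in> {0..1}"
      show "gap (?d k \<sigma>') t = \<eta> t \<otimes> gap (?d k \<sigma>) t"
        using diff_act_right[OF gap(4-6)[OF s(1) t], of "\<eta> t"] h[OF f[OF t]] same fe[OF t]
        by (simp add: gap_def \<eta>_def)
    qed
    also have "\<dots> = \<Xi> \<eta> + \<Xi> (gap (?d k \<sigma>)) + \<omega> (\<eta> 1) (gap (?d k \<sigma>) 1) - \<omega> (\<eta> 0) (gap (?d k \<sigma>) 0)"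
      by (rule \<Xi>_mult[OF \<eta> gap(1)[OF s(1)]])
    finally show ?thesis
      using s gap(2,3)[OF s(1)] fe[of 0] fe[of 1] by (simp add: cochain_def W_def \<eta>_def[abs_def])
  qed
  have X1: "\<Xi> (\<lambda>t. h (simplical_face (Suc 0) (seg_point t))) = \<Xi> (\<lambda>t. h (simplical_face 0
    (seg_point t)))
     + \<Xi> (\<lambda>t. h (simplical_face (Suc (Suc 0)) (seg_point t)))"
    using \<Xi>_simplex[OF hs] by (simp add: algebra_simps)
  show ?thesis
    using \<sigma> \<sigma>' edge[of 0] edge[of "Suc 0"] edge[of "Suc (Suc 0)"]
    by (simp add: gdiff_singular_cochains vertices X1)
qed

text \<open>Computed on an arbitrary lift of the simplex; \<open>gdiff_cochain_descends\<close>
  makes the choice immaterial.\<close>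

definition base_cochain :: "((nat \<Rightarrow> real) \<Rightarrow> 'x set) \<Rightarrow> complex" where
  "base_cochain \<tau> = (if singular_simplex (Suc (Suc 0)) BX \<tau>
     then gdiff (singular_cochains X) (Suc 0) cochain
       (SOME \<sigma>. singular_simplex (Suc (Suc 0)) X \<sigma> \<and> (\<forall>x\<in>standard_simplex (Suc (Suc 0)). proj (\<sigma>
         x) = \<tau> x))
     else 0)"

lemma base_cochain:
  assumes \<tau>: "singular_simplex (Suc (Suc 0)) BX \<tau>" and \<sigma>: "singular_simplex (Suc (Suc 0)) X \<sigma>"
    and e: "\<And>x. x \<in> standard_simplex (Suc (Suc 0)) \<Longrightarrow> proj (\<sigma> x) = \<tau> x"
  shows "base_cochain \<tau> = gdiff (singular_cochains X) (Suc 0) cochain \<sigma>"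
proof -
  define \<sigma>' where "\<sigma>' = (SOME \<sigma>. singular_simplex (Suc (Suc 0)) X \<sigma> \<and> (\<forall>x\<in>standard_simplex (Suc
    (Suc 0)). proj (\<sigma> x) = \<tau> x))"
  have "singular_simplex (Suc (Suc 0)) X \<sigma>' \<and> (\<forall>x\<in>standard_simplex (Suc (Suc 0)). proj (\<sigma>' x) = \<tau>
    x)"
    unfolding \<sigma>'_def by (rule someI[of _ \<sigma>]) (use \<sigma> e in blast)
  then have "gdiff (singular_cochains X) (Suc 0) cochain \<sigma>' = gdiff (singular_cochains X) (Suc 0)
    cochain \<sigma>"
    using \<sigma> e by (intro gdiff_cochain_descends) auto
  then show ?thesis using \<tau> by (simp add: base_cochain_def \<sigma>'_def)
qed

lemma gdiff_cochain: "gdiff (singular_cochains X) (Suc 0) cochain = cochain_pullback X proj (Suc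
  (Suc 0)) base_cochain"
proof
  fix \<sigma>
  show "gdiff (singular_cochains X) (Suc 0) cochain \<sigma> = cochain_pullback X proj (Suc (Suc 0))
    base_cochain \<sigma>"
  proof (cases "singular_simplex (Suc (Suc 0)) X \<sigma>")
    case True
    have "base_cochain (simplex_map (Suc (Suc 0)) proj \<sigma>) = gdiff (singular_cochains X) (Suc 0)
      cochain \<sigma>"
      by (rule base_cochain[OF singular_simplex_simplex_map[OF True proj_cont] True]) (simp add:
        simplex_map_def)
    then show ?thesis using True by (simp add: cochain_pullback_def)
  qed (simp add: cochain_pullback_def gdiff_singular_cochains)
qed

text \<open>A 3-simplex of the base lifts as well, and its faces are lifted by the faces of the
  lift. On the total space the expression is the coboundary of a coboundary.\<close>

lemma base_cochain_cocycle: "base_cochain \<in> cocycles (singular_cochains BX) (Suc (Suc 0))"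
proof -
  let ?n = "Suc (Suc (Suc 0))"
  have "gdiff (singular_cochains BX) (Suc (Suc 0)) base_cochain \<tau> = 0" for \<tau>
  proof (cases "singular_simplex ?n BX \<tau>")
    case True
    obtain \<sigma> where \<sigma>: "singular_simplex ?n X \<sigma>" "\<forall>x\<in>standard_simplex ?n. proj (\<sigma> x) = \<tau> x"
      using simplex_lift[OF True] by (auto simp: numeral_3_eq_3)
    have "base_cochain (singular_face ?n i \<tau>) =
        gdiff (singular_cochains X) (Suc 0) cochain (singular_face ?n i \<sigma>)" if i: "i \<le> ?n" for i
    proof (rule base_cochain)
      show "singular_simplex (Suc (Suc 0)) BX (singular_face ?n i \<tau>)"
        "singular_simplex (Suc (Suc 0)) X (singular_face ?n i \<sigma>)"
        using singular_simplex_singular_face[of ?n _ _ i] True \<sigma> i by auto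
      show "proj (singular_face ?n i \<sigma> x) = singular_face ?n i \<tau> x" if "x \<in> standard_simplex (Suc
        (Suc 0))" for x
        using that i \<sigma>(2) simplical_face_closed[OF i that] by (simp add: singular_face_eq)
    qed
    then have "gdiff (singular_cochains BX) (Suc (Suc 0)) base_cochain \<tau> =
      gdiff (singular_cochains X) (Suc (Suc 0)) (gdiff (singular_cochains X) (Suc 0) cochain) \<sigma>"
      unfolding gdiff_singular_cochains[of BX] gdiff_singular_cochains[of X "Suc (Suc 0)"]
      using True \<sigma>(1) by simp
    then show ?thesis by (simp add: gdiff_gdiff_1)
  qed (simp add: gdiff_singular_cochains)
  then show ?thesis
    by (auto simp: cocycles_def gcar_singular_cochains zero_singular_cochains base_cochain_def)
qed

text \<open>An edge in the orbit of \<open>e0\<close> projects to a constant edge, whose chosen lift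
  is constantly \<open>e0\<close>; its gap is therefore the edge of \<open>K\<close> it came
  from.\<close>

lemma cochain_restricts: "cochain_pullback T (\<lambda>k. act k e0) (Suc 0) cochain = \<xi>"
proof
  fix \<sigma>
  have orb: "continuous_map T X (\<lambda>k. act k e0)"
    using continuous_map_act[OF continuous_map_id, of "\<lambda>_. e0"] e0 by simp
  show "cochain_pullback T (\<lambda>k. act k e0) (Suc 0) cochain \<sigma> = \<xi> \<sigma>"
  proof (cases "singular_simplex (Suc 0) T \<sigma>")
    case True
    let ?\<rho> = "simplex_map (Suc 0) (\<lambda>k. act k e0) \<sigma>"
    have \<rho>: "singular_simplex (Suc 0) X ?\<rho>" using singular_simplex_simplex_map[OF True orb] .
    have \<sigma>K: "\<sigma> (seg_point t) \<in> carrier K" if "t \<in> {0..1}" for t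
      using pathin_carrier[OF pathin_simplex_path[OF True] that] by (simp add: simplex_path_def)
    have \<rho>e: "?\<rho> (seg_point t) = act (\<sigma> (seg_point t)) e0" if "t \<in> {0..1}" for t
      using seg_point_in[OF that] by (simp add: simplex_map_def)
    have "\<forall>t\<in>{0..1}. simplex_map (Suc 0) proj ?\<rho> (seg_point t) = proj e0"
      using \<rho>e \<sigma>K seg_point_in e0 by (simp add: simplex_map_def proj_act)
    then have "lift (simplex_map (Suc 0) proj ?\<rho>) t = e0" if "t \<in> {0..1}" for t
      using lift[OF singular_simplex_simplex_map[OF \<rho> proj_cont]] that unfolding good_lift_def by
        blast
    then have "\<Xi> (gap ?\<rho>) = \<Xi> (simplex_path \<sigma>)"
      using \<rho>e \<sigma>K e0 by (intro \<Xi>_cong) (auto simp: gap_def simplex_path_def diff_act)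
    then show ?thesis using True \<rho> by (simp add: cochain_pullback_def cochain_def \<Xi>_simplex_path)
  next
    case False
    then show ?thesis using cocycle
      by (auto simp: cochain_pullback_def cocycles_def gcar_singular_cochains)
  qed
qed

text \<open>Every class in \<open>H^1(K)\<close> is thus universally transgressive, so injectivity
  on \<open>primitive_space\<close> in degree 1 can be applied to all of them, the zero class
  included.\<close>

lemma transgressive:
  "coh_class (singular_cochains T) (Suc 0) \<xi> \<in> primitive_space K T X act e0 (Suc 0)"
proof -
  have "transgresses T (\<lambda>k. act k e0) X proj BX (Suc 0) (coh_class (singular_cochains T) (Suc 0) \<xi>)
    (coh_class (singular_cochains BX) (Suc (Suc 0)) base_cochain)"
    unfolding transgresses_def
  proof (intro conjI bexI[of _ cochain] bexI[of _ base_cochain])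
    show "coh_class (singular_cochains T) (Suc 0) \<xi> \<in> gcar (sing_coh T) (Suc 0)"
      using cocycle by (simp add: gcar_sing_coh)
    show "coh_class (singular_cochains BX) (Suc (Suc 0)) base_cochain \<in> gcar (sing_coh BX) (Suc
      (Suc 0))"
      using base_cochain_cocycle by (simp add: gcar_sing_coh)
    show "cochain \<in> gcar (singular_cochains X) (Suc 0)"
      by (simp add: gcar_singular_cochains cochain_def)
  qed (simp_all add: cochain_restricts self_in_coh_class gdiff_cochain)
  then show ?thesis unfolding primitive_space_def by auto
qed

end


text \<open>The transgression is a description operator, so this gives it equal values on both classes
  whether
  or not it is well defined.\<close>

lemma transgresses_shift:
  assumes F: "continuous_map F E i"
    and c0: "c0 \<in> gcar (singular_cochains E) (Suc 0)" "gdiff (singular_cochains E) (Suc 0) c0 =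
      (\<lambda>_. 0)"
    and \<xi>: "\<xi> = cochain_pullback F i (Suc 0) c0" "\<xi> \<in> cocycles (singular_cochains F) (Suc 0)"
  shows "transgresses F i E q B (Suc 0) (coh_class (singular_cochains F) (Suc 0) \<xi>) y \<longleftrightarrow>
    transgresses F i E q B (Suc 0) (coh_class (singular_cochains F) (Suc 0) (\<lambda>_. 0)) y"
proof -
  let ?C = "coh_class (singular_cochains F) (Suc 0)" and ?d = "gdiff (singular_cochains E) (Suc 0)"
  have z: "(\<lambda>_. 0) \<in> cocycles (singular_cochains F) (Suc 0)"
    by (auto simp: cocycles_def gcar_singular_cochains zero_singular_cochains
      gdiff_singular_cochains)
  have "?C \<xi> \<in> gcar (sing_coh F) (Suc 0)" "?C (\<lambda>_. 0) \<in> gcar (sing_coh F) (Suc 0)"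
    using z \<xi>(2) by (auto simp: gcar_sing_coh)
  moreover have "(\<exists>c\<in>gcar (singular_cochains E) (Suc 0). cochain_pullback F i (Suc 0) c \<in> ?C \<xi> \<and>
    (\<exists>z\<in>y. ?d c = P z)) \<longleftrightarrow>
     (\<exists>c\<in>gcar (singular_cochains E) (Suc 0). cochain_pullback F i (Suc 0) c \<in> ?C (\<lambda>_. 0) \<and> (\<exists>z\<in>y.
       ?d c = P z))" for P
  proof
    assume "\<exists>c\<in>gcar (singular_cochains E) (Suc 0). cochain_pullback F i (Suc 0) c \<in> ?C \<xi> \<and> (\<exists>z\<in>y.
      ?d c = P z)"
    then obtain c where c: "c \<in> gcar (singular_cochains E) (Suc 0)" "cochain_pullback F i (Suc 0)
      c \<in> ?C \<xi>"
      "\<exists>z\<in>y. ?d c = P z" by blast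
    define e where "e = (\<lambda>\<sigma>. c \<sigma> + - c0 \<sigma>)"
    have "e \<in> gcar (singular_cochains E) (Suc 0)" using c(1) c0(1) by (simp add: e_def
      gcar_singular_cochains)
    moreover have "cochain_pullback F i (Suc 0) e \<in> ?C (\<lambda>_. 0)"
      using c(2) \<xi>(1) unfolding e_def cochain_pullback_add cochain_pullback_minus
      by (auto simp: mem_coh_class)
    moreover have "?d e = ?d c" unfolding e_def gdiff_add gdiff_minus c0(2) by simp
    ultimately show "\<exists>c\<in>gcar (singular_cochains E) (Suc 0). cochain_pullback F i (Suc 0) c \<in> ?C
      (\<lambda>_. 0) \<and> (\<exists>z\<in>y. ?d c = P z)"
      using c(3) by metis
  next
    assume "\<exists>c\<in>gcar (singular_cochains E) (Suc 0). cochain_pullback F i (Suc 0) c \<in> ?C (\<lambda>_. 0) \<and>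
      (\<exists>z\<in>y. ?d c = P z)"
    then obtain c where c: "c \<in> gcar (singular_cochains E) (Suc 0)" "cochain_pullback F i (Suc 0)
      c \<in> ?C (\<lambda>_. 0)"
      "\<exists>z\<in>y. ?d c = P z" by blast
    define e where "e = (\<lambda>\<sigma>. c \<sigma> + c0 \<sigma>)"
    have "e \<in> gcar (singular_cochains E) (Suc 0)" using c(1) c0(1) by (simp add: e_def
      gcar_singular_cochains)
    moreover have "cochain_pullback F i (Suc 0) e \<in> ?C \<xi>"
      using c(2) \<xi>(1) unfolding e_def cochain_pullback_add
      by (auto simp: mem_coh_class)
    moreover have "?d e = ?d c" unfolding e_def gdiff_add c0(2) by simp
    ultimately show "\<exists>c\<in>gcar (singular_cochains E) (Suc 0). cochain_pullback F i (Suc 0) c \<in> ?C \<xi>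
      \<and> (\<exists>z\<in>y. ?d c = P z)"
      using c(3) by metis
  qed
  ultimately show ?thesis unfolding transgresses_def by simp
qed

text \<open>The two faces of a loop are the same 0-simplex, so their contributions cancel.\<close>

lemma coboundary_on_loop:
  assumes "gdiff (singular_cochains X) 0 u = \<xi>" "pathin X k" "k 0 = k 1"
  shows "\<xi> (path_simplex k) = 0"
proof -
  let ?d = "singular_face (Suc 0)"
  have e: "simplical_face 0 x = seg_point 1" "simplical_face (Suc 0) x = seg_point 0" if "x \<in>
    standard_simplex 0" for x
    using that by (auto simp: simplical_face_def seg_point_def standard_simplex_def fun_eq_iff)
  have p: "path_simplex k (seg_point t) = k t" if "t \<in> {0..1}" for t
    using seg_point_in[OF that] by (simp add: path_simplex_def) (simp add: seg_point_def)
  have "?d 0 (path_simplex k) = ?d (Suc 0) (path_simplex k)"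
  proof
    fix x show "?d 0 (path_simplex k) x = ?d (Suc 0) (path_simplex k) x"
      using assms(3) p[of 0] p[of 1] by (cases "x \<in> standard_simplex 0") (simp_all add:
        singular_face_def e)
  qed
  then show ?thesis
    unfolding assms(1)[symmetric] using singular_simplex_path_simplex[OF assms(2)] by (simp add:
      gdiff_singular_cochains)
qed

text \<open>Chain-level form of the passage from additive characters to degree one classes. By
  \<open>holonomy_simplex\<close> the holonomy of the middle edge is the product of the other
  two.\<close>

lemma additive_holonomy_cocycle:
  assumes "pointed_space X x0" and \<phi>: "additive_on (fundamental_group X x0) (carrier
    (fundamental_group X x0)) \<phi>"
  shows "gdiff (singular_cochains X) (Suc 0)
    (\<lambda>\<sigma>. if singular_simplex (Suc 0) X \<sigma> then \<phi> (holonomy X x0 (simplex_path \<sigma>)) else 0) = (\<lambda>_. 0)"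
proof
  interpret pointed_space X x0 by (rule assms(1))
  fix \<sigma>
  let ?d = "singular_face (Suc (Suc 0))"
  show "gdiff (singular_cochains X) (Suc 0)
    (\<lambda>\<sigma>. if singular_simplex (Suc 0) X \<sigma> then \<phi> (holonomy X x0 (simplex_path \<sigma>)) else 0) \<sigma> = 0"
  proof (cases "singular_simplex (Suc (Suc 0)) X \<sigma>")
    case True
    have s: "singular_simplex (Suc 0) X (?d k \<sigma>)" if "k \<le> 2" for k
      using singular_simplex_singular_face[of "Suc (Suc 0)" X \<sigma> k] True that by simp
    have "\<phi> (holonomy X x0 (simplex_path (?d (Suc 0) \<sigma>))) =
      \<phi> (holonomy X x0 (simplex_path (?d (Suc (Suc 0)) \<sigma>))) + \<phi> (holonomy X x0 (simplex_path (?d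
        0 \<sigma>)))"
      unfolding holonomy_simplex[OF True, symmetric]
      using \<phi> s unfolding additive_on_def by (simp add: pathin_simplex_path)
    then show ?thesis using True s by (simp add: gdiff_singular_cochains)
  qed (simp add: gdiff_singular_cochains)
qed

context borel_setup
begin

lemma kills_additive:
  assumes inj: "inj_on (transgression K T E ea e0 X a x0 (Suc 0)) (primitive_space K T E ea e0
    (Suc 0))"
    and \<phi>: "additive_on X0.PI (carrier X0.PI) \<phi>" and c: "c \<in> carrier T0.PI"
  shows "\<phi> (orbit_sharp c) = 0"
proof -
  obtain k where k: "is_loop T \<one> k" "c = path_class T k" using c by (auto simp:
    carrier_fundamental_group)
  have kp: "pathin T k" "k 0 = k 1" using k by (auto simp: is_loop_def)
  define cX where "cX = (\<lambda>\<sigma>. if singular_simplex (Suc 0) X \<sigma> then \<phi> (holonomy X x0 (simplex_path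
    \<sigma>)) else 0)"
  have dX: "gdiff (singular_cochains X) (Suc 0) cX = (\<lambda>_. 0)"
    unfolding cX_def by (rule additive_holonomy_cocycle[OF X0.pointed_space_axioms \<phi>])
  define c0 where "c0 = cochain_pullback EM snd (Suc 0) cX"
  have d0: "gdiff (singular_cochains EM) (Suc 0) c0 = (\<lambda>_. 0)"
    unfolding c0_def gdiff_cochain_pullback[OF continuous_map_snd] dX by (auto simp:
      cochain_pullback_def)
  have c0: "c0 \<in> gcar (singular_cochains EM) (Suc 0)"
    by (simp add: c0_def gcar_singular_cochains cochain_pullback_def)
  let ?i = "\<lambda>k. (ea k e0, a k x0)"
  have i: "continuous_map T EM ?i"
    using E.continuous_map_act[OF continuous_map_id, of "\<lambda>_. e0"] X.continuous_map_act[OF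
      continuous_map_id, of "\<lambda>_. x0"] e0 x0
    by (intro continuous_map_pairedI) auto
  define \<xi> where "\<xi> = cochain_pullback T ?i (Suc 0) c0"
  have "gdiff (singular_cochains T) (Suc 0) \<xi> = (\<lambda>_. 0)"
    unfolding \<xi>_def gdiff_cochain_pullback[OF i] d0 by (auto simp: cochain_pullback_def)
  then have \<xi>: "\<xi> \<in> cocycles (singular_cochains T) (Suc 0)"
    by (simp add: cocycles_def gcar_singular_cochains zero_singular_cochains) (simp add: \<xi>_def
      cochain_pullback_def)
  have zero: "(\<lambda>_. 0) \<in> cocycles (singular_cochains T) (Suc 0)"
    by (auto simp: cocycles_def gcar_singular_cochains zero_singular_cochains
      gdiff_singular_cochains)
  let ?C = "coh_class (singular_cochains T) (Suc 0)"
  \<comment> \<open>Injectivity compares two members of \<open>primitive_space\<close>: the class of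
    \<xi> and the zero class. The construction of the transgression is run for both.\<close>
  have prim: "?C \<zeta> \<in> primitive_space K T E ea e0 (Suc 0)" if "\<zeta> \<in> cocycles (singular_cochains T)
    (Suc 0)" for \<zeta>
  proof -
    interpret transgression_setup K T E ea \<zeta> e0
      by unfold_locales (use that pcT e0 in auto)
    show ?thesis by (rule transgressive)
  qed
  have "transgression K T E ea e0 X a x0 (Suc 0) (?C \<xi>) = transgression K T E ea e0 X a x0 (Suc
    0) (?C (\<lambda>_. 0))"
    unfolding transgression_def
    by (rule arg_cong[where f = The], rule ext, rule transgresses_shift[OF i c0 d0 \<xi>_def \<xi>])
  then have "?C \<xi> = ?C (\<lambda>_. 0)" using inj prim[OF \<xi>] prim[OF zero] by (auto dest: inj_onD)
  then have "\<xi> \<in> ?C (\<lambda>_. 0)" using self_in_coh_class by metis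
  then have "\<xi> \<in> coboundaries (singular_cochains T) (Suc 0)" by (auto simp: mem_coh_class)
  then obtain u where "gdiff (singular_cochains T) 0 u = \<xi>" unfolding coboundaries_def by auto
  then have 0: "\<xi> (path_simplex k) = 0" by (rule coboundary_on_loop[OF _ kp])
  \<comment> \<open>On the loop \<open>k\<close>, the two pullbacks defining \<xi> amount to mapping
    \<open>k\<close> into \<open>EM\<close> by \<open>?i\<close> and projecting to \<open>X\<close>,
    which is \<open>orbit_map\<close>. So the value that was just shown to vanish is \<phi> of the
    orbit class.\<close>
  have s1: "singular_simplex (Suc 0) T (path_simplex k)" by (rule
    singular_simplex_path_simplex[OF kp(1)])
  note s2 = singular_simplex_simplex_map[OF s1 i]
  note s3 = singular_simplex_simplex_map[OF s2 continuous_map_snd]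
  have "\<xi> (path_simplex k) = \<phi> (holonomy X x0 (simplex_path (simplex_map (Suc 0) snd (simplex_map
    (Suc 0) ?i (path_simplex k)))))"
    using s1 s2 s3 by (simp add: \<xi>_def c0_def cX_def cochain_pullback_def)
  also have "holonomy X x0 (simplex_path (simplex_map (Suc 0) snd (simplex_map (Suc 0) ?i
    (path_simplex k)))) =
     holonomy X x0 (orbit_map \<circ> k)"
  proof (rule X0.holonomy_homotopic, rule path_homotopic_eq[OF pathin_simplex_path[OF s3]])
    fix t :: real assume "0 \<le> t" "t \<le> 1"
    then have "seg_point t \<in> standard_simplex (Suc 0)" using seg_point_in by simp
    then show "simplex_path (simplex_map (Suc 0) snd (simplex_map (Suc 0) ?i (path_simplex k))) t
      = (orbit_map \<circ> k) t"
      by (simp add: simplex_path_def simplex_map_def path_simplex_def orbit_map_def) (simp add: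
        seg_point_def)
  qed
  also have "\<dots> = orbit_sharp c"
    using k orbit_sharp_class X0.holonomy_loop[OF orbit_loop[OF k(1)]] by simp
  finally show ?thesis using 0 by simp
qed

end


section \<open>Germs of representation varieties along a central extension\<close>

lemma group_Cstar: "group Cstar"
proof (rule groupI)
  show "\<exists>y\<in>carrier Cstar. y \<otimes>\<^bsub>Cstar\<^esub> x = \<one>\<^bsub>Cstar\<^esub>" if "x \<in> carrier Cstar" for x
    using that by (intro bexI[of _ "inverse x"]) (auto simp: Cstar_def)
qed (auto simp: Cstar_def)

definition adjugate2 :: "complex^2^2 \<Rightarrow> complex^2^2" where
  "adjugate2 A = (\<chi> i j. if i = j then A $ (if i = 1 then 2 else 1) $ (if i = 1 then 2 else 1)
    else - A $ i $ j)"

lemma adjugate2_mult: "adjugate2 A ** A = mat (det A)" "A ** adjugate2 A = mat (det A)"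
  by (auto simp: vec_eq_iff forall_2 adjugate2_def matrix_matrix_mult_def mat_def sum_2 det_2)

text \<open>Over \<open>2 \<times> 2\<close> matrices the centralizer of a non-scalar matrix is commutative.\<close>

lemma commuting_square_scalar:
  fixes A B C :: "complex^2^2"
  assumes AB: "A ** B = B ** A" and AC: "A ** C = C ** A" and BC: "B ** C \<noteq> C ** B"
  shows "A ** A = mat (det A)"
proof -
  \<comment> \<open>Commutation sees only the two off-diagonal entries and the difference of the
    diagonal entries: it says that these triples of \<open>X\<close> and \<open>Y\<close> are
    proportional.\<close>
  have comm_iff: "X ** Y = Y ** X \<longleftrightarrow> X$1$2 * Y$2$1 = X$2$1 * Y$1$2 \<and>
      (X$1$1 - X$2$2) * Y$1$2 = X$1$2 * (Y$1$1 - Y$2$2) \<and>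
      (X$1$1 - X$2$2) * Y$2$1 = X$2$1 * (Y$1$1 - Y$2$2)" for X Y :: "complex^2^2"
    by (simp add: vec_eq_iff forall_2 matrix_matrix_mult_def sum_2) (auto simp: algebra_simps)
  \<comment> \<open>Two triples proportional to a common non-zero triple are proportional to each
    other. So if \<open>A\<close> is not scalar, \<open>B\<close> and \<open>C\<close>
    commute.\<close>
  have cross: "y1 * z2 = y2 * z1 \<and> y1 * z3 = y3 * z1 \<and> y2 * z3 = y3 * z2"
    if "x1 * y2 = x2 * y1" "x1 * y3 = x3 * y1" "x2 * y3 = x3 * y2"
      "x1 * z2 = x2 * z1" "x1 * z3 = x3 * z1" "x2 * z3 = x3 * z2" "x1 \<noteq> 0 \<or> x2 \<noteq> 0 \<or> x3 \<noteq> 0"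
    for x1 x2 x3 y1 y2 y3 z1 z2 z3 :: complex
  proof -
    have mult: "\<exists>l. w1 = l * x1 \<and> w2 = l * x2 \<and> w3 = l * x3"
      if "x1 * w2 = x2 * w1" "x1 * w3 = x3 * w1" "x2 * w3 = x3 * w2" for w1 w2 w3
    proof -
      consider "x1 \<noteq> 0" | "x2 \<noteq> 0" | "x3 \<noteq> 0" using \<open>x1 \<noteq> 0 \<or> x2 \<noteq> 0 \<or> x3 \<noteq> 0\<close> by blast
      then show ?thesis
      proof cases
        case 1 then show ?thesis using that by (intro exI[of _ "w1 / x1"]) (simp add: field_simps)
      next
        case 2 then show ?thesis using that by (intro exI[of _ "w2 / x2"]) (simp add: field_simps)
      next
        case 3 then show ?thesis using that by (intro exI[of _ "w3 / x3"]) (simp add: field_simps)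
      qed
    qed
    from mult[OF that(1-3)] obtain l where "y1 = l * x1" "y2 = l * x2" "y3 = l * x3" by blast
    moreover from mult[OF that(4-6)] obtain m where "z1 = m * x1" "z2 = m * x2" "z3 = m * x3" by
      blast
    ultimately show ?thesis by simp
  qed
  have "A$1$2 = 0 \<and> A$2$1 = 0 \<and> A$1$1 - A$2$2 = 0"
  proof (rule ccontr)
    assume "\<not> ?thesis"
    then have "B ** C = C ** B"
      using AB AC cross[of "A$1$2" "B$2$1" "A$2$1" "B$1$2" "B$1$1 - B$2$2" "A$1$1 - A$2$2"
        "C$2$1" "C$1$2" "C$1$1 - C$2$2"]
      unfolding comm_iff by (auto simp: mult.commute)
    then show False using BC by blast
  qed
  then show ?thesis by (simp add: vec_eq_iff forall_2 matrix_matrix_mult_def sum_2 mat_def det_2)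
qed

lemma group_SL2: "group SL2"
proof (rule groupI)
  show "\<exists>y\<in>carrier SL2. y \<otimes>\<^bsub>SL2\<^esub> x = \<one>\<^bsub>SL2\<^esub>" if "x \<in> carrier SL2" for x
  proof (intro bexI)
    show "adjugate2 x \<otimes>\<^bsub>SL2\<^esub> x = \<one>\<^bsub>SL2\<^esub>" using that by (simp add: SL2_def adjugate2_mult)
    then have "det (adjugate2 x) * det x = 1" by (simp add: SL2_def flip: det_mul)
    then show "adjugate2 x \<in> carrier SL2" using that by (simp add: SL2_def)
  qed
qed (auto simp: SL2_def det_mul matrix_mul_assoc)

lemma inv_Cstar: "x \<in> carrier Cstar \<Longrightarrow> inv\<^bsub>Cstar\<^esub> x = inverse x"
  by (rule group.inv_equality[OF group_Cstar]) (auto simp: Cstar_def)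

lemma inv_SL2: "x \<in> carrier SL2 \<Longrightarrow> inv\<^bsub>SL2\<^esub> x = adjugate2 x"
proof (rule group.inv_equality[OF group_SL2])
  assume x: "x \<in> carrier SL2"
  then show e: "adjugate2 x \<otimes>\<^bsub>SL2\<^esub> x = \<one>\<^bsub>SL2\<^esub>" by (simp add: SL2_def adjugate2_mult)
  then have "det (adjugate2 x) * det x = 1" by (simp add: SL2_def flip: det_mul)
  then show "adjugate2 x \<in> carrier SL2" using x by (simp add: SL2_def)
qed

section \<open>Values of representations as holomorphic functions of their values on
  generators\<close>

definition unit_coords :: "'g set \<Rightarrow> ('g \<times> unit \<Rightarrow> complex) set" where
  "unit_coords S = {z \<in> topspace (affine_space (S \<times> UNIV)). \<forall>s\<in>S. z (s, ()) \<noteq> 0}"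

lemma openin_unit_coords:
  assumes "finite S" shows "openin (affine_space (S \<times> UNIV)) (unit_coords S)"
proof -
  let ?X = "affine_space (S \<times> (UNIV :: unit set))"
  have "holomorphic_several (S \<times> (UNIV :: unit set)) (topspace ?X) (\<lambda>z. \<Prod>s\<in>S. z (s, ()))"
    using assms by (intro holomorphic_several_prod holomorphic_several_coord) auto
  from openin_nonzero[OF openin_topspace this] show ?thesis
    using assms by (simp add: unit_coords_def)
qed

lemma rep_coords_unit_coords:
  assumes "\<rho> \<in> hom G Cstar" "S \<subseteq> carrier G" shows "rep_coords (\<lambda>_ z. z) S \<rho> \<in> unit_coords S"
  using assms hom_in_carrier[OF assms(1)]
  by (auto simp: unit_coords_def affine_space_def rep_coords_def Cstar_def)

text \<open>Induction over words in the generators. Inverses of generators are the reason for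
  staying in \<open>unit_coords\<close>, where no coordinate vanishes.\<close>

lemma word_function_Cstar:
  assumes G: "group G" and S: "S \<subseteq> carrier G" and g: "g \<in> generate G S"
  shows "\<exists>\<Theta>. holomorphic_several (S \<times> UNIV) (unit_coords S) \<Theta> \<and>
     (\<forall>\<rho>\<in>hom G Cstar. \<Theta> (rep_coords (\<lambda>_ z. z) S \<rho>) = \<rho> g)"
  using g
proof (induction rule: generate.induct)
  case one
  have "\<rho> \<one>\<^bsub>G\<^esub> = 1" if "\<rho> \<in> hom G Cstar" for \<rho>
    using group_hom.hom_one[of G Cstar \<rho>] that G group_Cstar
    by (simp add: group_hom_def group_hom_axioms_def Cstar_def)
  then show ?case by (intro exI[of _ "\<lambda>_. 1"]) (simp add: holomorphic_several_const)
next
  case (incl s)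
  then show ?case
    by (intro exI[of _ "\<lambda>z. z (s, ())"]) (auto simp: rep_coords_def intro!:
      holomorphic_several_coord)
next
  case (inv s)
  have "\<rho> (inv\<^bsub>G\<^esub> s) = inverse (\<rho> s)" if \<rho>: "\<rho> \<in> hom G Cstar" for \<rho>
  proof -
    interpret group_hom G Cstar \<rho> using \<rho> G group_Cstar by (simp add: group_hom_def
      group_hom_axioms_def)
    have "s \<in> carrier G" using inv S by blast
    then show ?thesis by (simp add: inv_Cstar)
  qed
  then show ?case using inv
    by (intro exI[of _ "\<lambda>z. inverse (z (s, ()))"])
      (auto simp: rep_coords_def unit_coords_def intro!: holomorphic_several_coord
        holomorphic_several_inverse)
next
  case (eng g h)
  then obtain A B where AB: "holomorphic_several (S \<times> UNIV) (unit_coords S) A"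
    "\<forall>\<rho>\<in>hom G Cstar. A (rep_coords (\<lambda>_ z. z) S \<rho>) = \<rho> g"
    "holomorphic_several (S \<times> UNIV) (unit_coords S) B"
    "\<forall>\<rho>\<in>hom G Cstar. B (rep_coords (\<lambda>_ z. z) S \<rho>) = \<rho> h"
    by blast
  have "g \<in> carrier G" "h \<in> carrier G" using eng group.generate_in_carrier[OF G S] by auto
  then have "\<rho> (g \<otimes>\<^bsub>G\<^esub> h) = \<rho> g * \<rho> h" if "\<rho> \<in> hom G Cstar" for \<rho>
    using hom_mult[OF that] by (simp add: Cstar_def)
  then show ?case using AB
    by (intro exI[of _ "\<lambda>z. A z * B z"]) (auto intro: holomorphic_several_mult)
qed

text \<open>The inverse in \<open>SL2\<close> is the adjugate, which is polynomial in the entries;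
  the functions are polynomials, so \<open>U\<close> can be arbitrary.\<close>

lemma word_function_SL2:
  assumes G: "group G" and S: "S \<subseteq> carrier G" and g: "g \<in> generate G S"
  shows "\<exists>\<Theta>. (\<forall>c. holomorphic_several (S \<times> UNIV) U (\<Theta> c)) \<and>
     (\<forall>\<rho>\<in>hom G SL2. \<forall>c. \<Theta> c (rep_coords mat_entry S \<rho>) = mat_entry c (\<rho> g))"
  using g
proof (induction rule: generate.induct)
  case one
  have "\<rho> \<one>\<^bsub>G\<^esub> = mat 1" if "\<rho> \<in> hom G SL2" for \<rho>
    using group_hom.hom_one[of G SL2 \<rho>] that G group_SL2
    by (simp add: group_hom_def group_hom_axioms_def SL2_def)
  then show ?case by (intro exI[of _ "\<lambda>c _. mat_entry c (mat 1)"]) (simp add: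
    holomorphic_several_const)
next
  case (incl s)
  then show ?case
    by (intro exI[of _ "\<lambda>c z. z (s, c)"]) (auto simp: rep_coords_def intro!:
      holomorphic_several_coord)
next
  case (inv s)
  have "\<rho> (inv\<^bsub>G\<^esub> s) = adjugate2 (\<rho> s)" if \<rho>: "\<rho> \<in> hom G SL2" for \<rho>
  proof -
    interpret group_hom G SL2 \<rho> using \<rho> G group_SL2 by (simp add: group_hom_def
      group_hom_axioms_def)
    have "s \<in> carrier G" using inv S by blast
    then show ?thesis by (simp add: inv_SL2)
  qed
  moreover define \<Theta> :: "2 \<times> 2 \<Rightarrow> ('a \<times> 2 \<times> 2 \<Rightarrow> complex) \<Rightarrow> complex" where
    "\<Theta> c z = (let k = if fst c = 1 then 2 else 1 in if fst c = snd c then z (s, k, k) else - z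
      (s, c))" for c z
  have "holomorphic_several (S \<times> UNIV) U (\<Theta> c)" for c
    unfolding \<Theta>_def[abs_def] Let_def using inv
    by (cases "fst c = snd c") (auto intro!: holomorphic_several_coord holomorphic_several_uminus)
  moreover have "\<Theta> c (rep_coords mat_entry S \<rho>) = mat_entry c (adjugate2 (\<rho> s))" for c \<rho>
    using inv by (cases c) (simp add: \<Theta>_def rep_coords_def mat_entry_def adjugate2_def Let_def)
  ultimately show ?case by (intro exI[of _ \<Theta>]) simp
next
  case (eng g h)
  obtain A where A: "\<forall>c. holomorphic_several (S \<times> UNIV) U (A c)"
    "\<forall>\<rho>\<in>hom G SL2. \<forall>c. A c (rep_coords mat_entry S \<rho>) = mat_entry c (\<rho> g)" using eng.IH(1) by blast
  obtain B where B: "\<forall>c. holomorphic_several (S \<times> UNIV) U (B c)"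
    "\<forall>\<rho>\<in>hom G SL2. \<forall>c. B c (rep_coords mat_entry S \<rho>) = mat_entry c (\<rho> h)" using eng.IH(2) by blast
  have gh: "g \<in> carrier G" "h \<in> carrier G" using eng.hyps group.generate_in_carrier[OF G S] by auto
  define \<Theta> where "\<Theta> c z = A (fst c, 1) z * B (1, snd c) z + A (fst c, 2) z * B (2, snd c) z" for c z
  have "holomorphic_several (S \<times> UNIV) U (\<Theta> c)" for c
    unfolding \<Theta>_def[abs_def] using A(1) B(1) by (intro holomorphic_several_mult
      holomorphic_several_add) auto
  moreover have "\<Theta> c (rep_coords mat_entry S \<rho>) = mat_entry c (\<rho> (g \<otimes>\<^bsub>G\<^esub> h))" if \<rho>: "\<rho> \<in> hom G
    SL2" for c \<rho>
  proof -
    have "\<rho> (g \<otimes>\<^bsub>G\<^esub> h) = \<rho> g ** \<rho> h" using hom_mult[OF \<rho> gh] by (simp add: SL2_def)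
    then show ?thesis
      using A(2) B(2) \<rho> by (cases c) (simp add: \<Theta>_def matrix_matrix_mult_def sum_2 mat_entry_def)
  qed
  ultimately show ?case by (intro exI[of _ \<Theta>]) blast
qed

lemma matrix_mult_add_left:
  fixes A B C :: "complex^2^2" shows "(A + B) ** C = A ** C + B ** C"
  by (vector matrix_matrix_mult_def sum.distrib[symmetric] field_simps)

text \<open>What remains of the geometry is group theory: \<open>Z\<close> stands for the images of
  generators of \<pi>_1(K). The subgroup generated by \<open>Z\<close> contains the kernel of
  \<open>p\<close> but may be larger than it.\<close>

locale central_epi =
  fixes G1 :: "'g monoid" and G2 :: "'h monoid" and p :: "'g \<Rightarrow> 'h" and Z :: "'g set"
  assumes G1: "group G1" and G2: "group G2" and p_hom: "p \<in> hom G1 G2"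
    and surj: "p ` carrier G1 = carrier G2"
    and fg: "\<exists>S. generating_set G1 S"
    and finZ: "finite Z" and Z: "Z \<subseteq> carrier G1"
    and kernel: "g \<in> carrier G1 \<Longrightarrow> p g = \<one>\<^bsub>G2\<^esub> \<Longrightarrow> g \<in> generate G1 Z"
    and central: "c \<in> generate G1 Z \<Longrightarrow> g \<in> carrier G1 \<Longrightarrow> c \<otimes>\<^bsub>G1\<^esub> g = g \<otimes>\<^bsub>G1\<^esub> c"
    and killed: "c \<in> generate G1 Z \<Longrightarrow> additive_on G1 (carrier G1) \<phi> \<Longrightarrow> \<phi> c = 0"
begin

sublocale G1: group G1 by (rule G1)
sublocale G2: group G2 by (rule G2)
sublocale p: group_hom G1 G2 p using p_hom by unfold_locales

lemma fg2: "\<exists>S. generating_set G2 S"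
proof -
  obtain S where S: "generating_set G1 S" using fg by blast
  then have "generate G2 (p ` S) = p ` generate G1 S"
    unfolding generating_set_def using p.generate_img by metis
  then have "generating_set G2 (p ` S)"
    using S surj unfolding generating_set_def by auto
  then show ?thesis by blast
qed

lemma torsion: "c \<in> Z \<Longrightarrow> \<exists>n>0. c [^]\<^bsub>G1\<^esub> (n :: nat) \<in> derived G1 (carrier G1)"
  using fg Z killed[OF generate.incl] G1.torsion_mod_derived by (metis subsetD)

abbreviation "pull \<rho> \<equiv> restrict (\<rho> \<circ> p) (carrier G1)"

lemma lift_ex: "h \<in> carrier G2 \<Longrightarrow> \<exists>g\<in>carrier G1. p g = h"
  using surj by (metis imageE)

definition lft :: "'h \<Rightarrow> 'g" where "lft h = (SOME g. g \<in> carrier G1 \<and> p g = h)"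

lemma lft: "h \<in> carrier G2 \<Longrightarrow> lft h \<in> carrier G1" "h \<in> carrier G2 \<Longrightarrow> p (lft h) = h"
  using someI_ex[of "\<lambda>g. g \<in> carrier G1 \<and> p g = h"] lift_ex[of h] unfolding lft_def by blast+

lemma same_image:
  assumes "g \<in> carrier G1" "g' \<in> carrier G1" "p g = p g'"
  shows "\<exists>k\<in>generate G1 Z. g' = g \<otimes>\<^bsub>G1\<^esub> k"
proof (intro bexI)
  show "g' = g \<otimes>\<^bsub>G1\<^esub> (inv\<^bsub>G1\<^esub> g \<otimes>\<^bsub>G1\<^esub> g')" using assms by (simp flip: G1.m_assoc)
  show "inv\<^bsub>G1\<^esub> g \<otimes>\<^bsub>G1\<^esub> g' \<in> generate G1 Z" by (rule kernel) (use assms in auto)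
qed

lemma gen_carrier: "c \<in> generate G1 Z \<Longrightarrow> c \<in> carrier G1"
  using G1.generate_in_carrier[OF Z] .

lemma hom_trivial_on_generate:
  assumes "group A" "\<rho> \<in> hom G1 A" "\<And>c. c \<in> Z \<Longrightarrow> \<rho> c = \<one>\<^bsub>A\<^esub>" "c \<in> generate G1 Z"
  shows "\<rho> c = \<one>\<^bsub>A\<^esub>"
proof -
  interpret group_hom G1 A \<rho> using assms G1 by (simp add: group_hom_def group_hom_axioms_def)
  have "Z \<subseteq> kernel G1 A \<rho>" using assms(3) Z by (auto simp: kernel_def)
  then have "generate G1 Z \<subseteq> kernel G1 A \<rho>" by (rule G1.generate_subgroup_incl[OF _
    subgroup_kernel])
  then show ?thesis using assms(4) by (auto simp: kernel_def)
qed

lemma pull_hom: "\<rho> \<in> rep_variety G2 A \<Longrightarrow> pull \<rho> \<in> rep_variety G1 A"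
  unfolding rep_variety_def hom_def by auto

lemma pull_inj: "inj_on pull (rep_variety G2 A)"
proof (rule inj_onI)
  fix \<rho> \<rho>' assume r: "\<rho> \<in> rep_variety G2 A" "\<rho>' \<in> rep_variety G2 A" "pull \<rho> = pull \<rho>'"
  show "\<rho> = \<rho>'"
  proof
    fix h show "\<rho> h = \<rho>' h"
    proof (cases "h \<in> carrier G2")
      case True
      then show ?thesis using fun_cong[OF r(3), of "lft h"] lft[OF True] by simp
    next
      case False then show ?thesis using r(1,2) by (auto simp: rep_variety_def extensional_def)
    qed
  qed
qed

text \<open>Triviality on \<open>Z\<close> gives triviality on the kernel of \<open>p\<close>, so
  \<rho> is constant on the fibres of \<open>p\<close> and descends along the set-theoretic section
  \<open>lft\<close>.\<close>

lemma pull_onto: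
  assumes A: "group A" and \<rho>: "\<rho> \<in> rep_variety G1 A" and triv: "\<And>c. c \<in> Z \<Longrightarrow> \<rho> c = \<one>\<^bsub>A\<^esub>"
  shows "\<exists>\<sigma>\<in>rep_variety G2 A. pull \<sigma> = \<rho>"
proof -
  interpret A: group A by (rule A)
  have hom: "\<rho> \<in> hom G1 A" and ext: "\<rho> \<in> extensional (carrier G1)" using \<rho> by (auto simp:
    rep_variety_def)
  have same: "\<rho> g = \<rho> g'" if "g \<in> carrier G1" "g' \<in> carrier G1" "p g = p g'" for g g'
  proof -
    from same_image[OF that] obtain k where k: "k \<in> generate G1 Z" "g' = g \<otimes>\<^bsub>G1\<^esub> k" by blast
    then show ?thesis
      using hom_trivial_on_generate[OF A hom triv k(1)] hom_mult[OF hom that(1) gen_carrier[OF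
        k(1)]]
        hom_in_carrier[OF hom that(1)] by simp
  qed
  define \<sigma> where "\<sigma> = restrict (\<lambda>h. \<rho> (lft h)) (carrier G2)"
  have "\<sigma> \<in> hom G2 A"
  proof (rule homI)
    show "\<sigma> x \<in> carrier A" if "x \<in> carrier G2" for x
      using that lft hom_in_carrier[OF hom] by (simp add: \<sigma>_def)
    fix x y assume xy: "x \<in> carrier G2" "y \<in> carrier G2"
    have "\<rho> (lft (x \<otimes>\<^bsub>G2\<^esub> y)) = \<rho> (lft x \<otimes>\<^bsub>G1\<^esub> lft y)"
      by (rule same) (use xy lft in auto)
    then show "\<sigma> (x \<otimes>\<^bsub>G2\<^esub> y) = \<sigma> x \<otimes>\<^bsub>A\<^esub> \<sigma> y"
      using xy lft hom_mult[OF hom] by (simp add: \<sigma>_def)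
  qed
  then have "\<sigma> \<in> rep_variety G2 A" by (simp add: rep_variety_def \<sigma>_def)
  moreover have "pull \<sigma> = \<rho>"
  proof
    fix g show "pull \<sigma> g = \<rho> g"
    proof (cases "g \<in> carrier G1")
      case True
      then show ?thesis using same[of "lft (p g)" g] lft[of "p g"] by (simp add: \<sigma>_def)
    next
      case False then show ?thesis using ext by (simp add: extensional_def)
    qed
  qed
  ultimately show ?thesis by blast
qed

text \<open>Representations take values in \<open>A\<close>, while word functions and the
  neighbourhood \<open>V\<close> belong to the larger group \<open>H\<close>; with \<open>H\<close>
  equal to \<open>SL2\<close> a single neighbourhood serves all its subgroups. On \<open>V\<close>
  every representation kills \<open>Z\<close>, hence is a pullback.\<close>

lemma germ_iso_pull:
  fixes \<kappa> :: "'c \<Rightarrow> 'v \<Rightarrow> complex"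
  assumes A: "group A" and AH: "group H" and sub: "carrier A \<subseteq> carrier H" "\<And>x y. x \<otimes>\<^bsub>A\<^esub> y = x
    \<otimes>\<^bsub>H\<^esub> y" "\<one>\<^bsub>A\<^esub> = \<one>\<^bsub>H\<^esub>"
    and S1: "generating_set G1 S1" and S2: "generating_set G2 S2"
    and X1: "X1 \<subseteq> rep_variety G1 A" and X2: "X2 \<subseteq> rep_variety G2 A"
    and X: "\<And>\<rho>. \<rho> \<in> rep_variety G2 A \<Longrightarrow> \<rho> \<in> X2 \<longleftrightarrow> pull \<rho> \<in> X1"
    and U1: "openin (affine_space (S1 \<times> UNIV)) U1" 
    and U2: "openin (affine_space (S2 \<times> UNIV)) U2" "\<And>\<rho>. \<rho> \<in> hom G2 H \<Longrightarrow> rep_coords \<kappa> S2 \<rho> \<in> U2"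
    and W1: "\<And>g. g \<in> carrier G1 \<Longrightarrow> \<exists>\<Theta>. (\<forall>c. holomorphic_several (S1 \<times> UNIV) U1 (\<Theta> c)) \<and>
       (\<forall>\<rho>\<in>hom G1 H. \<forall>c. \<Theta> c (rep_coords \<kappa> S1 \<rho>) = \<kappa> c (\<rho> g))"
    and W2: "\<And>g. g \<in> carrier G2 \<Longrightarrow> \<exists>\<Theta>. (\<forall>c. holomorphic_several (S2 \<times> UNIV) U2 (\<Theta> c)) \<and>
       (\<forall>\<rho>\<in>hom G2 H. \<forall>c. \<Theta> c (rep_coords \<kappa> S2 \<rho>) = \<kappa> c (\<rho> g))"
    and V: "openin (affine_space (S1 \<times> UNIV)) V" "V \<subseteq> U1" "rep_coords \<kappa> S1 (\<lambda>g\<in>carrier G1. \<one>\<^bsub>H\<^esub>)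
      \<in> V"
    and Vtriv: "\<And>\<rho> c. \<rho> \<in> hom G1 H \<Longrightarrow> rep_coords \<kappa> S1 \<rho> \<in> V \<Longrightarrow> c \<in> Z \<Longrightarrow> \<rho> c = \<one>\<^bsub>H\<^esub>"
  shows "germ_iso (S2 \<times> UNIV) (rep_coords \<kappa> S2) X2 (\<lambda>g\<in>carrier G2. \<one>\<^bsub>H\<^esub>)
                  (S1 \<times> UNIV) (rep_coords \<kappa> S1) X1 (\<lambda>g\<in>carrier G1. \<one>\<^bsub>H\<^esub>) pull"
proof -
  interpret A: group A by (rule A)
  have S1c: "S1 \<subseteq> carrier G1" and S2c: "S2 \<subseteq> carrier G2" using S1 S2 by (auto simp:
    generating_set_def)
  have toH: "\<rho> \<in> hom G H" if "\<rho> \<in> rep_variety G A" for \<rho> :: "'z \<Rightarrow> 'v" and G :: "'z monoid"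
    using that sub by (auto simp: rep_variety_def hom_def)
  let ?a = "\<lambda>g\<in>carrier G2. \<one>\<^bsub>H\<^esub>" and ?b = "\<lambda>g\<in>carrier G1. \<one>\<^bsub>H\<^esub>"
  have a: "?a \<in> rep_variety G2 A" and Fa: "pull ?a = ?b"
    by (auto simp: rep_variety_def hom_def fun_eq_iff simp flip: sub(3))
  obtain \<Theta>2 where \<Theta>2: "\<And>g c. g \<in> carrier G2 \<Longrightarrow> holomorphic_several (S2 \<times> UNIV) U2 (\<Theta>2 g c)"
    "\<And>g \<rho> c. g \<in> carrier G2 \<Longrightarrow> \<rho> \<in> hom G2 H \<Longrightarrow> \<Theta>2 g c (rep_coords \<kappa> S2 \<rho>) = \<kappa> c (\<rho> g)"
    using W2 by metis
  obtain \<Theta>1 where \<Theta>1: "\<And>g c. g \<in> carrier G1 \<Longrightarrow> holomorphic_several (S1 \<times> UNIV) U1 (\<Theta>1 g c)"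
    "\<And>g \<rho> c. g \<in> carrier G1 \<Longrightarrow> \<rho> \<in> hom G1 H \<Longrightarrow> \<Theta>1 g c (rep_coords \<kappa> S1 \<rho>) = \<kappa> c (\<rho> g)"
    using W1 by metis
  \<comment> \<open>Pullback in coordinates evaluates a representation at \<open>p s\<close>, a word
    in \<open>S2\<close>. Its inverse \<open>\<Psi>\<close> evaluates at \<open>lft s\<close>, a
    word in \<open>S1\<close>.\<close>
  define \<Phi> where "\<Phi> z = (\<lambda>(s, c) \<in> S1 \<times> UNIV. \<Theta>2 (p s) c z)" for z
  define \<Psi> where "\<Psi> z = (\<lambda>(s, c) \<in> S2 \<times> UNIV. \<Theta>1 (lft s) c z)" for z
  have \<Phi>: "\<Phi> (rep_coords \<kappa> S2 \<rho>) = rep_coords \<kappa> S1 (pull \<rho>)" if "\<rho> \<in> hom G2 H" for \<rho>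
    unfolding \<Phi>_def rep_coords_def[of \<kappa> S1]
    by (rule restrict_ext) (use S1c \<Theta>2(2)[OF _ that] in \<open>auto simp: subset_iff\<close>)
  have \<Psi>: "\<Psi> (rep_coords \<kappa> S1 (pull \<rho>)) = rep_coords \<kappa> S2 \<rho>" if "\<rho> \<in> rep_variety G2 A" for \<rho>
    unfolding \<Psi>_def rep_coords_def[of \<kappa> S2]
    by (rule restrict_ext) (use S2c \<Theta>1(2)[OF _ toH[OF pull_hom[OF that]]] lft in \<open>auto simp:
      subset_iff\<close>)
  have \<Phi>hol: "holomorphic_several (S2 \<times> UNIV) U2 (\<lambda>z. \<Phi> z j)" if "j \<in> S1 \<times> UNIV" for j
    using that \<Theta>2(1)[of "p (fst j)" "snd j"] S1c by (auto simp: \<Phi>_def case_prod_unfold)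
  have \<Psi>hol: "holomorphic_several (S1 \<times> UNIV) V (\<lambda>z. \<Psi> z j)" if "j \<in> S2 \<times> UNIV" for j
  proof -
    have "lft (fst j) \<in> carrier G1" using that S2c lft by auto
    then show ?thesis
      using that holomorphic_several_mono[OF \<Theta>1(1) V(2), of "lft (fst j)" "snd j"] by (auto simp:
        \<Psi>_def case_prod_unfold)
  qed
  \<comment> \<open>Taking the full preimage of \<open>V\<close> makes the bijection exact: a point
    of \<open>X1\<close> in \<open>V\<close> descends, and what it descends to lies in
    \<open>U\<close>.\<close>
  define U where "U = {z \<in> U2. \<Phi> z \<in> V}"
  have U: "openin (affine_space (S2 \<times> UNIV)) U"
  proof -
    have "continuous_map (subtopology (affine_space (S2 \<times> UNIV)) U2) (affine_space (S1 \<times> UNIV)) \<Phi>"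
      unfolding affine_space_def[of "S1 \<times> UNIV"] continuous_map_componentwise
      using \<Phi>hol by (auto simp: holomorphic_several_def \<Phi>_def)
    from openin_continuous_map_preimage[OF this V(1)]
    have "openin (subtopology (affine_space (S2 \<times> UNIV)) U2) U"
      using openin_subset[OF U2(1)] by (simp add: U_def Int_absorb1)
    then show ?thesis using U2(1) openin_trans_full by blast
  qed
  have "bij_betw pull {x \<in> X2. rep_coords \<kappa> S2 x \<in> U} {y \<in> X1. rep_coords \<kappa> S1 y \<in> V}"
    unfolding bij_betw_def
  proof
    show "inj_on pull {x \<in> X2. rep_coords \<kappa> S2 x \<in> U}"
      by (rule inj_on_subset[OF pull_inj]) (use X2 in blast)
    show "pull ` {x \<in> X2. rep_coords \<kappa> S2 x \<in> U} = {y \<in> X1. rep_coords \<kappa> S1 y \<in> V}"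
    proof (intro equalityI subsetI)
      fix y assume "y \<in> pull ` {x \<in> X2. rep_coords \<kappa> S2 x \<in> U}"
      then obtain x where "x \<in> X2" "rep_coords \<kappa> S2 x \<in> U" "y = pull x" by blast
      then show "y \<in> {y \<in> X1. rep_coords \<kappa> S1 y \<in> V}"
        using X[of x] X2 \<Phi>[of x] toH[of x G2] by (auto simp: U_def)
    next
      fix y assume y: "y \<in> {y \<in> X1. rep_coords \<kappa> S1 y \<in> V}"
      then have y1: "y \<in> rep_variety G1 A" using X1 by blast
      have "\<exists>\<sigma>\<in>rep_variety G2 A. pull \<sigma> = y"
        by (rule pull_onto[OF A y1]) (use Vtriv[OF toH[OF y1]] y sub(3) in auto)
      then obtain x where x: "x \<in> rep_variety G2 A" "pull x = y" by blast
      then have "x \<in> X2" "rep_coords \<kappa> S2 x \<in> U"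
        using X[of x] y \<Phi>[of x] toH[of x G2] U2(2) by (auto simp: U_def)
      then show "y \<in> pull ` {x \<in> X2. rep_coords \<kappa> S2 x \<in> U}" using x by blast
    qed
  qed
  moreover have "\<forall>x\<in>X2. rep_coords \<kappa> S2 x \<in> U \<longrightarrow>
     \<Phi> (rep_coords \<kappa> S2 x) = rep_coords \<kappa> S1 (pull x) \<and> \<Psi> (rep_coords \<kappa> S1 (pull x)) = rep_coords
       \<kappa> S2 x"
    using X2 \<Phi> \<Psi> toH by blast
  moreover have "rep_coords \<kappa> S2 ?a \<in> U"
    using \<Phi>[of ?a] toH[OF a] U2(2) V(3) Fa by (simp add: U_def)
  moreover have "\<forall>j\<in>S1 \<times> UNIV. holomorphic_several (S2 \<times> UNIV) U (\<lambda>z. \<Phi> z j)"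
    using \<Phi>hol holomorphic_several_mono[of _ U2 _ U] by (auto simp: U_def)
  ultimately show ?thesis
    unfolding germ_iso_def using U V(1,3) \<Psi>hol X[OF a] Fa
    by (intro conjI exI[of _ U] exI[of _ V] exI[of _ \<Phi>] exI[of _ \<Psi>]) (simp_all only: ball_simps
      simp_thms Ball_def, blast?)
qed

text \<open>Cocycles for the pulled back character vanish on the kernel of \<open>p\<close>, so they
  descend. For the trivial character they are additive, and \<open>killed\<close> applies. Otherwise
  take \<open>g\<close> with non-trivial value: computing \<open>f\<close> on the two equal products
  of \<open>g\<close> with a kernel element \<open>k\<close> gives
  \<open>(pull \<rho> g - 1) * f k = 0\<close>.\<close>

lemma dim_H1_pull:
  assumes \<rho>: "\<rho> \<in> rep_variety G2 Cstar"
  shows "dim_H1_ge G2 \<rho> s \<longleftrightarrow> dim_H1_ge G1 (pull \<rho>) s"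
proof -
  have hom: "\<rho> \<in> hom G2 Cstar" using \<rho> by (simp add: rep_variety_def)
  have hom1: "pull \<rho> \<in> hom G1 Cstar" using pull_hom[OF \<rho>] by (simp add: rep_variety_def)
  have ker1: "pull \<rho> k = 1" if "k \<in> carrier G1" "p k = \<one>\<^bsub>G2\<^esub>" for k
    using that group_hom.hom_one[of G2 Cstar \<rho>] hom G2 group_Cstar
    by (simp add: group_hom_def group_hom_axioms_def Cstar_def)
  have vanish: "f k = 0" if f: "f \<in> twisted_cocycles G1 (pull \<rho>)" and k: "k \<in> carrier G1" "p k =
    \<one>\<^bsub>G2\<^esub>" for f k
  proof (cases "\<forall>g\<in>carrier G1. pull \<rho> g = 1")
    case True
    then have "additive_on G1 (carrier G1) f"
      using f by (auto simp: additive_on_def twisted_cocycles_def)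
    then show ?thesis using killed kernel[OF k] by blast
  next
    case False
    then obtain g where g: "g \<in> carrier G1" "pull \<rho> g \<noteq> 1" by blast
    have "f (g \<otimes>\<^bsub>G1\<^esub> k) = f g + pull \<rho> g * f k" "f (k \<otimes>\<^bsub>G1\<^esub> g) = f k + pull \<rho> k * f g"
      using f g k unfolding twisted_cocycles_def by blast+
    then have "f g + pull \<rho> g * f k = f k + f g"
      using central[OF kernel[OF k] g(1)] ker1[OF k] by simp
    then have "(pull \<rho> g - 1) * f k = 0" by (simp add: algebra_simps)
    then show ?thesis using g(2) by simp
  qed
  show ?thesis
  proof
    assume "dim_H1_ge G2 \<rho> s"
    then obtain f where f: "\<forall>i<s. f i \<in> twisted_cocycles G2 \<rho>"
      "\<forall>c. (\<lambda>g. \<Sum>i<s. c i * f i g) \<in> twisted_coboundaries G2 \<rho> \<longrightarrow> (\<forall>i<s. c i = 0)"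
      unfolding dim_H1_ge_def by blast
    have "\<forall>i<s. f i \<circ> p \<in> twisted_cocycles G1 (pull \<rho>)"
      using f(1) by (auto simp: twisted_cocycles_def)
    moreover have "\<forall>i<s. c i = 0" if c: "(\<lambda>g. \<Sum>i<s. c i * (f i \<circ> p) g) \<in> twisted_coboundaries G1
      (pull \<rho>)" for c
    proof -
      obtain d where d: "\<forall>g\<in>carrier G1. (\<Sum>i<s. c i * f i (p g)) = pull \<rho> g * d - d"
        using c unfolding twisted_coboundaries_def by auto
      have "(\<Sum>i<s. c i * f i h) = \<rho> h * d - d" if "h \<in> carrier G2" for h
        using d lft[OF that] by (auto dest: bspec[of _ _ "lft h"])
      then show ?thesis using f(2) unfolding twisted_coboundaries_def by blast
    qed
    ultimately show "dim_H1_ge G1 (pull \<rho>) s" unfolding dim_H1_ge_def by (intro exI[of _ "\<lambda>i. f i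
      \<circ> p"]) blast
  next
    assume "dim_H1_ge G1 (pull \<rho>) s"
    then obtain f where f: "\<forall>i<s. f i \<in> twisted_cocycles G1 (pull \<rho>)"
      "\<forall>c. (\<lambda>g. \<Sum>i<s. c i * f i g) \<in> twisted_coboundaries G1 (pull \<rho>) \<longrightarrow> (\<forall>i<s. c i = 0)"
      unfolding dim_H1_ge_def by blast
    have same: "f i g = f i g'" if i: "i < s" and g: "g \<in> carrier G1" "g' \<in> carrier G1" "p g = p
      g'" for i g g'
    proof -
      let ?k = "inv\<^bsub>G1\<^esub> g \<otimes>\<^bsub>G1\<^esub> g'"
      have k: "?k \<in> carrier G1" "p ?k = \<one>\<^bsub>G2\<^esub>" using g by auto
      have "g' = g \<otimes>\<^bsub>G1\<^esub> ?k" using g by (simp flip: G1.m_assoc)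
      then have "f i g' = f i g + pull \<rho> g * f i ?k"
        using f(1) i g k unfolding twisted_cocycles_def by (metis (mono_tags, lifting)
          mem_Collect_eq)
      then show ?thesis using vanish[OF _ k] f(1) i by simp
    qed
    have fl: "f i (lft (p g)) = f i g" if "i < s" "g \<in> carrier G1" for i g
      using same[OF that(1), of "lft (p g)" g] lft[of "p g"] that by simp
    have "(\<lambda>h. f i (lft h)) \<in> twisted_cocycles G2 \<rho>" if i: "i < s" for i
      unfolding twisted_cocycles_def
    proof (intro CollectI ballI)
      fix h h' assume h: "h \<in> carrier G2" "h' \<in> carrier G2"
      have "f i (lft (h \<otimes>\<^bsub>G2\<^esub> h')) = f i (lft h \<otimes>\<^bsub>G1\<^esub> lft h')"
        by (rule same[OF i]) (use h lft in auto)
      also have "\<dots> = f i (lft h) + pull \<rho> (lft h) * f i (lft h')"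
        using f(1) i lft h unfolding twisted_cocycles_def by blast
      finally show "f i (lft (h \<otimes>\<^bsub>G2\<^esub> h')) = f i (lft h) + \<rho> h * f i (lft h')"
        using lft[OF h(1)] by simp
    qed
    moreover have "\<forall>i<s. c i = 0" if c: "(\<lambda>h. \<Sum>i<s. c i * f i (lft h)) \<in> twisted_coboundaries G2
      \<rho>" for c
    proof -
      obtain d where d: "\<forall>h\<in>carrier G2. (\<Sum>i<s. c i * f i (lft h)) = \<rho> h * d - d"
        using c unfolding twisted_coboundaries_def by auto
      have "(\<Sum>i<s. c i * f i g) = pull \<rho> g * d - d" if g: "g \<in> carrier G1" for g
      proof -
        have "(\<Sum>i<s. c i * f i g) = (\<Sum>i<s. c i * f i (lft (p g)))"
          using fl[OF _ g] by (intro sum.cong) auto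
        then show ?thesis using d g by simp
      qed
      then show ?thesis using f(2) unfolding twisted_coboundaries_def by blast
    qed
    ultimately show "dim_H1_ge G2 \<rho> s"
      unfolding dim_H1_ge_def by (intro exI[of _ "\<lambda>i h. f i (lft h)"]) blast
  qed
qed

lemma trivial_hom: "group H \<Longrightarrow> (\<lambda>g\<in>carrier G1. \<one>\<^bsub>H\<^esub>) \<in> hom G1 H"
proof -
  assume "group H"
  then interpret H: group H .
  show ?thesis by (auto simp: hom_def)
qed

section \<open>Neighbourhoods of the trivial representation on which the central generators act
  trivially\<close>

lemma kill_nbhd:
  assumes H: "group H" and U: "openin (affine_space (S \<times> UNIV)) U" "rep_coords \<kappa> S (\<lambda>g\<in>carrier
    G1. \<one>\<^bsub>H\<^esub>) \<in> U"
    and f: "\<And>c. c \<in> Z \<Longrightarrow> \<exists>f. holomorphic_several (S \<times> UNIV) U f \<and>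
      f (rep_coords \<kappa> S (\<lambda>g\<in>carrier G1. \<one>\<^bsub>H\<^esub>)) \<noteq> 0 \<and>
      (\<forall>\<rho>\<in>hom G1 H. f (rep_coords \<kappa> S \<rho>) \<noteq> 0 \<longrightarrow> \<rho> c = \<one>\<^bsub>H\<^esub>)"
  obtains V where "openin (affine_space (S \<times> UNIV)) V" "V \<subseteq> U"
    "rep_coords \<kappa> S (\<lambda>g\<in>carrier G1. \<one>\<^bsub>H\<^esub>) \<in> V"
    "\<And>\<rho> c. \<rho> \<in> hom G1 H \<Longrightarrow> rep_coords \<kappa> S \<rho> \<in> V \<Longrightarrow> c \<in> Z \<Longrightarrow> \<rho> c = \<one>\<^bsub>H\<^esub>"
proof -
  obtain F where F: "\<And>c. c \<in> Z \<Longrightarrow> holomorphic_several (S \<times> UNIV) U (F c) \<and>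
      F c (rep_coords \<kappa> S (\<lambda>g\<in>carrier G1. \<one>\<^bsub>H\<^esub>)) \<noteq> 0 \<and>
      (\<forall>\<rho>\<in>hom G1 H. F c (rep_coords \<kappa> S \<rho>) \<noteq> 0 \<longrightarrow> \<rho> c = \<one>\<^bsub>H\<^esub>)"
    using f by metis
  \<comment> \<open>As \<open>Z\<close> is finite, one product expresses all the non-vanishing
    conditions.\<close>
  define V where "V = {z \<in> U. (\<Prod>c\<in>Z. F c z) \<noteq> 0}"
  have "holomorphic_several (S \<times> UNIV) U (\<lambda>z. \<Prod>c\<in>Z. F c z)"
    using finZ F by (intro holomorphic_several_prod) auto
  then have "openin (affine_space (S \<times> UNIV)) V"
    unfolding V_def by (rule openin_nonzero[OF U(1)])
  moreover have "rep_coords \<kappa> S (\<lambda>g\<in>carrier G1. \<one>\<^bsub>H\<^esub>) \<in> V"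
    using U(2) F finZ by (simp add: V_def)
  moreover have "\<rho> c = \<one>\<^bsub>H\<^esub>" if "\<rho> \<in> hom G1 H" "rep_coords \<kappa> S \<rho> \<in> V" "c \<in> Z" for \<rho> c
    using F[OF that(3)] that finZ by (simp add: V_def)
  ultimately show thesis using that[of V] by (auto simp: V_def)
qed

text \<open>The exponent \<open>n\<close> depends on \<open>c\<close> only, not on \<rho>. The
  function is the sum of the first \<open>n\<close> powers of \<rho>(c), which has the value
  \<open>n\<close> at the trivial character.\<close>

lemma char_kill_function:
  assumes S: "S \<subseteq> carrier G1" "generate G1 S = carrier G1" and c: "c \<in> Z"
  shows "\<exists>f. holomorphic_several (S \<times> UNIV) (unit_coords S) f \<and>
      f (rep_coords (\<lambda>_ z. z) S (\<lambda>g\<in>carrier G1. \<one>\<^bsub>Cstar\<^esub>)) \<noteq> 0 \<and>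
      (\<forall>\<rho>\<in>hom G1 Cstar. f (rep_coords (\<lambda>_ z. z) S \<rho>) \<noteq> 0 \<longrightarrow> \<rho> c = \<one>\<^bsub>Cstar\<^esub>)"
proof -
  have cc: "c \<in> carrier G1" using c Z by blast
  obtain n :: nat where n: "n > 0" "c [^]\<^bsub>G1\<^esub> n \<in> derived G1 (carrier G1)" using torsion[OF c] by
    blast
  have "\<exists>\<Theta>. holomorphic_several (S \<times> UNIV) (unit_coords S) \<Theta> \<and>
     (\<forall>\<rho>\<in>hom G1 Cstar. \<Theta> (rep_coords (\<lambda>_ z. z) S \<rho>) = \<rho> (c [^]\<^bsub>G1\<^esub> k))" for k :: nat
    using word_function_Cstar[OF G1 S(1), of "c [^]\<^bsub>G1\<^esub> k"] S(2) cc by simp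
  then obtain \<Theta> where \<Theta>: "\<And>k::nat. holomorphic_several (S \<times> UNIV) (unit_coords S) (\<Theta> k)"
    "\<And>k \<rho>. \<rho> \<in> hom G1 Cstar \<Longrightarrow> \<Theta> k (rep_coords (\<lambda>_ z. z) S \<rho>) = \<rho> (c [^]\<^bsub>G1\<^esub> k)" by metis
  define f where "f z = (\<Sum>k<n. \<Theta> k z)" for z
  have "holomorphic_several (S \<times> UNIV) (unit_coords S) f"
    unfolding f_def[abs_def] using \<Theta>(1) by (intro holomorphic_several_sum) auto
  moreover have "f (rep_coords (\<lambda>_ z. z) S (\<lambda>g\<in>carrier G1. \<one>\<^bsub>Cstar\<^esub>)) \<noteq> 0"
    using \<Theta>(2)[OF trivial_hom[OF group_Cstar]] cc n(1) by (simp add: f_def Cstar_def)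
  moreover have "\<rho> c = \<one>\<^bsub>Cstar\<^esub>" if \<rho>: "\<rho> \<in> hom G1 Cstar" "f (rep_coords (\<lambda>_ z. z) S \<rho>) \<noteq> 0" for \<rho>
  proof -
    interpret \<rho>: group_hom G1 Cstar \<rho> using \<rho> G1 group_Cstar by (simp add: group_hom_def
      group_hom_axioms_def)
    have one: "\<one>\<^bsub>Cstar\<^esub> = 1" by (simp add: Cstar_def)
    let ?P = "\<lambda>k::nat. \<rho> (c [^]\<^bsub>G1\<^esub> k)"
    have Suc: "?P (Suc k) = ?P k * \<rho> c" for k
      using \<rho>.hom_mult[of "c [^]\<^bsub>G1\<^esub> k" c] cc by (simp add: Cstar_def)
    have "?P n = 1"
      using hom_derived_trivial[OF \<rho>.group_hom_axioms _ n(2)] by (simp add: Cstar_def mult.commute)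
    \<comment> \<open>Telescoping: the sum of the powers times \<rho>(c) - 1 is the
      \<open>n\<close>-th power of \<rho>(c) minus 1.\<close>
    then have "(\<Sum>k<n. ?P (Suc k) - ?P k) = 0"
      using sum_lessThan_telescope[of ?P n] \<rho>.hom_one one by simp
    then have "(\<Sum>k<n. ?P k) * (\<rho> c - 1) = 0"
      by (simp only: Suc sum_distrib_right right_diff_distrib mult_1_right sum_subtractf)
    then show ?thesis using \<rho>(2) \<Theta>(2)[OF \<rho>(1)] one by (simp add: f_def)
  qed
  ultimately show ?thesis by blast
qed

lemma induces_char_germ_iso:
  "induces_germ_iso p G1 G2 (\<lambda>_ :: unit. \<lambda>z. z) 1 (char_variety s G1) (char_variety s G2)"
  unfolding induces_germ_iso_def
proof (intro conjI fg fg2 allI impI)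
  fix S1 S2 assume S: "generating_set G1 S1 \<and> generating_set G2 S2"
  then have S1: "finite S1" "S1 \<subseteq> carrier G1" "generate G1 S1 = carrier G1"
    and S2: "finite S2" "S2 \<subseteq> carrier G2" "generate G2 S2 = carrier G2" by (auto simp:
      generating_set_def)
  obtain V where V: "openin (affine_space (S1 \<times> UNIV)) V" "V \<subseteq> unit_coords S1"
    "rep_coords (\<lambda>_ z. z) S1 (\<lambda>g\<in>carrier G1. \<one>\<^bsub>Cstar\<^esub>) \<in> V"
    "\<And>\<rho> c. \<rho> \<in> hom G1 Cstar \<Longrightarrow> rep_coords (\<lambda>_ z. z) S1 \<rho> \<in> V \<Longrightarrow> c \<in> Z \<Longrightarrow> \<rho> c = \<one>\<^bsub>Cstar\<^esub>"
    by (rule kill_nbhd[OF group_Cstar openin_unit_coords[OF S1(1)]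
          rep_coords_unit_coords[OF trivial_hom[OF group_Cstar] S1(2)] char_kill_function[OF
            S1(2,3)]]) auto
  have words: "\<exists>\<Theta>. (\<forall>c :: unit. holomorphic_several (S \<times> UNIV) (unit_coords S) (\<Theta> c)) \<and>
       (\<forall>\<rho>\<in>hom G Cstar. \<forall>c. \<Theta> c (rep_coords (\<lambda>_ z. z) S \<rho>) = \<rho> g)"
    if G: "group G" "S \<subseteq> carrier G" "g \<in> generate G S" for G :: "'z monoid" and S g
  proof -
    obtain \<Theta> where "holomorphic_several (S \<times> UNIV) (unit_coords S) \<Theta>"
      "\<forall>\<rho>\<in>hom G Cstar. \<Theta> (rep_coords (\<lambda>_ z. z) S \<rho>) = \<rho> g"
      using word_function_Cstar[OF G] by blast
    then show ?thesis by (intro exI[of _ "\<lambda>_. \<Theta>"]) simp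
  qed
  have "germ_iso (S2 \<times> UNIV) (rep_coords (\<lambda>_ :: unit. \<lambda>z. z) S2) (char_variety s G2) (\<lambda>g\<in>carrier
    G2. \<one>\<^bsub>Cstar\<^esub>)
     (S1 \<times> UNIV) (rep_coords (\<lambda>_ :: unit. \<lambda>z. z) S1) (char_variety s G1) (\<lambda>g\<in>carrier G1.
       \<one>\<^bsub>Cstar\<^esub>) pull"
  proof (rule germ_iso_pull[where A = Cstar and H = Cstar and ?U1.0 = "unit_coords S1" and ?U2.0
    = "unit_coords S2" and V = V])
    show "openin (affine_space (S1 \<times> UNIV)) (unit_coords S1)" "openin (affine_space (S2 \<times> UNIV))
      (unit_coords S2)"
      using openin_unit_coords S1(1) S2(1) by auto
    show "rep_coords (\<lambda>_ z. z) S2 \<rho> \<in> unit_coords S2" if "\<rho> \<in> hom G2 Cstar" for \<rho>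
      using rep_coords_unit_coords[OF that S2(2)] .
    show "\<rho> c = \<one>\<^bsub>Cstar\<^esub>" if "\<rho> \<in> hom G1 Cstar" "rep_coords (\<lambda>_ z. z) S1 \<rho> \<in> V" "c \<in> Z" for \<rho> c
      using V(4)[OF that] .
    show "\<rho> \<in> char_variety s G2 \<longleftrightarrow> pull \<rho> \<in> char_variety s G1" if "\<rho> \<in> rep_variety G2 Cstar" for \<rho>
      using that pull_hom[OF that] dim_H1_pull[OF that] by (simp add: char_variety_def)
  qed (use words[OF G1 S1(2)] words[OF G2 S2(2)] S1(3) S2(3) S V(1-3) group_Cstar in \<open>auto simp:
    char_variety_def\<close>)
  then show "germ_iso (S2 \<times> UNIV) (rep_coords (\<lambda>_ :: unit. \<lambda>z. z) S2) (char_variety s G2)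
    (\<lambda>g\<in>carrier G2. 1)
     (S1 \<times> UNIV) (rep_coords (\<lambda>_ :: unit. \<lambda>z. z) S1) (char_variety s G1) (\<lambda>g\<in>carrier G1. 1) (\<lambda>\<rho>.
       pull \<rho>)"
    by (simp add: Cstar_def)
qed

text \<open>The exponent \<open>2 * n\<close> covers both alternatives. If the image of \<rho> is
  commutative, the \<open>n\<close>-th power of \<open>c\<close> is killed as an element of the
  derived subgroup. Otherwise the square of \<rho>(c) is its determinant, which is 1.\<close>

lemma SL2_central_power:
  assumes c: "c \<in> Z" and n: "c [^]\<^bsub>G1\<^esub> (n :: nat) \<in> derived G1 (carrier G1)" and \<rho>: "\<rho> \<in> hom G1 SL2"
  shows "\<rho> (c [^]\<^bsub>G1\<^esub> (2 * n)) = mat 1"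
proof -
  interpret \<rho>: group_hom G1 SL2 \<rho> using \<rho> G1 group_SL2 by (simp add: group_hom_def
    group_hom_axioms_def)
  have cc: "c \<in> carrier G1" using c Z by blast
  have one: "\<one>\<^bsub>SL2\<^esub> = mat 1" and mul: "A \<otimes>\<^bsub>SL2\<^esub> B = A ** B" for A B by (simp_all add: SL2_def)
  show ?thesis
  proof (cases "\<forall>x\<in>carrier G1. \<forall>y\<in>carrier G1. \<rho> x ** \<rho> y = \<rho> y ** \<rho> x")
    case True
    then have "\<rho> (c [^]\<^bsub>G1\<^esub> n) = \<one>\<^bsub>SL2\<^esub>"
      by (intro hom_derived_trivial[OF \<rho>.group_hom_axioms _ n]) (simp add: mul)
    moreover have "c [^]\<^bsub>G1\<^esub> (2 * n) = c [^]\<^bsub>G1\<^esub> n \<otimes>\<^bsub>G1\<^esub> c [^]\<^bsub>G1\<^esub> n"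
      using cc by (simp add: G1.nat_pow_mult mult_2)
    ultimately show ?thesis using cc by (simp add: one mul)
  next
    case False
    then obtain x y where xy: "x \<in> carrier G1" "y \<in> carrier G1" "\<rho> x ** \<rho> y \<noteq> \<rho> y ** \<rho> x" by blast
    have comm: "\<rho> c ** \<rho> g = \<rho> g ** \<rho> c" if "g \<in> carrier G1" for g
      using central[OF generate.incl[OF c] that] \<rho>.hom_mult[OF cc that] \<rho>.hom_mult[OF that cc]
        mul by metis
    have "\<rho> c ** \<rho> c = mat (det (\<rho> c))"
      by (rule commuting_square_scalar[OF comm[OF xy(1)] comm[OF xy(2)] xy(3)])
    moreover have "det (\<rho> c) = 1" using \<rho>.hom_closed[OF cc] by (simp add: SL2_def)
    moreover have "c [^]\<^bsub>G1\<^esub> (2::nat) = c \<otimes>\<^bsub>G1\<^esub> c" using cc by (simp add: numeral_2_eq_2)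
    ultimately have "\<rho> (c [^]\<^bsub>G1\<^esub> (2::nat)) = \<one>\<^bsub>SL2\<^esub>" using cc by (simp add: one mul)
    then have "\<rho> ((c [^]\<^bsub>G1\<^esub> (2::nat)) [^]\<^bsub>G1\<^esub> n) = \<one>\<^bsub>SL2\<^esub>"
      using cc \<rho>.hom_nat_pow[of "c [^]\<^bsub>G1\<^esub> (2::nat)" n] by simp
    moreover have "c [^]\<^bsub>G1\<^esub> (2 * n) = (c [^]\<^bsub>G1\<^esub> (2::nat)) [^]\<^bsub>G1\<^esub> n" using cc by (simp add:
      G1.nat_pow_pow)
    ultimately show ?thesis using one by simp
  qed
qed

text \<open>The function is the determinant of the sum \<open>M m\<close> of the first
  \<open>m\<close> powers of \<rho>(c). At the trivial representation this matrix is
  \<open>m\<close> times the identity. Since \<open>M m ** \<rho> c = M m\<close>, an invertible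
  \<open>M m\<close> forces \<rho>(c) to be the identity.\<close>

lemma SL2_kill_function:
  assumes S: "S \<subseteq> carrier G1" "generate G1 S = carrier G1" and c: "c \<in> Z"
  shows "\<exists>f. holomorphic_several (S \<times> UNIV) U f \<and>
      f (rep_coords mat_entry S (\<lambda>g\<in>carrier G1. \<one>\<^bsub>SL2\<^esub>)) \<noteq> 0 \<and>
      (\<forall>\<rho>\<in>hom G1 SL2. f (rep_coords mat_entry S \<rho>) \<noteq> 0 \<longrightarrow> \<rho> c = \<one>\<^bsub>SL2\<^esub>)"
proof -
  have cc: "c \<in> carrier G1" using c Z by blast
  have one: "\<one>\<^bsub>SL2\<^esub> = mat 1" by (simp add: SL2_def)
  obtain n :: nat where n: "n > 0" "c [^]\<^bsub>G1\<^esub> n \<in> derived G1 (carrier G1)" using torsion[OF c] by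
    blast
  define m where "m = 2 * n"
  have "\<exists>\<Theta>. (\<forall>i. holomorphic_several (S \<times> UNIV) U (\<Theta> i)) \<and>
     (\<forall>\<rho>\<in>hom G1 SL2. \<forall>i. \<Theta> i (rep_coords mat_entry S \<rho>) = mat_entry i (\<rho> (c [^]\<^bsub>G1\<^esub> k)))" for k
       :: nat
    using word_function_SL2[OF G1 S(1), of "c [^]\<^bsub>G1\<^esub> k"] S(2) cc by simp
  then obtain \<Theta> where \<Theta>: "\<And>(k::nat) i. holomorphic_several (S \<times> UNIV) U (\<Theta> k i)"
    "\<And>k i \<rho>. \<rho> \<in> hom G1 SL2 \<Longrightarrow> \<Theta> k i (rep_coords mat_entry S \<rho>) = mat_entry i (\<rho> (c [^]\<^bsub>G1\<^esub> k))"
      by metis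
  define h where "h i z = (\<Sum>k<m. \<Theta> k i z)" for i z
  define f where "f z = h (1, 1) z * h (2, 2) z + - (h (1, 2) z * h (2, 1) z)" for z
  have "holomorphic_several (S \<times> UNIV) U (h i)" for i
    unfolding h_def[abs_def] using \<Theta>(1) by (intro holomorphic_several_sum) auto
  then have "holomorphic_several (S \<times> UNIV) U f"
    unfolding f_def[abs_def] by (intro holomorphic_several_add holomorphic_several_uminus
      holomorphic_several_mult)
  moreover have "f (rep_coords mat_entry S (\<lambda>g\<in>carrier G1. \<one>\<^bsub>SL2\<^esub>)) \<noteq> 0"
    using \<Theta>(2)[OF trivial_hom[OF group_SL2]] cc n(1) by (simp add: f_def h_def one mat_entry_def
      mat_def m_def)
  moreover have "\<rho> c = \<one>\<^bsub>SL2\<^esub>" if \<rho>: "\<rho> \<in> hom G1 SL2" "f (rep_coords mat_entry S \<rho>) \<noteq> 0" for \<rho>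
  proof -
    interpret \<rho>: group_hom G1 SL2 \<rho> using \<rho> G1 group_SL2 by (simp add: group_hom_def
      group_hom_axioms_def)
    let ?P = "\<lambda>k::nat. \<rho> (c [^]\<^bsub>G1\<^esub> k)"
    define M where "M j = (\<Sum>k<j. ?P k)" for j
    have P_Suc: "?P (Suc k) = ?P k ** \<rho> c" for k
      using \<rho>.hom_mult[of "c [^]\<^bsub>G1\<^esub> k" c] cc by (simp add: SL2_def)
    \<comment> \<open>Telescoping written without subtraction; at \<open>j = m\<close> the term
      \<open>?P j\<close> is also the identity, and the two extra summands cancel.\<close>
    have tele: "M j ** \<rho> c + mat 1 = M j + ?P j" for j
    proof (induction j)
      case 0 then show ?case using \<rho>.hom_one by (simp add: M_def one)
    next
      case (Suc j)
      have "M (Suc j) ** \<rho> c + mat 1 = (M j ** \<rho> c + mat 1) + ?P j ** \<rho> c"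
        by (simp add: M_def matrix_mult_add_left)
      then show ?case using Suc.IH by (simp only: P_Suc) (simp add: M_def)
    qed
    have "M m ** \<rho> c = M m"
      using tele[of m] SL2_central_power[OF c n(2) \<rho>(1)] by (simp add: m_def)
    moreover have "det (M m) \<noteq> 0"
      using \<rho>(2) \<Theta>(2)[OF \<rho>(1)] by (simp add: f_def h_def det_2 M_def mat_entry_def)
    then obtain N where "N ** M m = mat 1" using invertible_det_nz invertible_def by metis
    ultimately show ?thesis by (metis matrix_mul_assoc matrix_mul_lid one)
  qed
  ultimately show ?thesis by blast
qed

text \<open>The coordinates and the neighbourhood are those of \<open>SL2\<close>, restricted to
  representations with values in \<open>G\<close>. The word functions are polynomial, so the whole
  affine spaces serve as ambient open sets.\<close>

lemma induces_rep_germ_iso: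
  assumes G: "subgroup G SL2"
  shows "induces_germ_iso p G1 G2 mat_entry (mat 1)
     (rep_variety G1 (SL2\<lparr>carrier := G\<rparr>)) (rep_variety G2 (SL2\<lparr>carrier := G\<rparr>))"
  unfolding induces_germ_iso_def
proof (intro conjI fg fg2 allI impI)
  fix S1 S2 assume S: "generating_set G1 S1 \<and> generating_set G2 S2"
  then have S1: "finite S1" "S1 \<subseteq> carrier G1" "generate G1 S1 = carrier G1"
    and S2: "finite S2" "S2 \<subseteq> carrier G2" "generate G2 S2 = carrier G2" by (auto simp:
      generating_set_def)
  let ?T1 = "topspace (affine_space (S1 \<times> (UNIV :: (2 \<times> 2) set)))" and ?T2 = "topspace
    (affine_space (S2 \<times> (UNIV :: (2 \<times> 2) set)))"
  have top: "rep_coords mat_entry S1 \<rho> \<in> ?T1" "rep_coords mat_entry S2 \<rho>' \<in> ?T2" for \<rho> \<rho>'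
    by (auto simp: affine_space_def rep_coords_def)
  obtain V where V: "openin (affine_space (S1 \<times> UNIV)) V" "V \<subseteq> ?T1"
    "rep_coords mat_entry S1 (\<lambda>g\<in>carrier G1. \<one>\<^bsub>SL2\<^esub>) \<in> V"
    "\<And>\<rho> c. \<rho> \<in> hom G1 SL2 \<Longrightarrow> rep_coords mat_entry S1 \<rho> \<in> V \<Longrightarrow> c \<in> Z \<Longrightarrow> \<rho> c = \<one>\<^bsub>SL2\<^esub>"
    by (rule kill_nbhd[OF group_SL2 openin_topspace top(1) SL2_kill_function[OF S1(2,3)]]) auto
  have A: "group (SL2\<lparr>carrier := G\<rparr>)" using group.subgroup_imp_group[OF group_SL2 G] .
  have "germ_iso (S2 \<times> UNIV) (rep_coords mat_entry S2) (rep_variety G2 (SL2\<lparr>carrier := G\<rparr>))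
    (\<lambda>g\<in>carrier G2. \<one>\<^bsub>SL2\<^esub>)
     (S1 \<times> UNIV) (rep_coords mat_entry S1) (rep_variety G1 (SL2\<lparr>carrier := G\<rparr>)) (\<lambda>g\<in>carrier G1.
       \<one>\<^bsub>SL2\<^esub>) pull"
  proof (rule germ_iso_pull[where A = "SL2\<lparr>carrier := G\<rparr>" and H = SL2 and ?U1.0 = ?T1 and ?U2.0 =
    ?T2 and V = V])
    show "\<rho> c = \<one>\<^bsub>SL2\<^esub>" if "\<rho> \<in> hom G1 SL2" "rep_coords mat_entry S1 \<rho> \<in> V" "c \<in> Z" for \<rho> c
      using V(4)[OF that] .
    show "carrier (SL2\<lparr>carrier := G\<rparr>) \<subseteq> carrier SL2" using subgroup.subset[OF G] by simp
    show "\<rho> \<in> rep_variety G2 (SL2\<lparr>carrier := G\<rparr>) \<longleftrightarrow> pull \<rho> \<in> rep_variety G1 (SL2\<lparr>carrier := G\<rparr>)"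
      if "\<rho> \<in> rep_variety G2 (SL2\<lparr>carrier := G\<rparr>)" for \<rho>
      using that pull_hom[OF that] by simp
  qed (use word_function_SL2[OF G1 S1(2)] word_function_SL2[OF G2 S2(2)] S1(3) S2(3) S V(1-3) A
    group_SL2 top in auto)
  then show "germ_iso (S2 \<times> UNIV) (rep_coords mat_entry S2) (rep_variety G2 (SL2\<lparr>carrier := G\<rparr>))
    (\<lambda>g\<in>carrier G2. mat 1)
     (S1 \<times> UNIV) (rep_coords mat_entry S1) (rep_variety G1 (SL2\<lparr>carrier := G\<rparr>)) (\<lambda>g\<in>carrier G1.
       mat 1) (\<lambda>\<rho>. pull \<rho>)"
    by (simp add: SL2_def)
qed

end


section \<open>From manifolds and Lie groups to the group-theoretic setting\<close>

lemma topological_group_lie: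
  assumes "lie_group K T" shows "topological_group K (mtop T)"
  using assms unfolding lie_group_def smooth_map_def topological_group_def prod_mfd_def by simp

lemma continuous_action_smooth:
  assumes G: "topological_group K (mtop T)" and a: "smooth_action K T M a"
  shows "continuous_action K (mtop T) (mtop M) a"
proof -
  interpret topological_group K "mtop T" by (rule G)
  have ga: "group_action K (topspace (mtop M)) a" using a by (simp add: smooth_action_def)
  have "continuous_map (prod_topology (mtop T) (mtop M)) (mtop M) (\<lambda>(k, x). a k x)"
    using a by (simp add: smooth_action_def smooth_map_def prod_mfd_def)
  then show ?thesis
    by unfold_locales (use group_action_apply[OF ga] in auto)
qed

text \<open>\<open>Z\<close> consists of the orbit classes of finitely many generators of the
  fundamental group of \<open>K\<close>; it generates the whole image of
  \<open>orbit_sharp\<close>.\<close>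

lemma (in borel_setup) central_epi:
  assumes fgX: "\<exists>S. generating_set X0.PI S" and fgT: "\<exists>S. generating_set T0.PI S"
    and inj: "inj_on (transgression K T E ea e0 X a x0 (Suc 0)) (primitive_space K T E ea e0 (Suc
      0))"
  shows "\<exists>Z. central_epi X0.PI B0.PI psharp Z"
proof -
  obtain S where S: "finite S" "S \<subseteq> carrier T0.PI" "generate T0.PI S = carrier T0.PI"
    using fgT by (auto simp: generating_set_def)
  interpret o: group_hom T0.PI X0.PI orbit_sharp
    by unfold_locales (rule orbit_sharp_hom)
  have gen: "generate X0.PI (orbit_sharp ` S) = orbit_sharp ` carrier T0.PI"
    using o.generate_img[OF S(2)] S(3) by simp
  have "central_epi X0.PI B0.PI psharp (orbit_sharp ` S)"
  proof (unfold_locales, goal_cases)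
    case 1 show ?case by (rule psharp_hom)
  next
    case 2 show ?case by (rule psharp_surj)
  next
    case 3 show ?case by (rule fgX)
  next
    case 4 show ?case using S(1) by simp
  next
    case 5 show ?case using S(2) o.hom_closed by blast
  next
    case (6 g) then show ?case unfolding gen by (rule psharp_kernel)
  next
    case (7 c g) then show ?case unfolding gen using orbit_sharp_central by blast
  next
    case (8 c \<phi>) then show ?case unfolding gen using kills_additive[OF inj] by blast
  qed
  then show ?thesis by blast
qed

theorem theorem1p5:
  fixes M :: "'m mfd" and K :: "'k monoid" and T :: "'k mfd" and a :: "'k \<Rightarrow> 'm \<Rightarrow> 'm"
    and E :: "'e topology" and ea :: "'k \<Rightarrow> 'e \<Rightarrow> 'e" and e0 :: 'e and x0 :: 'm
  defines "N \<equiv> orbit_space K (mtop M) a"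
    and "\<pi>M \<equiv> fundamental_group (mtop M) x0"
    and "\<pi>N \<equiv> orbifold_pi1 K E ea e0 (mtop M) a x0"
    and "psharp \<equiv> p_sharp K E ea e0 (mtop M) a x0"
  assumes "closed_connected_manifold M"
    and "compact_connected_lie_group K T"
    and "smooth_action K T M a"
    and "almost_free K (topspace (mtop M)) a"
    and "universal_bundle K (mtop T) E ea"
    and "e0 \<in> topspace E" and "x0 \<in> topspace (mtop M)"
    and "inj_on (transgression K (mtop T) E ea e0 (mtop M) a x0 1)
                (primitive_space K (mtop T) E ea e0 1)"
  shows "(has_two_finite_two_model TYPE('u) N \<longrightarrow>
            (\<forall>s. induces_germ_iso psharp \<pi>M \<pi>N (\<lambda>_ :: unit. \<lambda>z. z) 1
                   (char_variety s \<pi>M) (char_variety s \<pi>N)))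
       \<and> (two_formal TYPE('w) N \<longrightarrow>
            (\<forall>G. G = carrier SL2 \<or> borel_subgroup G \<longrightarrow>
               induces_germ_iso psharp \<pi>M \<pi>N mat_entry (mat 1)
                 (rep_variety \<pi>M (SL2\<lparr>carrier := G\<rparr>)) (rep_variety \<pi>N (SL2\<lparr>carrier := G\<rparr>))))"
proof -
  have lie: "lie_group K T" using assms(6) by (simp add: compact_connected_lie_group_def)
  have G: "topological_group K (mtop T)" by (rule topological_group_lie[OF lie])
  have M: "smooth_manifold M" "compact_space (mtop M)" "connected_space (mtop M)"
    "Hausdorff_space (mtop M)"
    using assms(5) by (auto simp: closed_connected_manifold_def smooth_manifold_def)
  have T: "smooth_manifold T" "compact_space (mtop T)" "connected_space (mtop T)"
    "Hausdorff_space (mtop T)"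
    using assms(6) by (auto simp: compact_connected_lie_group_def lie_group_def smooth_manifold_def)
  interpret E: principal_action K "mtop T" E ea
    by (rule principal_action_universal[OF G assms(9)])
  interpret X: continuous_action K "mtop T" "mtop M" a
    by (rule continuous_action_smooth[OF G assms(7)])
  interpret borel_setup K "mtop T" E ea "mtop M" a e0 x0
  proof
    show "contractible_space E" using assms(9) by (simp add: universal_bundle_def)
    show "path_connected_space (mtop T)" "path_connected_space (mtop M)"
      using M T by (auto intro: locally_simple_imp_path_connected smooth_manifold_locally_simple)
  qed (use assms in auto)
  \<comment> \<open>Compactness enters twice: generators for \<open>M\<close> make the
    representation varieties finite dimensional, and generators for \<open>K\<close> make
    \<open>Z\<close> finite.\<close>
  have "\<exists>S. generating_set X0.PI S" "\<exists>S. generating_set T0.PI S"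
    using X0.finitely_generated T0.finitely_generated M T smooth_manifold_locally_simple by auto
  then obtain Z where "central_epi X0.PI B0.PI (p_sharp K E ea e0 (mtop M) a x0) Z"
    using central_epi assms(12) by auto
  then interpret C: central_epi X0.PI B0.PI "p_sharp K E ea e0 (mtop M) a x0" Z .
  have "\<pi>N = B0.PI" by (simp add: \<pi>N_def orbifold_pi1_def)
  moreover have "subgroup G SL2" if "G = carrier SL2 \<or> borel_subgroup G" for G
    using that group.subgroup_self[OF group_SL2] by (auto simp: borel_subgroup_def
      connected_solvable_def)
  ultimately show ?thesis
    using C.induces_char_germ_iso C.induces_rep_germ_iso by (simp add: \<pi>M_def psharp_def)
qed

end
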